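(* Let $A_m=\frac1{m!}\sum_{\alpha\in\mathbb{S}_m}w_{\mathfrak{gl}}(\alpha)$. There are polynomials $a_{2k}(N)\in\mathbb{C}[N]$, $k=0,1,2,\dots$, with $a_0=1$ and $\deg a_{2k}=k$, not depending on $m$, such that for every $m\ge1$ $\Phi(A_m)=\sum_{k=0}^{\lfloor m/2\rfloor}(-1)^k a_{2k}(N)\,(N+m-1)_{2k}\,S_{m-2k}$, with $S_0=1$.
   Context: $(a)_\ell=a(a-1)\cdots(a-\ell+1)$ is the falling factorial. $w_{\mathfrak{gl}}$ is the universal $\mathfrak{gl}$-weight system with values in $\mathbb{C}[N,C_1,C_2,\dots]$: the unique function such that for every $N\ge1$ the specialization $C_k\mapsto w_{\mathfrak{gl}(N)}((1,\dots,k))$ gives $w_{\mathfrak{gl}(N)}(\alpha)=\sum_{i_1,\dots,i_m=1}^N E_{i_1i_{\alpha(1)}}\cdots E_{i_mi_{\alpha(m)}}\in ZU(\mathfrak{gl}(N))$. The Schur substitution is the $\mathbb{C}[N]$-algebra isomorphism $\Phi:\mathbb{C}[N][C_1,C_2,\dots]\to\mathbb{C}[N][S_1,S_2,\dots]$ determined by $1-Nu-\sum_{k\ge1}\Phi(C_k)u^{k+1}=\left(\frac{1-(N+1)u/2}{1-(N-1)u/2}\right)^N\frac{1+\sum_{i\ge1}S_i\big(\frac{u}{1-(N-1)u/2}\big)^i}{1+\sum_{i\ge1}S_i\big(\frac{u}{1-(N+1)u/2}\big)^i}$. *)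

theory Defs
  imports Complex_Main "HOL-Library.Poly_Mapping" "HOL-Library.FuncSet"
    "HOL-Combinatorics.Permutations"
    "HOL-Computational_Algebra.Polynomial"
    "HOL-Computational_Algebra.Formal_Power_Series"
begin

text \<open>Free associative algebra on the generators E_ij: finitely supported
  complex functions on words (lists of index pairs).\<close>
type_synonym fa = "(nat \<times> nat) list \<Rightarrow>\<^sub>0 complex"

definition fa_word :: "(nat \<times> nat) list \<Rightarrow> fa" where
  "fa_word w = Poly_Mapping.single w 1"

definition fa_scalar :: "complex \<Rightarrow> fa" where
  "fa_scalar c = Poly_Mapping.single [] c"

definition fa_mult :: "fa \<Rightarrow> fa \<Rightarrow> fa" where
  "fa_mult p q = (\<Sum>u\<in>Poly_Mapping.keys p. \<Sum>v\<in>Poly_Mapping.keys q.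
      Poly_Mapping.single (u @ v) (Poly_Mapping.lookup p u * Poly_Mapping.lookup q v))"

definition fa_smult :: "complex \<Rightarrow> fa \<Rightarrow> fa" where
  "fa_smult c p = fa_mult (fa_scalar c) p"

text \<open>Defining relation of U(gl(N)) placed inside the word u _ v:
  E_ij E_kl - E_kl E_ij - [E_ij, E_kl], with [E_ij,E_kl] = d_jk E_il - d_li E_kj.\<close>
definition gl_rel :: "(nat \<times> nat) list \<Rightarrow> nat \<Rightarrow> nat \<Rightarrow> nat \<Rightarrow> nat \<Rightarrow> (nat \<times> nat) list \<Rightarrow> fa" where
  "gl_rel u i j k l v =
     fa_word (u @ [(i,j),(k,l)] @ v) - fa_word (u @ [(k,l),(i,j)] @ v)
     - (if j = k then fa_word (u @ [(i,l)] @ v) else 0)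
     + (if l = i then fa_word (u @ [(k,j)] @ v) else 0)"

text \<open>The two-sided ideal generated by the relations (indices in 1..N); it is the
  linear span of the elements u * rel * v for words u, v.\<close>
inductive_set gl_ideal :: "nat \<Rightarrow> fa set" for N :: nat where
  zero: "0 \<in> gl_ideal N"
| add: "p \<in> gl_ideal N \<Longrightarrow> q \<in> gl_ideal N \<Longrightarrow> p + q \<in> gl_ideal N"
| smult: "p \<in> gl_ideal N \<Longrightarrow> fa_smult c p \<in> gl_ideal N"
| gen: "i \<in> {1..N} \<Longrightarrow> j \<in> {1..N} \<Longrightarrow> k \<in> {1..N} \<Longrightarrow> l \<in> {1..N} \<Longrightarrow>
        set u \<subseteq> {1..N} \<times> {1..N} \<Longrightarrow> set v \<subseteq> {1..N} \<times> {1..N} \<Longrightarrow>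
        gl_rel u i j k l v \<in> gl_ideal N"

definition U_eq :: "nat \<Rightarrow> fa \<Rightarrow> fa \<Rightarrow> bool" where
  "U_eq N p q \<longleftrightarrow> p - q \<in> gl_ideal N"

definition w_glN :: "nat \<Rightarrow> nat \<Rightarrow> (nat \<Rightarrow> nat) \<Rightarrow> fa" where
  "w_glN N m \<alpha> = (\<Sum>i\<in>Pi\<^sub>E {1..m} (\<lambda>_. {1..N}).
      fa_word (map (\<lambda>t. (i t, i (\<alpha> t))) [1..<m+1]))"

definition long_cycle :: "nat \<Rightarrow> nat \<Rightarrow> nat" where
  "long_cycle k t = (if 1 \<le> t \<and> t < k then t + 1 else if t = k then 1 else t)"

text \<open>Polynomials in countably many variables with coefficients in C[N].
  The variable with index i (i = 0,1,2,...) stands for C_(i+1), resp. S_(i+1).\<close>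
type_synonym mpoly = "(nat \<Rightarrow>\<^sub>0 nat) \<Rightarrow>\<^sub>0 complex poly"

definition mvar :: "nat \<Rightarrow> mpoly" where
  "mvar i = Poly_Mapping.single (Poly_Mapping.single i 1) 1"

definition mconst :: "complex poly \<Rightarrow> mpoly" where
  "mconst c = Poly_Mapping.single 0 c"

definition Cvar :: "nat \<Rightarrow> mpoly" where "Cvar k = mvar (k - 1)"
definition Svar :: "nat \<Rightarrow> mpoly" where "Svar k = (if k = 0 then 1 else mvar (k - 1))"

text \<open>Evaluation of a polynomial of C[N][C_1,...] in the free algebra at a concrete
  N, with C_k sent to w_gl(N)((1..k)). (Since the C_k are central in U(gl(N)),
  the order of the factors is irrelevant modulo the ideal.)\<close>
definition fa_pow :: "fa \<Rightarrow> nat \<Rightarrow> fa" where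
  "fa_pow p n = ((\<lambda>q. fa_mult p q) ^^ n) (fa_scalar 1)"

definition eval_U :: "nat \<Rightarrow> mpoly \<Rightarrow> fa" where
  "eval_U N P = (\<Sum>\<mu>\<in>Poly_Mapping.keys P.
      fa_mult (fa_scalar (poly (Poly_Mapping.lookup P \<mu>) (of_nat N)))
        (foldr (\<lambda>i acc. fa_mult (fa_pow (w_glN N (i+1) (long_cycle (i+1))) (Poly_Mapping.lookup \<mu> i)) acc)
           (sorted_list_of_set (Poly_Mapping.keys \<mu>)) (fa_scalar 1)))"

definition w_gl :: "nat \<Rightarrow> (nat \<Rightarrow> nat) \<Rightarrow> mpoly" where
  "w_gl m \<alpha> = (THE P. \<forall>N\<ge>1. U_eq N (eval_U N P) (w_glN N m \<alpha>))"

definition A_elem :: "nat \<Rightarrow> mpoly" where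
  "A_elem m = mconst [:1 / of_nat (fact m):] * (\<Sum>\<alpha>\<in>{\<alpha>. \<alpha> permutes {1..m}}. w_gl m \<alpha>)"

text \<open>Locally finite sums of formal power series: F i is required to have order \<ge> i
  (true in all uses below), so the coefficient of u^n only involves i \<le> n.\<close>
definition lsum :: "(nat \<Rightarrow> 'a::comm_ring_1 fps) \<Rightarrow> 'a fps" where
  "lsum F = Abs_fps (\<lambda>n. \<Sum>i\<le>n. fps_nth (F i) n)"

definition geom :: "'a::comm_ring_1 \<Rightarrow> 'a fps" where
  "geom b = Abs_fps (\<lambda>n. b ^ n)"

text \<open>1/(1 + g) for g with zero constant term.\<close>
definition inv1p :: "'a::comm_ring_1 fps \<Rightarrow> 'a fps" where
  "inv1p g = lsum (\<lambda>j. (- g) ^ j)"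

definition Nchoose :: "nat \<Rightarrow> complex poly" where
  "Nchoose j = smult (1 / of_nat (fact j)) (\<Prod>i<j. [:- of_nat i, 1:])"

text \<open>(1 + g)^N for symbolic N and g with zero constant term.\<close>
definition powN1p :: "mpoly fps \<Rightarrow> mpoly fps" where
  "powN1p g = lsum (\<lambda>j. fps_const (mconst (Nchoose j)) * g ^ j)"

definition polyN :: "complex poly" where "polyN = [:0, 1:]"

definition schur_rhs :: "mpoly fps" where
  "schur_rhs = (let a = mconst (smult (1/2) (polyN + 1));
                    b = mconst (smult (1/2) (polyN - 1));
                    ratio = fps_const 1 - fps_const a * fps_X;
                    q = ratio * geom b
                in powN1p (q - 1) *
                   lsum (\<lambda>i. if i = 0 then 1 else fps_const (Svar i) * (fps_X * geom b) ^ i) *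
                   inv1p (lsum (\<lambda>i. if i = 0 then 0 else fps_const (Svar i) * (fps_X * geom a) ^ i)))"

text \<open>Phi(C_k) is determined by comparing coefficients of u^(k+1).\<close>
definition Phi_C :: "nat \<Rightarrow> mpoly" where
  "Phi_C k = - (fps_nth schur_rhs (k + 1))"

definition Phi :: "mpoly \<Rightarrow> mpoly" where
  "Phi P = (\<Sum>\<mu>\<in>Poly_Mapping.keys P. mconst (Poly_Mapping.lookup P \<mu>) *
              (\<Prod>i\<in>Poly_Mapping.keys \<mu>. Phi_C (i + 1) ^ Poly_Mapping.lookup \<mu> i))"

definition ffact_shift :: "nat \<Rightarrow> nat \<Rightarrow> complex poly" where
  "ffact_shift m l = (\<Prod>i<l. [:of_nat m - 1 - of_nat i, 1:])"

end

theory Submission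
  imports Defs "HOL-Computational_Algebra.Formal_Laurent_Series"
begin

text \<open>
  Fix \<open>N\<close> and put \<open>X = \<Sum> x_i y_j E_ij\<close> and \<open>r = \<Sum> x_i y_i\<close> with commuting
  variables \<open>x\<close>, \<open>y\<close>. Then \<open>m! A_m\<close> is the Gaussian (Wick) expectation of \<open>X^m\<close>, where
  \<open>\<langle>x^I y^J\<rangle> = [I = J] I!\<close>. The rising products \<open>X (X + r) \<dots> (X + (m - 1) r)\<close> satisfy
  \<open>\<partial>/\<partial>x_i (X^(m)) = m (Q_i + (m - 1) y_i) X^(m-1)\<close> with \<open>Q_i = \<Sum> y_j E_ij\<close>; integration by parts turns
  this into a Newton identity: \<open>Z_m = \<langle>X^(m)\<rangle> / m!\<close> satisfies
  \<open>(N + m) Z_m = \<Sum>_{j \<le> m} tr((E + j) \<dots> (E + m - 1)) Z_j\<close>, which determines \<open>Z_m\<close> as a polynomial in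
  \<open>N, C_1, C_2, \<dots>\<close>. On the other side, let \<open>\<sigma>\<close> be the linear functional on polynomials that takes
  \<open>(y - (N-1)/2)^(N-1+i)\<close> to \<open>S_i\<close> and lower powers to \<open>0\<close>. The Schur substitution is a first order
  difference equation for \<open>\<sigma>(1/(q - y))\<close>, and it says exactly that
  \<open>Z_m = \<sigma>((y - N + 1)(y - N + 2) \<dots> (y + m - 1))\<close> solves the same recursion. Passing from rising products
  back to powers gives, with \<open>h(t) = sinh(t/2)/(t/2)\<close>,
  \<open>\<Sum> A_m t^m / (N + m - 1)! = h(t)^(1-N) \<Sum> S_m t^m / (N + m - 1)!\<close>,
  so \<open>(-1)^k a_2k\<close> is the coefficient of \<open>t^2k\<close> in \<open>h(t)^(1-N)\<close>.

  That \<open>w_gl(\<alpha>)\<close> exists follows by reordering the factors of \<open>w_gl(N)(\<alpha>)\<close> cycle by cycle; it is unique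
  since the top-degree symbols of the \<open>C_k\<close>, in a representation of all \<open>gl(N)\<close> by differential operators,
  are power sums.
\<close>

subsection \<open>The free algebra and evaluation of polynomials\<close>

text \<open>Two obstacles shape the proof. \<open>w_gl\<close> is a definite description, so nothing
  can be computed before existence and uniqueness are known; and for a fixed \<open>N\<close> the
  \<open>C_k\<close> are algebraically dependent, so uniqueness has to use all \<open>N\<close> at
  once. Hence a single representation that serves every \<open>gl(N)\<close>, in which the images of
  the \<open>C_k\<close> commute and polynomial identities can be tested. Rising products appear
  because the derivative of a plain power \<open>X^m\<close> does not close up:
  \<open>X Q_i - Q_i X = y_i X - r Q_i\<close>, and the summands \<open>k r\<close> absorb exactly
  this correction. The bridge between the two sides is the recursion for \<open>Z_m\<close>. On the
  operator side it is evaluated by \<open>ev N\<close>; on the Schur side by \<open>evc n s\<close>,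
  with \<open>N\<close> an integer \<open>n \<ge> 1\<close> and the \<open>S_i\<close> complex
  numbers. There \<open>(1 + g)^N\<close> is an ordinary power, the factorials
  \<open>(n - 1 + m)!\<close> make sense, and a polynomial that vanishes at all such points is
  zero.\<close>

instantiation list :: (type) monoid_add
begin
definition zero_list_def: "0 = []"
definition plus_list_def: "xs + ys = xs @ ys"
instance by standard (simp_all add: zero_list_def plus_list_def)
end

lemma poly_mapping_sum_single:
  "p = (\<Sum>k\<in>Poly_Mapping.keys p. Poly_Mapping.single k (Poly_Mapping.lookup p k))"
proof (rule poly_mapping_eqI)
  fix k
  show "Poly_Mapping.lookup p k =
      Poly_Mapping.lookup (\<Sum>k\<in>Poly_Mapping.keys p. Poly_Mapping.single k (Poly_Mapping.lookup p k)) k"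
    by (simp add: lookup_sum lookup_single when_def in_keys_iff)
qed

text \<open>With concatenation as the addition of words, the convolution product on
  \<open>Poly_Mapping\<close> is the product of the free algebra, so ring reasoning becomes
  available.\<close>

lemma fa_mult_eq_times: "fa_mult p q = p * q"
proof -
  have "p * q = (\<Sum>u\<in>Poly_Mapping.keys p. Poly_Mapping.single u (Poly_Mapping.lookup p u)) *
      (\<Sum>v\<in>Poly_Mapping.keys q. Poly_Mapping.single v (Poly_Mapping.lookup q v))"
    using poly_mapping_sum_single[of p] poly_mapping_sum_single[of q] by simp
  thus ?thesis
    unfolding fa_mult_def by (simp add: sum_product mult_single plus_list_def)
qed

lemma fa_word_append: "fa_word (u @ v) = fa_word u * fa_word v"
  by (simp add: fa_word_def mult_single plus_list_def)

lemma fa_word_Nil: "fa_word [] = 1"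
  by (simp add: fa_word_def flip: zero_list_def)

lemma fa_scalar_1: "fa_scalar 1 = 1"
  by (simp add: fa_scalar_def flip: zero_list_def)

lemma fa_scalar_0: "fa_scalar 0 = 0"
  by (simp add: fa_scalar_def)

lemma fa_scalar_add: "fa_scalar (a + b) = fa_scalar a + fa_scalar b"
  by (simp add: fa_scalar_def single_add)

lemma fa_scalar_mult: "fa_scalar (a * b) = fa_scalar a * fa_scalar b"
  by (simp add: fa_scalar_def mult_single plus_list_def)

lemma fa_scalar_of_nat: "fa_scalar (of_nat n) = of_nat n"
  by (induction n) (simp_all add: fa_scalar_0 fa_scalar_1 fa_scalar_add)

lemma fa_pow_eq_power: "fa_pow p n = p ^ n"
  unfolding fa_pow_def by (induction n) (simp_all add: fa_scalar_1 fa_mult_eq_times)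

section \<open>Evaluation of polynomials at a concrete N\<close>

definition cyc :: "nat \<Rightarrow> nat \<Rightarrow> fa" where
  "cyc N i = w_glN N (i+1) (long_cycle (i+1))"

definition umon :: "nat \<Rightarrow> (nat \<Rightarrow>\<^sub>0 nat) \<Rightarrow> fa" where
  "umon N \<mu> = foldr (\<lambda>i acc. cyc N i ^ Poly_Mapping.lookup \<mu> i * acc)
     (sorted_list_of_set (Poly_Mapping.keys \<mu>)) 1"

lemma eval_U_umon:
  "eval_U N P = (\<Sum>\<mu>\<in>Poly_Mapping.keys P.
     fa_scalar (poly (Poly_Mapping.lookup P \<mu>) (of_nat N)) * umon N \<mu>)"
proof -
  have [simp]: "fa_mult = (*)" by (intro ext fa_mult_eq_times)
  show ?thesis unfolding eval_U_def umon_def cyc_def by (simp add: fa_pow_eq_power fa_scalar_1)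
qed

lemma umon_0: "umon N 0 = 1"
  by (simp add: umon_def)

text \<open>The factors of \<open>umon\<close> are sorted by index and do not commute in the free
  algebra, so a generator can only be prepended if its index is minimal. This is why cycles are
  later split off in order of length.\<close>

lemma umon_add_single_le:
  assumes "\<And>i. i \<in> Poly_Mapping.keys \<mu> \<Longrightarrow> k \<le> i"
  shows "umon N (\<mu> + Poly_Mapping.single k 1) = cyc N k * umon N \<mu>"
proof -
  let ?\<nu> = "\<mu> + Poly_Mapping.single k 1"
  let ?R = "sorted_list_of_set (Poly_Mapping.keys \<mu> - {k})"
  let ?f = "\<lambda>\<mu> i acc. cyc N i ^ Poly_Mapping.lookup \<mu> i * acc"
  have key: "Poly_Mapping.keys ?\<nu> = insert k (Poly_Mapping.keys \<mu>)"
    by (auto simp: in_keys_iff lookup_add lookup_single when_def split: if_splits)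
  have srt: "sorted_list_of_set (insert k A) = k # sorted_list_of_set (A - {k})"
    if "finite A" "\<And>i. i \<in> A \<Longrightarrow> k \<le> i" for A :: "nat set"
  proof -
    have "sorted_list_of_set (insert k (A - {k})) = insort k (sorted_list_of_set (A - {k}))"
      using that by (subst sorted_list_of_set_insert) auto
    also have "\<dots> = k # sorted_list_of_set (A - {k})"
      using that by (intro insort_is_Cons) auto
    finally show ?thesis by simp
  qed
  have srtk: "sorted_list_of_set (insert k (Poly_Mapping.keys \<mu>)) = k # ?R"
    using assms by (intro srt) auto
  have rest: "foldr (?f ?\<nu>) ?R 1 = foldr (?f \<mu>) ?R 1"
    by (intro foldr_cong) (auto simp: lookup_add lookup_single when_def)
  have "umon N ?\<nu> = cyc N k ^ (Suc (Poly_Mapping.lookup \<mu> k)) * foldr (?f \<mu>) ?R 1"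
    unfolding umon_def key srtk by (simp only: foldr.simps o_apply rest) (simp add: lookup_add)
  also have "\<dots> = cyc N k * (cyc N k ^ Poly_Mapping.lookup \<mu> k * foldr (?f \<mu>) ?R 1)"
    by (simp add: mult.assoc)
  also have "cyc N k ^ Poly_Mapping.lookup \<mu> k * foldr (?f \<mu>) ?R 1 = umon N \<mu>"
  proof (cases "k \<in> Poly_Mapping.keys \<mu>")
    case True
    hence "sorted_list_of_set (Poly_Mapping.keys \<mu>) = k # ?R"
      using srt[of "Poly_Mapping.keys \<mu>"] assms by (simp add: insert_absorb)
    thus ?thesis unfolding umon_def by simp
  next
    case False
    thus ?thesis unfolding umon_def by (simp add: in_keys_iff)
  qed
  finally show ?thesis .
qed

lemma eval_U_add: "eval_U N (P + Q) = eval_U N P + eval_U N Q"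
  unfolding eval_U_umon
  by (rule setsum_keys_plus_distrib) (simp_all add: fa_scalar_0 fa_scalar_add distrib_right)

lemma eval_U_0: "eval_U N 0 = 0"
  by (simp add: eval_U_umon)

lemma eval_U_single:
  "eval_U N (Poly_Mapping.single \<mu> c) = fa_scalar (poly c (of_nat N)) * umon N \<mu>"
  by (cases "c = 0") (simp_all add: eval_U_umon fa_scalar_0)

lemma eval_U_sum: "eval_U N (sum f A) = (\<Sum>x\<in>A. eval_U N (f x))"
  by (induction A rule: infinite_finite_induct) (simp_all add: eval_U_0 eval_U_add)

text \<open>Replaces an induction over the support in the proofs that evaluations and
  \<open>rep\<close> respect products.\<close>

lemma poly_mapping_additive_eqI:
  fixes f g :: "('k \<Rightarrow>\<^sub>0 'a::comm_monoid_add) \<Rightarrow> 'b::comm_monoid_add"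
  assumes "\<And>p q. f (p + q) = f p + f q" "\<And>p q. g (p + q) = g p + g q"
    and "f 0 = 0" "g 0 = 0"
    and "\<And>k a. f (Poly_Mapping.single k a) = g (Poly_Mapping.single k a)"
  shows "f p = g p"
proof -
  have fs: "f (sum h A) = (\<Sum>x\<in>A. f (h x))" for h and A :: "'k set"
    by (induction A rule: infinite_finite_induct) (simp_all add: assms)
  have gs: "g (sum h A) = (\<Sum>x\<in>A. g (h x))" for h and A :: "'k set"
    by (induction A rule: infinite_finite_induct) (simp_all add: assms)
  show ?thesis
    by (subst (1 2) poly_mapping_sum_single) (simp add: fs gs assms(5))
qed

lemma eval_U_mconst_mult: "eval_U N (mconst c * P) = fa_scalar (poly c (of_nat N)) * eval_U N P"
  by (rule poly_mapping_additive_eqI)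
     (simp_all add: eval_U_add distrib_left eval_U_0 mconst_def mult_single eval_U_single
        fa_scalar_mult mult.assoc)

lemma gl_ideal_scalar: "p \<in> gl_ideal N \<Longrightarrow> fa_scalar c * p \<in> gl_ideal N"
  using gl_ideal.smult[of p N c] by (simp add: fa_smult_def fa_mult_eq_times)

lemma gl_ideal_sum: "(\<And>x. x \<in> A \<Longrightarrow> f x \<in> gl_ideal N) \<Longrightarrow> sum f A \<in> gl_ideal N"
  by (induction A rule: infinite_finite_induct) (simp_all add: gl_ideal.zero gl_ideal.add)

text \<open>The order of quantifiers is the point: one \<open>P\<close> serves every
  \<open>N\<close>, so a factor \<open>N\<close> has to be recorded as the polynomial
  \<open>polyN\<close>.\<close>

definition universal :: "(nat \<Rightarrow> fa) \<Rightarrow> bool" where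
  "universal f \<longleftrightarrow> (\<exists>P. \<forall>N\<ge>1. U_eq N (eval_U N P) (f N))"

lemma universal_cong: 
  assumes "universal f" "\<And>N. N \<ge> 1 \<Longrightarrow> f N - g N \<in> gl_ideal N"
  shows "universal g"
proof -
  from assms(1) obtain P where P: "\<And>N. N \<ge> 1 \<Longrightarrow> eval_U N P - f N \<in> gl_ideal N"
    unfolding universal_def U_eq_def by blast
  have "eval_U N P - g N \<in> gl_ideal N" if "N \<ge> 1" for N
    using gl_ideal.add[OF P[OF that] assms(2)[OF that]] by simp
  thus ?thesis unfolding universal_def U_eq_def by blast
qed

lemma universal_add: 
  assumes "universal f" "universal g"
  shows "universal (\<lambda>N. f N + g N)"
proof -
  from assms obtain P Q where P: "\<And>N. N \<ge> 1 \<Longrightarrow> eval_U N P - f N \<in> gl_ideal N"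
    and Q: "\<And>N. N \<ge> 1 \<Longrightarrow> eval_U N Q - g N \<in> gl_ideal N"
    unfolding universal_def U_eq_def by blast
  have "eval_U N (P + Q) - (f N + g N) \<in> gl_ideal N" if "N \<ge> 1" for N
    using gl_ideal.add[OF P[OF that] Q[OF that]] by (simp add: eval_U_add algebra_simps)
  thus ?thesis unfolding universal_def U_eq_def by blast
qed

lemma universal_scale: 
  assumes "universal f"
  shows "universal (\<lambda>N. fa_scalar (poly c (of_nat N)) * f N)"
proof -
  from assms obtain P where P: "\<And>N. N \<ge> 1 \<Longrightarrow> eval_U N P - f N \<in> gl_ideal N"
    unfolding universal_def U_eq_def by blast
  have "eval_U N (mconst c * P) - fa_scalar (poly c (of_nat N)) * f N \<in> gl_ideal N" if "N \<ge> 1" for N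
    using gl_ideal_scalar[OF P[OF that], of "poly c (of_nat N)"]
    by (simp add: eval_U_mconst_mult right_diff_distrib)
  thus ?thesis unfolding universal_def U_eq_def by blast
qed

lemma universal_diff: 
  assumes "universal f" "universal g"
  shows "universal (\<lambda>N. f N - g N)"
proof -
  have "fa_scalar (-1) = -1" by (simp add: fa_scalar_def single_uminus flip: zero_list_def)
  thus ?thesis
    using universal_add[OF assms(1) universal_scale[OF assms(2), of "[:-1:]"]] by simp
qed

lemma universal_umon: "universal (\<lambda>N. umon N \<mu>)"
  unfolding universal_def U_eq_def
  by (rule exI[of _ "Poly_Mapping.single \<mu> 1"]) (simp add: eval_U_single fa_scalar_1 gl_ideal.zero)

subsection \<open>Existence of the universal weight system\<close>

text \<open>Generalizes \<open>w_glN\<close> to positions listed in any order, so that factors can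
  be reordered and positions deleted without relabelling.\<close>

definition index_sum :: "nat \<Rightarrow> nat list \<Rightarrow> (nat \<Rightarrow> nat) \<Rightarrow> fa" where
  "index_sum N ts g = (\<Sum>i\<in>Pi\<^sub>E (set ts) (\<lambda>_. {1..N}). fa_word (map (\<lambda>t. (i t, i (g t))) ts))"

lemma w_glN_index_sum: "w_glN N m \<alpha> = index_sum N [1..<m+1] \<alpha>"
proof -
  have "set [1..<m+1] = {1..m}" by auto
  thus ?thesis unfolding w_glN_def index_sum_def by simp
qed

text \<open>Cuts \<open>c\<close> out of its cycle: the preimage of \<open>c\<close> is sent
  straight to \<open>g c\<close>, and \<open>c\<close> becomes fixed.\<close>

definition skip :: "nat \<Rightarrow> (nat \<Rightarrow> nat) \<Rightarrow> nat \<Rightarrow> nat" where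
  "skip c g = transpose c (g c) \<circ> g"

lemma skip_permutes:
  assumes "g permutes A" "c \<in> A"
  shows "skip c g permutes (A - {c})"
proof -
  have "g c \<in> A" using assms by (simp add: permutes_in_image)
  hence "skip c g permutes A"
    unfolding skip_def using assms by (intro permutes_compose permutes_swap_id)
  thus ?thesis
    by (rule permutes_superset) (auto simp: skip_def)
qed

lemma sum_PiE_insert:
  assumes "x \<notin> S"
  shows "(\<Sum>f\<in>Pi\<^sub>E (insert x S) D. h f) = (\<Sum>a\<in>D x. \<Sum>f\<in>Pi\<^sub>E S D. h (f(x := a)))"
proof -
  have "(\<Sum>f\<in>Pi\<^sub>E (insert x S) D. h f) = (\<Sum>(a, f)\<in>D x \<times> Pi\<^sub>E S D. h (f(x := a)))"
    unfolding PiE_insert_eq using inj_combinator[OF assms, of D]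
    by (subst sum.reindex) (auto simp: case_prod_unfold)
  thus ?thesis by (simp add: sum.cartesian_product)
qed

text \<open>The Kronecker delta eliminates the index at \<open>c\<close>. If \<open>c\<close> is a
  fixed point of \<open>g\<close> the delta is vacuous and the free index contributes a factor
  \<open>N\<close>.\<close>

lemma sum_contract:
  assumes g: "g permutes A" and c: "c \<in> A" and A: "set ts = A - {c}" "finite A"
  shows "(\<Sum>i\<in>Pi\<^sub>E A (\<lambda>_. {1..N}). if i (g c) = i c then fa_word (map (\<lambda>t. (i t, i (g t))) ts) else 0)
     = fa_scalar (poly (if g c = c then polyN else 1) (of_nat N)) * index_sum N ts (skip c g)"
proof -
  let ?D = "\<lambda>_::nat. {1..N}"
  let ?F = "\<lambda>i. if i (g c) = i c then fa_word (map (\<lambda>t. (i t, i (g t))) ts) else 0"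
  have ins: "A = insert c (set ts)" "c \<notin> set ts" using c A by auto
  have inj: "inj g" using g permutes_inj by blast
  have "(\<Sum>i\<in>Pi\<^sub>E A ?D. ?F i) = (\<Sum>j\<in>Pi\<^sub>E (set ts) ?D. \<Sum>x\<in>{1..N}. ?F (j(c := x)))"
    unfolding ins(1) sum_PiE_insert[OF ins(2)] by (rule sum.swap)
  also have "\<dots> = (\<Sum>j\<in>Pi\<^sub>E (set ts) ?D. fa_scalar (poly (if g c = c then polyN else 1) (of_nat N)) *
       fa_word (map (\<lambda>t. (j t, j (skip c g t))) ts))"
  proof (intro sum.cong refl)
    fix j assume j: "j \<in> Pi\<^sub>E (set ts) ?D"
    show "(\<Sum>x\<in>{1..N}. ?F (j(c := x))) = fa_scalar (poly (if g c = c then polyN else 1) (of_nat N)) *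
       fa_word (map (\<lambda>t. (j t, j (skip c g t))) ts)"
    proof (cases "g c = c")
      case True
      have *: "map (\<lambda>t. ((j(c := x)) t, (j(c := x)) (g t))) ts = map (\<lambda>t. (j t, j (skip c g t))) ts" for x
      proof (intro map_cong refl)
        fix t assume "t \<in> set ts"
        hence "t \<noteq> c" using ins(2) by auto
        moreover from this have "g t \<noteq> c" using True inj_eq[OF inj, of t c] by simp
        ultimately show "((j(c := x)) t, (j(c := x)) (g t)) = (j t, j (skip c g t))"
          using True by (simp add: skip_def)
      qed
      have "(\<Sum>x\<in>{1..N}. ?F (j(c := x))) = of_nat N * fa_word (map (\<lambda>t. (j t, j (skip c g t))) ts)"
        unfolding * using True by simp
      thus ?thesis using True by (simp add: polyN_def fa_scalar_of_nat)
    next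
      case False
      have gc: "g c \<in> set ts" using False g c A by (auto simp: permutes_in_image)
      have jD: "j (g c) \<in> {1..N}" using j gc by (auto simp: PiE_def Pi_def)
      have *: "map (\<lambda>t. ((j(c := x)) t, (j(c := x)) (g t))) ts = map (\<lambda>t. (j t, j (skip c g t))) ts"
        if "x = j (g c)" for x
      proof (intro map_cong refl)
        fix t assume "t \<in> set ts"
        hence "t \<noteq> c" using ins(2) by auto
        moreover from this have "g t \<noteq> g c" using inj_eq[OF inj, of t c] by simp
        ultimately show "((j(c := x)) t, (j(c := x)) (g t)) = (j t, j (skip c g t))"
          using that by (simp add: skip_def transpose_def)
      qed
      have "(\<Sum>x\<in>{1..N}. ?F (j(c := x))) =
        (\<Sum>x\<in>{1..N}. if x = j (g c) then fa_word (map (\<lambda>t. (j t, j (skip c g t))) ts) else 0)"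
        using False * by (intro sum.cong refl) (simp del: map_eq_conv)
      also have "\<dots> = fa_word (map (\<lambda>t. (j t, j (skip c g t))) ts)"
        using jD by simp
      finally show ?thesis using False by (simp add: fa_scalar_1)
    qed
  qed
  finally show ?thesis by (simp add: index_sum_def sum_distrib_left)
qed

text \<open>In the commutator of the factors at \<open>a\<close> and \<open>b\<close>, one term
  contracts \<open>i (g a) = i b\<close> and keeps \<open>E\<close> with indices \<open>i a\<close>,
  \<open>i (g b)\<close>; the other contracts \<open>i (g b) = i a\<close> and keeps
  \<open>i b\<close>, \<open>i (g a)\<close>. Both survivors are factors of the permutation
  \<open>g'\<close>, with one position fewer.\<close>

lemma index_sum_swap_adjacent:
  assumes ts: "distinct (u @ [a, b] @ v)" and A: "A = set (u @ [a, b] @ v)" and g: "g permutes A"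
  defines "g' \<equiv> g \<circ> transpose a b"
  shows "index_sum N (u @ [a, b] @ v) g - index_sum N (u @ [b, a] @ v) g
    - fa_scalar (poly (if g' b = b then polyN else 1) (of_nat N)) * index_sum N (u @ [a] @ v) (skip b g')
    + fa_scalar (poly (if g' a = a then polyN else 1) (of_nat N)) * index_sum N (u @ [b] @ v) (skip a g')
    \<in> gl_ideal N"
proof -
  let ?D = "\<lambda>_::nat. {1..N}"
  have g': "g' permutes A"
    unfolding g'_def using A by (intro permutes_compose g permutes_swap_id) auto
  have g'_out: "g' t = g t" if "t \<noteq> a" "t \<noteq> b" for t
    using that by (simp add: g'_def)
  have g'ab: "g' a = g b" "g' b = g a" by (auto simp: g'_def)
  have A': "set (u @ [b, a] @ v) = A" using A by auto
  have fin: "finite A" using A by simp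
  let ?L = "\<lambda>i t. (i t, i (g t))" and ?L' = "\<lambda>i t. (i t, i (g' t))"
  have 1: "fa_scalar (poly (if g' b = b then polyN else 1) (of_nat N)) * index_sum N (u @ [a] @ v) (skip b g')
     = (\<Sum>i\<in>Pi\<^sub>E A ?D. if i (g' b) = i b then fa_word (map (?L' i) (u @ [a] @ v)) else 0)"
    using A ts by (subst sum_contract[OF g']) (auto simp: fin)
  have 2: "fa_scalar (poly (if g' a = a then polyN else 1) (of_nat N)) * index_sum N (u @ [b] @ v) (skip a g')
     = (\<Sum>i\<in>Pi\<^sub>E A ?D. if i (g' a) = i a then fa_word (map (?L' i) (u @ [b] @ v)) else 0)"
    using A ts by (subst sum_contract[OF g']) (auto simp: fin)
  have 3: "index_sum N (u @ [a, b] @ v) g = (\<Sum>i\<in>Pi\<^sub>E A ?D. fa_word (map (?L i) (u @ [a, b] @ v)))"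
    by (simp only: index_sum_def A)
  have 4: "index_sum N (u @ [b, a] @ v) g = (\<Sum>i\<in>Pi\<^sub>E A ?D. fa_word (map (?L i) (u @ [b, a] @ v)))"
    by (simp only: index_sum_def A')
  have mu: "map (?L' i) u = map (?L i) u" "map (?L' i) v = map (?L i) v" for i
  proof -
    have "g' t = g t" if "t \<in> set u \<union> set v" for t
      using that ts by (intro g'_out) auto
    thus "map (?L' i) u = map (?L i) u" "map (?L' i) v = map (?L i) v" by auto
  qed
  have "(\<Sum>i\<in>Pi\<^sub>E A ?D. gl_rel (map (?L i) u) (i a) (i (g a)) (i b) (i (g b)) (map (?L i) v)) \<in> gl_ideal N"
  proof (intro gl_ideal_sum gl_ideal.gen)
    fix i assume i: "i \<in> Pi\<^sub>E A ?D"
    have in1: "i t \<in> {1..N}" if "t \<in> A" for t using i that by (auto simp: PiE_def Pi_def)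
    have in2: "i (g t) \<in> {1..N}" if "t \<in> A" for t using in1 that g by (simp add: permutes_in_image)
    show "i a \<in> {1..N}" "i b \<in> {1..N}" using A in1 by auto
    show "i (g a) \<in> {1..N}" "i (g b) \<in> {1..N}" using A in2 by auto
    show "set (map (?L i) u) \<subseteq> {1..N} \<times> {1..N}" "set (map (?L i) v) \<subseteq> {1..N} \<times> {1..N}"
      using A in1 in2 by auto
  qed
  also have "(\<Sum>i\<in>Pi\<^sub>E A ?D. gl_rel (map (?L i) u) (i a) (i (g a)) (i b) (i (g b)) (map (?L i) v)) =
     (\<Sum>i\<in>Pi\<^sub>E A ?D. fa_word (map (?L i) (u @ [a,b] @ v)) - fa_word (map (?L i) (u @ [b,a] @ v))
        - (if i (g' b) = i b then fa_word (map (?L' i) (u @ [a] @ v)) else 0)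
        + (if i (g' a) = i a then fa_word (map (?L' i) (u @ [b] @ v)) else 0))"
    by (intro sum.cong refl) (simp add: gl_rel_def mu g'ab)
  also have "\<dots> = index_sum N (u @ [a, b] @ v) g - index_sum N (u @ [b, a] @ v) g
    - fa_scalar (poly (if g' b = b then polyN else 1) (of_nat N)) * index_sum N (u @ [a] @ v) (skip b g')
    + fa_scalar (poly (if g' a = a then polyN else 1) (of_nat N)) * index_sum N (u @ [b] @ v) (skip a g')"
    unfolding 1 2 3 4 by (simp only: sum.distrib sum_subtractf)
  finally show ?thesis .
qed

text \<open>Bubble sort: adjacent swaps reach every rearrangement.\<close>

lemma mset_adjacent_swap_induct:
  assumes swap: "\<And>u a b v. Q (u @ [a, b] @ v) \<Longrightarrow> Q (u @ [b, a] @ v)"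
    and "Q xs" "mset xs = mset ys"
  shows "Q ys"
proof -
  have move: "Q (pre @ [x] @ ys1 @ ys2) \<Longrightarrow> Q (pre @ ys1 @ [x] @ ys2)" for pre x ys1 ys2
  proof (induction ys1 arbitrary: pre)
    case (Cons y ys1)
    have "Q ((pre @ [y]) @ [x] @ ys1 @ ys2)" using swap[of pre x y "ys1 @ ys2"] Cons.prems by simp
    from Cons.IH[OF this] show ?case by simp
  qed simp
  have "Q (pre @ xs) \<Longrightarrow> mset xs = mset ys \<Longrightarrow> Q (pre @ ys)" for pre xs ys
  proof (induction xs arbitrary: pre ys)
    case (Cons x xs)
    have "x \<in> set ys" using Cons.prems(2) by (metis list.set_intros(1) mset_eq_setD)
    then obtain y1 y2 where ys: "ys = y1 @ x # y2" by (meson split_list)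
    have "mset xs = mset (y1 @ y2)" using Cons.prems(2) ys by simp
    with Cons.IH[of "pre @ [x]" "y1 @ y2"] Cons.prems(1) have "Q (pre @ [x] @ y1 @ y2)" by simp
    from move[OF this] show ?case using ys by simp
  qed simp
  from this[of "[]" xs ys] assms(2,3) show ?thesis by simp
qed

text \<open>When \<open>g\<close> preserves both blocks they share no summation index, and the sum
  factors.\<close>

lemma index_sum_append:
  assumes "set xs \<inter> set ys = {}" "g ` set xs \<subseteq> set xs" "g ` set ys \<subseteq> set ys"
  shows "index_sum N (xs @ ys) g = index_sum N xs g * index_sum N ys g"
proof -
  let ?D = "\<lambda>_::nat. {1..N}"
  let ?w = "\<lambda>i ts. fa_word (map (\<lambda>t. (i t, i (g t))) ts)"
  have "index_sum N (xs @ ys) g = (\<Sum>i\<in>Pi\<^sub>E (set xs \<union> set ys) ?D. ?w i xs * ?w i ys)"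
    by (simp add: index_sum_def fa_word_append)
  also have "\<dots> = (\<Sum>(i, j)\<in>Pi\<^sub>E (set xs) ?D \<times> Pi\<^sub>E (set ys) ?D. ?w i xs * ?w j ys)"
  proof (rule sum.reindex_bij_witness[where
        j = "\<lambda>i. (restrict i (set xs), restrict i (set ys))" and
        i = "\<lambda>(i, j) t. if t \<in> set xs then i t else j t"])
    fix i assume i: "i \<in> Pi\<^sub>E (set xs \<union> set ys) ?D"
    show "(case (restrict i (set xs), restrict i (set ys)) of (i, j) \<Rightarrow> \<lambda>t. if t \<in> set xs then i t else j t) = i"
      using i by (auto simp: fun_eq_iff PiE_def extensional_def)
    show "(restrict i (set xs), restrict i (set ys)) \<in> Pi\<^sub>E (set xs) ?D \<times> Pi\<^sub>E (set ys) ?D"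
      using i by (auto simp: PiE_def)
    have "?w (restrict i (set xs)) xs = ?w i xs" "?w (restrict i (set ys)) ys = ?w i ys"
      using assms by (auto intro!: arg_cong[where f = fa_word] map_cong)
    thus "(case (restrict i (set xs), restrict i (set ys)) of (i, j) \<Rightarrow> ?w i xs * ?w j ys) = ?w i xs * ?w i ys"
      by simp
  next
    fix p assume p: "p \<in> Pi\<^sub>E (set xs) ?D \<times> Pi\<^sub>E (set ys) ?D"
    show "(restrict (case p of (i, j) \<Rightarrow> \<lambda>t. if t \<in> set xs then i t else j t) (set xs),
           restrict (case p of (i, j) \<Rightarrow> \<lambda>t. if t \<in> set xs then i t else j t) (set ys)) = p"
      using p assms(1) by (auto simp: fun_eq_iff PiE_def extensional_def split: prod.splits)
    show "(case p of (i, j) \<Rightarrow> \<lambda>t. if t \<in> set xs then i t else j t) \<in> Pi\<^sub>E (set xs \<union> set ys) ?D"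
      using p by (auto simp: PiE_def extensional_def Pi_def split: prod.splits)
  qed
  also have "\<dots> = index_sum N xs g * index_sum N ys g"
    by (simp add: index_sum_def sum_product sum.cartesian_product)
  finally show ?thesis .
qed

lemma index_sum_relabel:
  assumes inj: "inj_on f {1..m}" and al: "\<alpha> permutes {1..m}"
    and eq: "\<And>t. t \<in> {1..m} \<Longrightarrow> f (\<alpha> t) = g (f t)"
  shows "index_sum N (map f [1..<m+1]) g = w_glN N m \<alpha>"
proof -
  let ?D = "\<lambda>_::nat. {1..N}"
  have st: "set (map f [1..<m+1]) = f ` {1..m}" by auto
  have al': "\<alpha> t \<in> {1..m}" if "t \<in> {1..m}" for t using permutes_in_image[OF al] that by blast
  have gin: "g (f t) \<in> f ` {1..m}" if "t \<in> {1..m}" for t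
    using eq[OF that] al'[OF that] by (metis imageI)
  have invf: "inv_into {1..m} f (f t) = t" if "t \<in> {1..m}" for t using inj that by (rule inv_into_f_f)
  show ?thesis
    unfolding index_sum_def w_glN_def st
  proof (rule sum.reindex_bij_witness[where
        j = "\<lambda>i. restrict (i \<circ> f) {1..m}" and
        i = "\<lambda>i. restrict (i \<circ> inv_into {1..m} f) (f ` {1..m})"])
    fix i assume i: "i \<in> Pi\<^sub>E (f ` {1..m}) ?D"
    show "restrict (restrict (i \<circ> f) {1..m} \<circ> inv_into {1..m} f) (f ` {1..m}) = i"
    proof
      fix x show "restrict (restrict (i \<circ> f) {1..m} \<circ> inv_into {1..m} f) (f ` {1..m}) x = i x"
      proof (cases "x \<in> f ` {1..m}")
        case True
        then obtain t where "t \<in> {1..m}" "x = f t" by blast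
        thus ?thesis using invf[of t] by auto
      next
        case False thus ?thesis using i by (auto simp: PiE_def extensional_def)
      qed
    qed
    show "restrict (i \<circ> f) {1..m} \<in> Pi\<^sub>E {1..m} ?D"
      unfolding restrict_PiE_iff using PiE_mem[OF i] by (metis comp_apply imageI)
    have "map (\<lambda>t. (restrict (i \<circ> f) {1..m} t, restrict (i \<circ> f) {1..m} (\<alpha> t))) [1..<m+1] =
          map ((\<lambda>t. (i t, i (g t))) \<circ> f) [1..<m+1]"
    proof (intro map_cong refl)
      fix t assume "t \<in> set [1..<m+1]"
      hence t: "t \<in> {1..m}" by auto
      show "(restrict (i \<circ> f) {1..m} t, restrict (i \<circ> f) {1..m} (\<alpha> t)) = ((\<lambda>t. (i t, i (g t))) \<circ> f) t"
        by (simp only: restrict_apply t al'[OF t] if_True comp_apply eq[OF t])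
    qed
    thus "fa_word (map (\<lambda>t. (restrict (i \<circ> f) {1..m} t, restrict (i \<circ> f) {1..m} (\<alpha> t))) [1..<m + 1]) =
         fa_word (map (\<lambda>t. (i t, i (g t))) (map f [1..<m + 1]))"
      by (simp only: map_map)
  next
    fix i assume i: "i \<in> Pi\<^sub>E {1..m} ?D"
    show "restrict (restrict (i \<circ> inv_into {1..m} f) (f ` {1..m}) \<circ> f) {1..m} = i"
    proof
      fix t show "restrict (restrict (i \<circ> inv_into {1..m} f) (f ` {1..m}) \<circ> f) {1..m} t = i t"
      proof (cases "t \<in> {1..m}")
        case True
        thus ?thesis by (simp only: restrict_apply comp_apply imageI if_True invf)
      next
        case False
        thus ?thesis using PiE_arb[OF i False] by (simp only: restrict_apply if_False)
      qed
    qed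
    show "restrict (i \<circ> inv_into {1..m} f) (f ` {1..m}) \<in> Pi\<^sub>E (f ` {1..m}) ?D"
      unfolding restrict_PiE_iff using PiE_mem[OF i] invf by (metis comp_apply imageE)
  qed
qed


text \<open>Pigeonhole on \<open>card A + 1\<close> iterates, after which injectivity cancels the
  common part of the two exponents.\<close>

lemma permutes_power_returns:
  assumes "g permutes A" "finite A" "a \<in> A"
  shows "\<exists>L>0. (g ^^ L) a = a"
proof -
  have inj: "inj (g ^^ s)" for s using permutes_inj[OF assms(1)] by (rule inj_fn)
  have mem: "(g ^^ s) a \<in> A" for s
    using assms by (induction s) (simp_all add: permutes_in_image)
  have "\<not> inj_on (\<lambda>s. (g ^^ s) a) {..card A}"
  proof
    assume "inj_on (\<lambda>s. (g ^^ s) a) {..card A}"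
    hence "card ((\<lambda>s. (g ^^ s) a) ` {..card A}) = Suc (card A)" by (simp add: card_image)
    moreover have "card ((\<lambda>s. (g ^^ s) a) ` {..card A}) \<le> card A"
      using assms mem by (intro card_mono) auto
    ultimately show False by simp
  qed
  then obtain s s' where ss: "s < s'" "(g ^^ s) a = (g ^^ s') a"
    unfolding inj_on_def by (metis nat_neq_iff)
  have "(g ^^ s) ((g ^^ (s' - s)) a) = (g ^^ s) a"
    using ss funpow_add[of s "s' - s" g] by (simp add: fun_eq_iff)
  hence "(g ^^ (s' - s)) a = a" using inj[of s] by (simp add: inj_eq)
  with ss show ?thesis by (intro exI[of _ "s' - s"]) simp
qed

definition period :: "(nat \<Rightarrow> nat) \<Rightarrow> nat \<Rightarrow> nat" where
  "period g a = (LEAST L. L > 0 \<and> (g ^^ L) a = a)"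

lemma period_props:
  assumes "g permutes A" "finite A" "a \<in> A"
  shows "period g a > 0" "(g ^^ period g a) a = a"
    "\<And>L. 0 < L \<Longrightarrow> L < period g a \<Longrightarrow> (g ^^ L) a \<noteq> a"
proof -
  have "period g a > 0 \<and> (g ^^ period g a) a = a"
    unfolding period_def by (rule LeastI_ex[OF permutes_power_returns[OF assms]])
  thus "period g a > 0" "(g ^^ period g a) a = a" by auto
  show "(g ^^ L) a \<noteq> a" if "0 < L" "L < period g a" for L
    using not_less_Least that unfolding period_def by blast
qed

lemma long_cycle_permutes: "k \<ge> 1 \<Longrightarrow> long_cycle k permutes {1..k}"
proof (rule bij_imp_permutes)
  assume k: "k \<ge> 1"
  have inj: "inj_on (long_cycle k) {1..k}"
    by (rule inj_onI) (auto simp: long_cycle_def split: if_splits)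
  moreover have "long_cycle k ` {1..k} \<subseteq> {1..k}" using k by (auto simp: long_cycle_def)
  ultimately show "bij_betw (long_cycle k) {1..k} {1..k}"
    unfolding bij_betw_def by (metis endo_inj_surj finite_atLeastAtMost)
qed (auto simp: long_cycle_def)

text \<open>Read along the orbit of \<open>a\<close>, the permutation is the standard long cycle up
  to relabelling, which yields the generator for the orbit length; \<open>cyc\<close> counts from 0,
  hence \<open>L - 1\<close>.\<close>

lemma index_sum_cycle:
  assumes g: "g permutes A" "finite A" "a \<in> A"
  defines "f \<equiv> \<lambda>s. (g ^^ (s - 1)) a" and "L \<equiv> period g a"
  shows "index_sum N (map f [1..<L+1]) g = cyc N (L - 1)" "distinct (map f [1..<L+1])"
    "set (map f [1..<L+1]) \<subseteq> A" "g ` set (map f [1..<L+1]) = set (map f [1..<L+1])"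
proof -
  note per = period_props[OF g, folded L_def]
  have st: "set (map f [1..<L+1]) = f ` {1..L}" by auto
  have inj: "inj (g ^^ s)" for s using permutes_inj[OF g(1)] by (rule inj_fn)
  have ne: "(g ^^ s) a \<noteq> (g ^^ s') a" if "s < s'" "s' < L" for s s'
  proof
    assume "(g ^^ s) a = (g ^^ s') a"
    hence "(g ^^ s) ((g ^^ (s' - s)) a) = (g ^^ s) a"
      using that funpow_add[of s "s' - s" g] by (simp add: fun_eq_iff)
    hence "(g ^^ (s' - s)) a = a" using inj[of s] by (simp add: inj_eq)
    thus False using per(3)[of "s' - s"] that by simp
  qed
  have injf: "inj_on f {1..L}"
  proof (rule inj_onI)
    fix s s' assume s: "s \<in> {1..L}" "s' \<in> {1..L}" "f s = f s'"
    show "s = s'"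
    proof (rule ccontr)
      assume "s \<noteq> s'"
      hence "s - 1 < s' - 1 \<and> s' - 1 < L \<or> s' - 1 < s - 1 \<and> s - 1 < L" using s by auto
      thus False using ne[of "s - 1" "s' - 1"] ne[of "s' - 1" "s - 1"] s(3) unfolding f_def by auto
    qed
  qed
  have fg: "f (long_cycle L t) = g (f t)" if "t \<in> {1..L}" for t
  proof (cases "t = L")
    case True
    have "g ((g ^^ (L - 1)) a) = (g ^^ Suc (L - 1)) a" by simp
    also have "\<dots> = a" using per(1,2) by simp
    finally show ?thesis using True by (simp add: f_def long_cycle_def)
  next
    case False
    hence "long_cycle L t = t + 1" using that by (simp add: long_cycle_def)
    moreover have "(g ^^ t) a = g ((g ^^ (t - 1)) a)"
      using that by (cases t) auto
    ultimately show ?thesis by (simp add: f_def)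
  qed
  have perm: "long_cycle L permutes {1..L}" using per(1) by (intro long_cycle_permutes) simp
  show "index_sum N (map f [1..<L+1]) g = cyc N (L - 1)"
    using index_sum_relabel[OF injf perm fg, where N=N] per(1) by (simp add: cyc_def)
  show "distinct (map f [1..<L+1])"
  proof -
    have "set [1..<L+1] = {1..L}" by auto
    thus ?thesis using injf by (simp only: distinct_map distinct_upt)
  qed
  have "(g ^^ s) a \<in> A" for s
    using g by (induction s) (simp_all add: permutes_in_image)
  hence "f s \<in> A" for s by (simp add: f_def)
  thus "set (map f [1..<L+1]) \<subseteq> A" by auto
  have "g ` (f ` {1..L}) = f ` (long_cycle L ` {1..L})"
    using fg by (force simp: image_image)
  also have "long_cycle L ` {1..L} = {1..L}" using perm by (rule permutes_image)
  finally show "g ` set (map f [1..<L+1]) = set (map f [1..<L+1])" unfolding st .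
qed

text \<open>A shortest cycle is split off first, so the generators come in the increasing order
  required by \<open>umon\<close>. The bound \<open>l\<close> carries this through the
  induction.\<close>

lemma cycle_sorted_order:
  assumes "g permutes S" "finite S" "A \<subseteq> S" "g ` A = A" "\<And>a. a \<in> A \<Longrightarrow> l \<le> period g a"
  shows "\<exists>ts \<mu>. set ts = A \<and> distinct ts \<and> (\<forall>i\<in>Poly_Mapping.keys \<mu>. l \<le> i + 1) \<and>
           (\<forall>N. index_sum N ts g = umon N \<mu>)"
  using assms(3-5)
proof (induction "card A" arbitrary: A l rule: less_induct)
  case less
  have inj: "inj g" using permutes_inj[OF assms(1)] .
  have finA: "finite A" using less.prems(1) assms(2) by (rule finite_subset)
  show ?case
  proof (cases "A = {}")
    case True
    have "index_sum N [] g = umon N 0" for N by (simp add: index_sum_def umon_0 fa_word_Nil)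
    thus ?thesis using True by (intro exI[of _ "[]"] exI[of _ 0]) auto
  next
    case False
    then obtain a where a: "a \<in> A" "\<And>b. b \<in> A \<Longrightarrow> period g a \<le> period g b"
      using arg_min_if_finite[OF finA False, of "period g"] by (metis not_le)
    have aS: "a \<in> S" using a less.prems by auto
    define L where "L = period g a"
    define c where "c = map (\<lambda>s. (g ^^ (s - 1)) a) [1..<L+1]"
    note cyc = index_sum_cycle[OF assms(1,2) aS, folded L_def, folded c_def]
    have L0: "L > 0" using period_props(1)[OF assms(1,2) aS] by (simp add: L_def)
    have gA: "g x \<in> A" if "x \<in> A" for x using that less.prems(2) by blast
    have pow: "(g ^^ s) a \<in> A" for s using a(1) gA by (induction s) auto
    have cA: "set c \<subseteq> A" unfolding c_def using pow by auto
    have ac: "a \<in> set c" unfolding c_def set_map using L0 by (intro image_eqI[of _ _ 1]) auto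
    let ?B = "A - set c"
    have cB: "card ?B < card A" using finA ac a(1) by (intro psubset_card_mono) auto
    have gB: "g ` ?B = ?B"
      using image_set_diff[OF inj, of A "set c"] less.prems(2) cyc(4) by simp
    have perB: "L \<le> period g b" if "b \<in> ?B" for b using a(2) that by (simp add: L_def)
    from less.hyps[OF cB _ gB perB] less.prems(1)
    obtain ts \<mu> where ih: "set ts = ?B" "distinct ts" "\<forall>i\<in>Poly_Mapping.keys \<mu>. L \<le> i + 1"
      "\<And>N. index_sum N ts g = umon N \<mu>" by blast
    show ?thesis
    proof (intro exI conjI)
      show "set (c @ ts) = A" using ih(1) cA by auto
      show "distinct (c @ ts)" using ih(1,2) cyc(2) by auto
      have "Poly_Mapping.keys (\<mu> + Poly_Mapping.single (L - 1) 1) \<subseteq> Poly_Mapping.keys \<mu> \<union> {L - 1}"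
        using keys_add[of \<mu> "Poly_Mapping.single (L - 1) (1::nat)"] by auto
      moreover have "l \<le> L" using less.prems(3)[OF a(1)] by (simp add: L_def)
      ultimately show "\<forall>i\<in>Poly_Mapping.keys (\<mu> + Poly_Mapping.single (L - 1) 1). l \<le> i + 1"
        using ih(3) L0 by fastforce
      show "\<forall>N. index_sum N (c @ ts) g = umon N (\<mu> + Poly_Mapping.single (L - 1) 1)"
      proof
        fix N
        have "index_sum N (c @ ts) g = cyc N (L - 1) * umon N \<mu>"
          using cyc(1,4) ih(1,4) gB by (subst index_sum_append) auto
        also have "\<dots> = umon N (\<mu> + Poly_Mapping.single (L - 1) 1)"
          using ih(3) by (subst umon_add_single_le) (auto simp: le_diff_conv)
        finally show "index_sum N (c @ ts) g = umon N (\<mu> + Poly_Mapping.single (L - 1) 1)" .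
      qed
    qed
  qed
qed

text \<open>By induction on length, shorter words are universal, and modulo them the order of the
  factors is immaterial. So the positions may be arranged cycle by cycle, where the sum is literally
  a monomial \<open>umon N \<mu>\<close> with \<open>\<mu>\<close> independent of
  \<open>N\<close>.\<close>

lemma universal_index_sum:
  assumes "distinct ts" "g permutes set ts"
  shows "universal (\<lambda>N. index_sum N ts g)"
  using assms
proof (induction "length ts" arbitrary: ts g rule: less_induct)
  case less
  have swap: "universal (\<lambda>N. index_sum N (u @ [b, a] @ v) g)"
    if "universal (\<lambda>N. index_sum N (u @ [a, b] @ v) g)"
      and ms: "mset (u @ [a, b] @ v) = mset ts" for u a b v
  proof -
    let ?A = "set (u @ [a, b] @ v)"
    have A: "?A = set ts" using ms mset_eq_setD by blast
    have dist: "distinct (u @ [a, b] @ v)" using ms less.prems(1) mset_eq_imp_distinct_iff by blast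
    have len: "length ts = length (u @ [a, b] @ v)" using ms mset_eq_length by metis
    have g: "g permutes ?A" using less.prems(2) A by simp
    let ?g' = "g \<circ> transpose a b"
    have g': "?g' permutes ?A" by (intro permutes_compose g permutes_swap_id) auto
    have 1: "universal (\<lambda>N. index_sum N (u @ [a] @ v) (skip b ?g'))"
    proof (rule less.hyps)
      have "set (u @ [a] @ v) = ?A - {b}" using dist by auto
      thus "skip b ?g' permutes set (u @ [a] @ v)" using skip_permutes[OF g', of b] by simp
    qed (use len dist in auto)
    have 2: "universal (\<lambda>N. index_sum N (u @ [b] @ v) (skip a ?g'))"
    proof (rule less.hyps)
      have "set (u @ [b] @ v) = ?A - {a}" using dist by auto
      thus "skip a ?g' permutes set (u @ [b] @ v)" using skip_permutes[OF g', of a] by simp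
    qed (use len dist in auto)
    have "universal (\<lambda>N. index_sum N (u @ [a, b] @ v) g
       - fa_scalar (poly (if ?g' b = b then polyN else 1) (of_nat N)) * index_sum N (u @ [a] @ v) (skip b ?g')
       + fa_scalar (poly (if ?g' a = a then polyN else 1) (of_nat N)) * index_sum N (u @ [b] @ v) (skip a ?g'))"
      by (intro universal_add universal_diff universal_scale that(1) 1 2)
    thus ?thesis
    proof (rule universal_cong)
      fix N :: nat
      show "index_sum N (u @ [a, b] @ v) g
       - fa_scalar (poly (if ?g' b = b then polyN else 1) (of_nat N)) * index_sum N (u @ [a] @ v) (skip b ?g')
       + fa_scalar (poly (if ?g' a = a then polyN else 1) (of_nat N)) * index_sum N (u @ [b] @ v) (skip a ?g')
       - index_sum N (u @ [b, a] @ v) g \<in> gl_ideal N"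
        using index_sum_swap_adjacent[OF dist refl g, of N]
        by (simp only: diff_diff_eq add_diff_eq diff_add_eq add.commute add.left_commute)
    qed
  qed
  obtain ts' \<mu> where ts': "set ts' = set ts" "distinct ts'" "\<And>N. index_sum N ts' g = umon N \<mu>"
    using cycle_sorted_order[OF less.prems(2) _ subset_refl, of 0] permutes_image[OF less.prems(2)] by auto
  have ms: "mset ts' = mset ts" using ts' less.prems(1) by (simp add: set_eq_iff_mset_eq_distinct)
  let ?Q = "\<lambda>xs. mset xs = mset ts \<and> universal (\<lambda>N. index_sum N xs g)"
  have "?Q ts"
  proof (rule mset_adjacent_swap_induct[where Q = ?Q])
    show "?Q ts'" using ms ts'(3) universal_umon[of \<mu>] by simp
    show "mset ts' = mset ts" by (rule ms)
    show "?Q (u @ [b, a] @ v)" if "?Q (u @ [a, b] @ v)" for u a b v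
      using that swap[of u a b v] by (auto simp: add_mset_commute)
  qed
  thus ?case by simp
qed

lemma universal_w_glN:
  assumes "\<alpha> permutes {1..m}"
  shows "\<exists>P. \<forall>N\<ge>1. U_eq N (eval_U N P) (w_glN N m \<alpha>)"
proof -
  have "set [1..<m+1] = {1..m}" by auto
  hence "universal (\<lambda>N. index_sum N [1..<m+1] \<alpha>)"
    using assms by (intro universal_index_sum) auto
  thus ?thesis unfolding universal_def w_glN_index_sum .
qed

subsection \<open>A representation of all gl(N)\<close>

text \<open>
  Operators on functionals of monomials in the matrix variables \<open>Y_ab\<close>, a monomial being a multiset
  of index pairs. The action is from the right, so the product is composition in reverse order.
\<close>

typedef endo = "{f :: ((nat \<times> nat) multiset \<Rightarrow> complex) \<Rightarrow> (nat \<times> nat) multiset \<Rightarrow> complex.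
   (\<forall>g h. f (\<lambda>x. g x + h x) = (\<lambda>x. f g x + f h x)) \<and> (\<forall>c g. f (\<lambda>x. c * g x) = (\<lambda>x. c * f g x))}"
  morphisms app Abs_endo
  by (rule exI[of _ "\<lambda>g. g"]) simp

setup_lifting type_definition_endo

instantiation endo :: ring_1
begin
lift_definition zero_endo :: endo is "\<lambda>g x. 0" by simp
lift_definition one_endo :: endo is "\<lambda>g. g" by simp
lift_definition plus_endo :: "endo \<Rightarrow> endo \<Rightarrow> endo" is "\<lambda>u v g x. u g x + v g x"
  by (auto simp: algebra_simps)
lift_definition minus_endo :: "endo \<Rightarrow> endo \<Rightarrow> endo" is "\<lambda>u v g x. u g x - v g x"
  by (auto simp: algebra_simps)
lift_definition uminus_endo :: "endo \<Rightarrow> endo" is "\<lambda>u g x. - u g x"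
  by (auto simp: algebra_simps)
lift_definition times_endo :: "endo \<Rightarrow> endo \<Rightarrow> endo" is "\<lambda>u v g. v (u g)"
  by auto
instance
proof
  show "(0::endo) \<noteq> 1"
    by transfer (metis zero_neq_one)
qed (transfer; auto simp: algebra_simps fun_eq_iff)+
end

lemma app_zero: "app 0 g x = 0" by transfer simp
lemma app_plus: "app (u + v) g x = app u g x + app v g x" by transfer simp
lemma app_times: "app (u * v) g = app v (app u g)" by transfer simp

lift_definition scal :: "complex \<Rightarrow> endo" is "\<lambda>c g x. c * g x"
  by (auto simp: algebra_simps)

lemma scal_add: "scal (a + b) = scal a + scal b" by transfer (auto simp: algebra_simps)
lemma scal_mult: "scal (a * b) = scal a * scal b" by transfer (auto simp: algebra_simps)
lemma scal_0: "scal 0 = 0" by transfer simp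
lemma scal_1: "scal 1 = 1" by transfer simp
lemma scal_commute: "u * scal a = scal a * u" by transfer (auto simp: fun_eq_iff)
lemma scal_diff: "scal (a - b) = scal a - scal b" by transfer (simp add: algebra_simps)
lemma scal_of_nat: "scal (of_nat n) = of_nat n"
  by (induction n) (simp_all add: scal_0 scal_1 scal_add)

text \<open>Transpose of \<open>\<Sum>_a Y_ai \<partial>/\<partial>Y_aj\<close>: one factor
  \<open>Y_aj\<close> of the monomial, counted with multiplicity, is replaced by
  \<open>Y_ai\<close>. Since \<open>a\<close> runs over all indices occurring in the monomial, no
  \<open>N\<close> enters.\<close>

definition hop :: "nat \<Rightarrow> nat \<Rightarrow> ((nat \<times> nat) multiset \<Rightarrow> complex) \<Rightarrow> (nat \<times> nat) multiset \<Rightarrow> complex" where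
  "hop i j G n = (\<Sum>x\<in>#n. if snd x = j then G (add_mset (fst x, i) (n - {#x#})) else 0)"

lemma hop_add: "hop i j (\<lambda>x. g x + h x) n = hop i j g n + hop i j h n"
  unfolding hop_def by (subst sum_mset.distrib[symmetric]) (intro arg_cong[where f = sum_mset] image_mset_cong, simp)

text \<open>
  The transpose of \<open>E_ij = Y_ji + \<Sum>_a Y_ai \<partial>/\<partial>Y_aj\<close>, which is the right translation action on
  \<open>f(Y) exp(tr Y)\<close>.
\<close>

lift_definition Eop :: "nat \<Rightarrow> nat \<Rightarrow> endo" is
  "\<lambda>i j G n. G (add_mset (j, i) n) + hop i j G n"
proof (intro conjI allI CollectI)
  fix i j and g h :: "(nat \<times> nat) multiset \<Rightarrow> complex"
  show "(\<lambda>n. g (add_mset (j, i) n) + h (add_mset (j, i) n) + hop i j (\<lambda>x. g x + h x) n) =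
     (\<lambda>x. g (add_mset (j, i) x) + hop i j g x + (h (add_mset (j, i) x) + hop i j h x))"
    by (simp add: hop_add algebra_simps)
next
  fix i j c and g :: "(nat \<times> nat) multiset \<Rightarrow> complex"
  have "hop i j (\<lambda>x. c * g x) n = c * hop i j g n" for n
    unfolding hop_def sum_mset_distrib_left by (intro arg_cong[where f = sum_mset] image_mset_cong, simp)
  thus "(\<lambda>n. c * g (add_mset (j, i) n) + hop i j (\<lambda>x. c * g x) n) =
     (\<lambda>x. c * (g (add_mset (j, i) x) + hop i j g x))"
    by (simp add: algebra_simps)
qed

lemma app_Eop: "app (Eop i j) G n = G (add_mset (j, i) n) + hop i j G n"
  by transfer simp

lemma sum_mset_remove: "x \<in># n \<Longrightarrow> (\<Sum>y\<in>#n. h y) = h x + (\<Sum>y\<in>#n - {#x#}. h y)"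
  for h :: "_ \<Rightarrow> 'a::comm_monoid_add"
  by (metis insert_DiffM image_mset_add_mset sum_mset.add_mset)

text \<open>Adding the diagonal terms completes both sides to full double sums, which can be
  interchanged.\<close>

lemma sum_mset_pairs_commute:
  fixes h :: "'b \<Rightarrow> 'b \<Rightarrow> 'a::ab_group_add"
  shows "(\<Sum>x\<in>#n. \<Sum>y\<in>#n - {#x#}. h x y) = (\<Sum>x\<in>#n. \<Sum>y\<in>#n - {#x#}. h y x)"
proof -
  have *: "(\<Sum>x\<in>#n. \<Sum>y\<in>#n - {#x#}. h x y) = (\<Sum>x\<in>#n. (\<Sum>y\<in>#n. h x y) - h x x)" for h :: "'b \<Rightarrow> 'b \<Rightarrow> 'a"
    by (intro arg_cong[where f = sum_mset] image_mset_cong) (simp add: sum_mset_remove[where n = n])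
  have sub: "(\<Sum>x\<in>#n. (\<Sum>y\<in>#n. h x y) - h x x) + (\<Sum>x\<in>#n. h x x) = (\<Sum>x\<in>#n. \<Sum>y\<in>#n. h x y)" for h :: "'b \<Rightarrow> 'b \<Rightarrow> 'a"
    by (simp flip: sum_mset.distrib)
  have **: "(\<Sum>x\<in>#n. (\<Sum>y\<in>#n. h x y) - h x x) = (\<Sum>x\<in>#n. \<Sum>y\<in>#n. h x y) - (\<Sum>x\<in>#n. h x x)" for h :: "'b \<Rightarrow> 'b \<Rightarrow> 'a"
    unfolding eq_diff_eq by (rule sub)
  have "(\<Sum>x\<in>#n. \<Sum>y\<in>#m. h x y) = (\<Sum>y\<in>#m. \<Sum>x\<in>#n. h x y)" for m
    by (induction n) (simp_all add: sum_mset.distrib)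
  thus ?thesis
    unfolding *[of h] *[of "\<lambda>x y. h y x"] **[of h] **[of "\<lambda>x y. h y x"] by simp
qed

lemma hop_add_mset:
  "hop i j G (add_mset (l, k) n) =
     (if k = j then G (add_mset (l, i) n) else 0) + hop i j (\<lambda>n. G (add_mset (l, k) n)) n"
proof -
  have "hop i j G (add_mset (l, k) n) = (if k = j then G (add_mset (l, i) n) else 0) +
     (\<Sum>x\<in>#n. if snd x = j then G (add_mset (fst x, i) (add_mset (l, k) n - {#x#})) else 0)"
    by (simp add: hop_def)
  also have "(\<Sum>x\<in>#n. if snd x = j then G (add_mset (fst x, i) (add_mset (l, k) n - {#x#})) else 0)
     = hop i j (\<lambda>n. G (add_mset (l, k) n)) n"
    unfolding hop_def
    by (intro arg_cong[where f = sum_mset] image_mset_cong)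
       (auto simp: add_mset_commute dest!: multi_member_split)
  finally show ?thesis .
qed

text \<open>The second replacement either hits the factor just created, which needs
  \<open>k = j\<close>, or a different one.\<close>

lemma hop_hop:
  "hop k l (hop i j G) n = (if k = j then hop i l G n else 0) +
     (\<Sum>x\<in>#n. \<Sum>y\<in>#n - {#x#}. if snd x = l \<and> snd y = j then
        G (add_mset (fst y, i) (add_mset (fst x, k) (n - {#x#} - {#y#}))) else 0)"
proof -
  have "hop k l (hop i j G) n = (\<Sum>x\<in>#n. (if k = j \<and> snd x = l then G (add_mset (fst x, i) (n - {#x#})) else 0) +
     (\<Sum>y\<in>#n - {#x#}. if snd x = l \<and> snd y = j then
        G (add_mset (fst y, i) (add_mset (fst x, k) (n - {#x#} - {#y#}))) else 0))"
    unfolding hop_def[of k l]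
  proof (intro arg_cong[where f = sum_mset] image_mset_cong)
    fix x assume "x \<in># n"
    have "hop i j (\<lambda>n. G (add_mset (fst x, k) n)) m =
      (\<Sum>y\<in>#m. if snd y = j then G (add_mset (fst y, i) (add_mset (fst x, k) (m - {#y#}))) else 0)" for m
      unfolding hop_def by (intro arg_cong[where f = sum_mset] image_mset_cong) (simp add: add_mset_commute)
    thus "(if snd x = l then hop i j G (add_mset (fst x, k) (n - {#x#})) else 0) =
       (if k = j \<and> snd x = l then G (add_mset (fst x, i) (n - {#x#})) else 0) +
       (\<Sum>y\<in>#n - {#x#}. if snd x = l \<and> snd y = j then
        G (add_mset (fst y, i) (add_mset (fst x, k) (n - {#x#} - {#y#}))) else 0)"
      by (simp add: hop_add_mset)
  qed
  also have "\<dots> = (\<Sum>x\<in>#n. (if k = j \<and> snd x = l then G (add_mset (fst x, i) (n - {#x#})) else 0)) +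
     (\<Sum>x\<in>#n. \<Sum>y\<in>#n - {#x#}. if snd x = l \<and> snd y = j then
        G (add_mset (fst y, i) (add_mset (fst x, k) (n - {#x#} - {#y#}))) else 0)"
    by (rule sum_mset.distrib)
  also have "(\<Sum>x\<in>#n. (if k = j \<and> snd x = l then G (add_mset (fst x, i) (n - {#x#})) else 0)) =
     (if k = j then hop i l G n else 0)"
    by (simp add: hop_def)
  finally show ?thesis .
qed

text \<open>Contributions in which the two operators act at different places are symmetric and
  cancel. There remain those where one operator acts on the factor created by the other.\<close>

lemma Eop_commutator:
  "Eop i j * Eop k l - Eop k l * Eop i j =
     (if j = k then Eop i l else 0) - (if l = i then Eop k j else 0)"
proof -
  let ?D = "\<lambda>i j k l G n. \<Sum>x\<in>#n. \<Sum>y\<in>#n - {#x#}. if snd x = l \<and> snd y = j then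
        G (add_mset (fst y, i) (add_mset (fst x, k) (n - {#x#} - {#y#}))) else 0"
  have prod: "app (Eop i j * Eop k l) G n =
      G (add_mset (j, i) (add_mset (l, k) n)) + (if j = k then app (Eop i l) G n else 0)
      + hop i j (\<lambda>n. G (add_mset (l, k) n)) n + hop k l (\<lambda>n. G (add_mset (j, i) n)) n
      + ?D i j k l G n" for i j k l G n
  proof -
    have "hop k l (app (Eop i j) G) n = hop k l (\<lambda>n. G (add_mset (j, i) n)) n + hop k l (hop i j G) n"
      using hop_add[of k l "\<lambda>n. G (add_mset (j, i) n)" "hop i j G" n] by (simp add: app_Eop[abs_def])
    thus ?thesis by (simp add: app_times app_Eop hop_add_mset hop_hop add_ac)
  qed
  have sym: "?D i j k l G n = ?D k l i j G n" for G :: "(nat \<times> nat) multiset \<Rightarrow> complex" and n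
    using sum_mset_pairs_commute[of "\<lambda>x y. if snd x = l \<and> snd y = j then
        G (add_mset (fst y, i) (add_mset (fst x, k) (n - {#x#} - {#y#}))) else 0" n]
    by (simp add: add_mset_commute diff_right_commute conj_commute cong: if_cong)
  have "app (Eop i j * Eop k l) G n + app (if l = i then Eop k j else 0) G n =
        app (Eop k l * Eop i j) G n + app (if j = k then Eop i l else 0) G n" for G n
    unfolding prod sym by (auto simp: app_zero add_mset_commute add_ac)
  hence "Eop i j * Eop k l + (if l = i then Eop k j else 0) =
        Eop k l * Eop i j + (if j = k then Eop i l else 0)"
    by (metis app_inject app_plus ext)
  thus ?thesis by (simp add: algebra_simps)
qed

section \<open>The induced homomorphism on the free algebra\<close>

definition word_op :: "(nat \<times> nat) list \<Rightarrow> endo" where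
  "word_op w = prod_list (map (\<lambda>(i, j). Eop i j) w)"

definition rep :: "fa \<Rightarrow> endo" where
  "rep p = (\<Sum>u\<in>Poly_Mapping.keys p. scal (Poly_Mapping.lookup p u) * word_op u)"

lemma rep_add: "rep (p + q) = rep p + rep q"
  unfolding rep_def by (rule setsum_keys_plus_distrib) (simp_all add: scal_0 scal_add distrib_right)

lemma rep_0: "rep 0 = 0" by (simp add: rep_def)

lemma rep_single: "rep (Poly_Mapping.single w c) = scal c * word_op w"
  by (cases "c = 0") (simp_all add: rep_def scal_0)

lemma rep_sum: "rep (sum f A) = (\<Sum>x\<in>A. rep (f x))"
  by (induction A rule: infinite_finite_induct) (simp_all add: rep_0 rep_add)

lemma rep_word: "rep (fa_word w) = word_op w"
  by (simp add: fa_word_def rep_single scal_1)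

lemma rep_scalar: "rep (fa_scalar c) = scal c"
  by (simp add: fa_scalar_def rep_single word_op_def)

lemma rep_1: "rep 1 = 1"
  using rep_scalar[of 1] by (simp add: fa_scalar_1 scal_1)

lemma rep_mult: "rep (p * q) = rep p * rep q"
proof (rule poly_mapping_additive_eqI[of "\<lambda>p. rep (p * q)" "\<lambda>p. rep p * rep q"])
  fix u a
  show "rep (Poly_Mapping.single u a * q) = rep (Poly_Mapping.single u a) * rep q"
  proof (rule poly_mapping_additive_eqI[of "\<lambda>q. rep (Poly_Mapping.single u a * q)" "\<lambda>q. rep (Poly_Mapping.single u a) * rep q"])
    fix v b
    have "scal a * scal b * (word_op u * word_op v) = scal a * word_op u * (scal b * word_op v)"
      by (metis mult.assoc scal_commute)
    thus "rep (Poly_Mapping.single u a * Poly_Mapping.single v b) = rep (Poly_Mapping.single u a) * rep (Poly_Mapping.single v b)"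
      by (simp add: rep_single mult_single plus_list_def scal_mult word_op_def)
  qed (simp_all add: distrib_left rep_add rep_0)
qed (simp_all add: distrib_right rep_add rep_0)

lemma rep_uminus: "rep (- p) = - rep p"
proof -
  have "rep (- p) + rep p = 0" by (simp add: rep_0 flip: rep_add)
  thus ?thesis by (simp add: eq_neg_iff_add_eq_0)
qed

lemma rep_diff: "rep (p - q) = rep p - rep q"
  using rep_add[of p "- q"] by (simp add: rep_uminus)

lemma rep_power: "rep (p ^ n) = rep p ^ n"
  by (induction n) (simp_all add: rep_1 rep_mult)

lemma rep_gl_rel: "rep (gl_rel u i j k l v) = 0"
proof -
  have "rep (gl_rel u i j k l v) = word_op u * (Eop i j * Eop k l - Eop k l * Eop i j
     - (if j = k then Eop i l else 0) + (if l = i then Eop k j else 0)) * word_op v"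
    by (simp add: gl_rel_def rep_add rep_diff rep_word rep_0 word_op_def algebra_simps)
  also have "\<dots> = 0" by (simp add: Eop_commutator)
  finally show ?thesis .
qed

lemma rep_gl_ideal: "p \<in> gl_ideal N \<Longrightarrow> rep p = 0"
  by (induction rule: gl_ideal.induct)
     (simp_all add: rep_0 rep_add fa_smult_def fa_mult_eq_times rep_mult rep_gl_rel)

lemma rep_U_eq: "U_eq N p q \<Longrightarrow> rep p = rep q"
  unfolding U_eq_def using rep_gl_ideal[of "p - q" N] by (simp add: rep_diff)

subsection \<open>Central elements\<close>

fun Epow :: "nat \<Rightarrow> nat \<Rightarrow> nat \<Rightarrow> nat \<Rightarrow> endo" where
  "Epow N 0 i j = (if i = j then 1 else 0)"
| "Epow N (Suc k) i j = (\<Sum>l=1..N. Eop i l * Epow N k l j)"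

definition Ctr :: "nat \<Rightarrow> nat \<Rightarrow> endo" where
  "Ctr N k = (\<Sum>i=1..N. Epow N k i i)"

lemma Epow_1: "j \<in> {1..N} \<Longrightarrow> Epow N (Suc 0) i j = Eop i j"
proof -
  assume j: "j \<in> {1..N}"
  have "Epow N (Suc 0) i j = (\<Sum>l=1..N. if l = j then Eop i l else 0)"
    unfolding Epow.simps by (intro sum.cong refl) simp
  also have "\<dots> = Eop i j" using j by (subst sum.delta) auto
  finally show ?thesis .
qed

lemma word_op_Cons: "word_op ((i, j) # w) = Eop i j * word_op w"
  by (simp add: word_op_def)

text \<open>A power of the matrix \<open>E\<close> as a sum over paths. The fixed end points sit at
  the positions \<open>s\<close> and \<open>s+m+1\<close>; \<open>s\<close> and \<open>a\<close> are
  general because peeling off the first step moves both.\<close>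

lemma Epow_path_sum:
  assumes "b \<in> {1..N}"
  shows "(\<Sum>i\<in>Pi\<^sub>E {s+1..s+m} (\<lambda>_. {1..N}).
      word_op (map (\<lambda>t. ((i(s := a, s+m+1 := b)) t, (i(s := a, s+m+1 := b)) (t+1))) [s..<s+m+1]))
    = Epow N (Suc m) a b"
proof (induction m arbitrary: s a)
  case 0
  show ?case using Epow_1[OF assms] by (simp add: word_op_def)
next
  case (Suc m)
  let ?D = "\<lambda>_::nat. {1..N}"
  let ?W = "\<lambda>i s m a. word_op (map (\<lambda>t. ((i(s := a, s+m+1 := b)) t, (i(s := a, s+m+1 := b)) (t+1))) [s..<s+m+1])"
  have set: "{s+1..s+Suc m} = insert (s+1) {(s+1)+1..(s+1)+m}" by auto
  have notin: "s + 1 \<notin> {(s+1)+1..(s+1)+m}" by simp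
  have step: "?W (i(s+1 := x)) s (Suc m) a = Eop a x * ?W i (s+1) m x" for i x
  proof -
    have l1: "[s..<s + Suc m + 1] = s # [s+1..<(s+1)+m+1]" by (simp add: upt_conv_Cons del: upt_Suc)
    have l2: "map (\<lambda>t. (((i(s+1 := x))(s := a, s+Suc m+1 := b)) t, ((i(s+1 := x))(s := a, s+Suc m+1 := b)) (t+1))) [s+1..<(s+1)+m+1]
       = map (\<lambda>t. ((i(s+1 := x, (s+1)+m+1 := b)) t, (i(s+1 := x, (s+1)+m+1 := b)) (t+1))) [s+1..<(s+1)+m+1]"
      by (intro map_cong refl) auto
    have l3: "((i(s+1 := x))(s := a, s+Suc m+1 := b)) s = a" "((i(s+1 := x))(s := a, s+Suc m+1 := b)) (s+1) = x"
      by auto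
    show ?thesis by (simp only: l1 list.map l2 l3 word_op_Cons)
  qed
  have "(\<Sum>i\<in>Pi\<^sub>E {s+1..s+Suc m} ?D. ?W i s (Suc m) a) =
     (\<Sum>x=1..N. \<Sum>i\<in>Pi\<^sub>E {(s+1)+1..(s+1)+m} ?D. Eop a x * ?W i (s+1) m x)"
    unfolding set sum_PiE_insert[OF notin] step ..
  also have "\<dots> = (\<Sum>x=1..N. Eop a x * Epow N (Suc m) x b)"
    unfolding sum_distrib_left[symmetric] Suc.IH ..
  also have "\<dots> = Epow N (Suc (Suc m)) a b" by (rule Epow.simps(2)[symmetric])
  finally show ?case .
qed

lemma rep_cyc: "rep (cyc N k) = Ctr N (k + 1)"
proof -
  let ?D = "\<lambda>_::nat. {1..N}"
  let ?W = "\<lambda>i. word_op (map (\<lambda>t. (i t, i (long_cycle (k+1) t))) [1..<k+1+1])"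
  have set: "{1..k+1} = insert 1 {1+1..1+k}" by auto
  have notin: "1 \<notin> {1+1..1+k}" by simp
  \<comment> \<open>The cycle is cut open at position 1: the last factor returns to the index
    \<open>a\<close>, now stored at the extra position \<open>1+k+1\<close>.\<close>
  have step: "?W (i(1 := a)) = word_op (map (\<lambda>t. ((i(1 := a, 1+k+1 := a)) t, (i(1 := a, 1+k+1 := a)) (t+1))) [1..<1+k+1])" for i a
    unfolding word_op_def
    by (intro arg_cong[where f = prod_list] arg_cong[where f = "map _"])
       (intro map_cong, auto simp: long_cycle_def)
  have "rep (cyc N k) = (\<Sum>i\<in>Pi\<^sub>E {1..k+1} ?D. ?W i)"
    by (simp only: cyc_def w_glN_def rep_sum rep_word)
  also have "\<dots> = (\<Sum>a=1..N. \<Sum>i\<in>Pi\<^sub>E {1+1..1+k} ?D. ?W (i(1 := a)))"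
    unfolding set by (rule sum_PiE_insert[OF notin])
  also have "\<dots> = (\<Sum>a=1..N. Epow N (Suc k) a a)"
    unfolding step by (intro sum.cong refl Epow_path_sum)
  finally show ?thesis by (simp add: Ctr_def)
qed

text \<open>Commutation with \<open>Eop a b\<close> is a derivation, and in the product of matrices
  the inner terms cancel. So powers of \<open>E\<close> transform like \<open>E\<close> itself, and
  their traces commute with every \<open>Eop a b\<close>.\<close>

lemma Eop_Epow_commutator:
  assumes "a \<in> {1..N}" "b \<in> {1..N}"
  shows "Eop a b * Epow N k i j - Epow N k i j * Eop a b =
    (if b = i then Epow N k a j else 0) - (if j = a then Epow N k i b else 0)"
proof (induction k arbitrary: i j)
  case 0
  show ?case by auto
next
  case (Suc k)
  let ?P = "Epow N k"
  have lie: "x * (y * z) - y * z * x = (x * y - y * x) * z + y * (x * z - z * x)" for x y z :: endo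
    by (simp add: algebra_simps)
  have "Eop a b * Epow N (Suc k) i j - Epow N (Suc k) i j * Eop a b =
     (\<Sum>l=1..N. Eop a b * (Eop i l * ?P l j) - Eop i l * ?P l j * Eop a b)"
    by (simp add: sum_distrib_left sum_distrib_right sum_subtractf)
  also have "\<dots> = (\<Sum>l=1..N. ((if b = i then Eop a l * ?P l j else 0) - (if l = a then Eop i b * ?P l j else 0))
      + ((if l = b then Eop i l * ?P a j else 0) - (if j = a then Eop i l * ?P l b else 0)))"
    unfolding lie Eop_commutator Suc.IH
    by (intro sum.cong refl) (simp add: left_diff_distrib right_diff_distrib)
  also have "\<dots> = (if b = i then Epow N (Suc k) a j else 0) - (if j = a then Epow N (Suc k) i b else 0)"
    using assms by (simp add: sum.distrib sum_subtractf sum.delta)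
  finally show ?case .
qed

lemma Ctr_commute_Eop:
  assumes "a \<in> {1..N}" "b \<in> {1..N}"
  shows "Eop a b * Ctr N k = Ctr N k * Eop a b"
proof -
  have "Eop a b * Ctr N k - Ctr N k * Eop a b =
    (\<Sum>i=1..N. Eop a b * Epow N k i i - Epow N k i i * Eop a b)"
    by (simp add: Ctr_def sum_distrib_left sum_distrib_right sum_subtractf)
  also have "\<dots> = 0"
    using assms by (simp add: Eop_Epow_commutator sum_subtractf sum.delta sum.delta')
  finally show ?thesis by simp
qed

lemma Ctr_commute_Epow:
  assumes "i \<in> {1..N}" "j \<in> {1..N}"
  shows "Epow N l i j * Ctr N k = Ctr N k * Epow N l i j"
  using assms
proof (induction l arbitrary: i)
  case (Suc l)
  have "Eop i x * Epow N l x j * Ctr N k = Ctr N k * (Eop i x * Epow N l x j)" if "x \<in> {1..N}" for x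
    using Suc.IH[OF that Suc.prems(2)] Ctr_commute_Eop[OF Suc.prems(1) that, of k] by (metis mult.assoc)
  thus ?case by (simp add: sum_distrib_left sum_distrib_right)
qed auto

lemma Ctr_commute: "Ctr N l * Ctr N k = Ctr N k * Ctr N l"
  unfolding Ctr_def[of N l] sum_distrib_left sum_distrib_right
  by (intro sum.cong refl Ctr_commute_Epow)

definition emon :: "nat \<Rightarrow> (nat \<Rightarrow>\<^sub>0 nat) \<Rightarrow> endo" where
  "emon N \<mu> = rep (umon N \<mu>)"

definition ev :: "nat \<Rightarrow> mpoly \<Rightarrow> endo" where
  "ev N P = rep (eval_U N P)"

lemma emon_foldr: "emon N \<mu> = foldr (\<lambda>i acc. Ctr N (i+1) ^ Poly_Mapping.lookup \<mu> i * acc)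
     (sorted_list_of_set (Poly_Mapping.keys \<mu>)) 1"
proof -
  have "rep (foldr (\<lambda>i acc. cyc N i ^ Poly_Mapping.lookup \<mu> i * acc) xs 1) =
    foldr (\<lambda>i acc. Ctr N (i+1) ^ Poly_Mapping.lookup \<mu> i * acc) xs 1" for xs
    by (induction xs) (simp_all add: rep_1 rep_mult rep_power rep_cyc)
  thus ?thesis by (simp add: emon_def umon_def)
qed

lemma foldr_filter_nontrivial:
  fixes f :: "'b \<Rightarrow> 'a::monoid_mult"
  assumes "\<And>x. x \<in> set xs \<Longrightarrow> \<not> P x \<Longrightarrow> f x = 1"
  shows "foldr (\<lambda>x acc. f x * acc) (filter P xs) a = foldr (\<lambda>x acc. f x * acc) xs a"
  using assms by (induction xs) auto

text \<open>Using one common range of indices, whatever the support, lets monomials with different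
  supports be compared factor by factor.\<close>

lemma emon_upt:
  assumes "Poly_Mapping.keys \<mu> \<subseteq> {..<M}"
  shows "emon N \<mu> = foldr (\<lambda>i acc. Ctr N (i+1) ^ Poly_Mapping.lookup \<mu> i * acc) [0..<M] 1"
proof -
  have "sorted_list_of_set (Poly_Mapping.keys \<mu>) = filter (\<lambda>i. i \<in> Poly_Mapping.keys \<mu>) [0..<M]"
  proof (rule sorted_distinct_set_unique)
    show "set (sorted_list_of_set (Poly_Mapping.keys \<mu>)) = set (filter (\<lambda>i. i \<in> Poly_Mapping.keys \<mu>) [0..<M])"
      using assms by auto
  qed (auto simp: sorted_wrt_filter)
  thus ?thesis unfolding emon_foldr
    using foldr_filter_nontrivial[of "[0..<M]" "\<lambda>i. i \<in> Poly_Mapping.keys \<mu>" "\<lambda>i. Ctr N (i+1) ^ Poly_Mapping.lookup \<mu> i" 1]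
    by (simp add: in_keys_iff)
qed

lemma Ctr_commute_power: "Ctr N l ^ n * Ctr N k = Ctr N k * Ctr N l ^ n"
proof (induction n)
  case (Suc n)
  have "Ctr N l ^ Suc n * Ctr N k = Ctr N l * (Ctr N k * Ctr N l ^ n)" by (simp add: mult.assoc Suc)
  also have "\<dots> = Ctr N k * Ctr N l * Ctr N l ^ n" by (metis Ctr_commute mult.assoc)
  finally show ?case by (simp add: mult.assoc)
qed simp

text \<open>In contrast to \<open>umon_add_single_le\<close>, \<open>k\<close> is arbitrary here:
  the images of the generators commute.\<close>

lemma emon_add_single: "emon N (\<mu> + Poly_Mapping.single k 1) = Ctr N (k + 1) * emon N \<mu>"
proof -
  let ?\<nu> = "\<mu> + Poly_Mapping.single k 1"
  let ?f = "\<lambda>\<mu> i acc. Ctr N (i+1) ^ Poly_Mapping.lookup \<mu> i * acc"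
  define M where "M = Suc (Max (insert k (Poly_Mapping.keys \<mu>)))"
  have lt: "x < M" if "x \<in> insert k (Poly_Mapping.keys \<mu>)" for x
    unfolding M_def using that by (intro le_imp_less_Suc Max_ge) auto
  have sub: "Poly_Mapping.keys \<mu> \<subseteq> {..<M}" "Poly_Mapping.keys ?\<nu> \<subseteq> {..<M}"
    using lt keys_add[of \<mu> "Poly_Mapping.single k (1::nat)"] by auto
  have *: "foldr (?f ?\<nu>) xs a = foldr (?f \<mu>) xs a" if "k \<notin> set xs" for xs a
    using that by (intro foldr_cong) (auto simp: lookup_add lookup_single when_def)
  have "foldr (?f ?\<nu>) xs 1 = Ctr N (k + 1) * foldr (?f \<mu>) xs 1" if "k \<in> set xs" "distinct xs" for xs
    using that
  proof (induction xs)
    case (Cons x xs)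
    show ?case
    proof (cases "x = k")
      case True
      hence "k \<notin> set xs" using Cons.prems by auto
      thus ?thesis using True * by (simp add: lookup_add mult.assoc)
    next
      case False
      hence "foldr (?f ?\<nu>) xs 1 = Ctr N (k + 1) * foldr (?f \<mu>) xs 1" using Cons by auto
      moreover have "Poly_Mapping.lookup ?\<nu> x = Poly_Mapping.lookup \<mu> x"
        using False by (simp add: lookup_add lookup_single when_def)
      ultimately show ?thesis
        by (simp only: foldr.simps o_apply mult.assoc[symmetric] Ctr_commute_power)
    qed
  qed simp
  moreover have "k \<in> set [0..<M]" using lt[of k] by simp
  ultimately show ?thesis
    unfolding emon_upt[OF sub(1)] emon_upt[OF sub(2)] using distinct_upt by blast
qed

lemma ev_add: "ev N (P + Q) = ev N P + ev N Q"
  by (simp add: ev_def eval_U_add rep_add)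

lemma ev_0: "ev N 0 = 0"
  by (simp add: ev_def eval_U_0 rep_0)

lemma ev_sum: "ev N (sum f A) = (\<Sum>x\<in>A. ev N (f x))"
  by (simp add: ev_def eval_U_sum rep_sum)

lemma ev_diff: "ev N (P - Q) = ev N P - ev N Q"
  using ev_add[of N "P - Q" Q] by simp

lemma ev_single: "ev N (Poly_Mapping.single \<mu> c) = scal (poly c (of_nat N)) * emon N \<mu>"
  by (simp add: ev_def emon_def eval_U_single rep_mult rep_scalar)

lemma ev_1: "ev N 1 = 1"
  using ev_single[of N 0 1] by (simp add: emon_def umon_0 rep_1 scal_1)

lemma ev_expand: "ev N P = (\<Sum>\<mu>\<in>Poly_Mapping.keys P. scal (poly (Poly_Mapping.lookup P \<mu>) (of_nat N)) * emon N \<mu>)"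
  by (simp add: ev_def emon_def eval_U_umon rep_mult rep_scalar rep_sum)

lemma ev_mconst_mult: "ev N (mconst c * P) = scal (poly c (of_nat N)) * ev N P"
  by (simp add: ev_def eval_U_mconst_mult rep_mult rep_scalar)

lemma ev_mvar_mult: "ev N (mvar k * P) = Ctr N (k + 1) * ev N P"
proof (rule poly_mapping_additive_eqI[of "\<lambda>P. ev N (mvar k * P)"])
  fix \<mu> c
  have "scal x * (Ctr N (k+1) * y) = Ctr N (k+1) * (scal x * y)" for x y
    by (metis mult.assoc scal_commute)
  thus "ev N (mvar k * Poly_Mapping.single \<mu> c) = Ctr N (k + 1) * ev N (Poly_Mapping.single \<mu> c)"
    using emon_add_single[of N \<mu> k] by (simp add: mvar_def mult_single ev_single add.commute)
qed (simp_all add: distrib_left ev_add ev_0)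

subsection \<open>Symbols and uniqueness\<close>

text \<open>The lowest part of the functional is \<open>c\<close> times evaluation at the point
  \<open>Y\<close>. Degrees above \<open>d\<close> are left free, which is where the lower order
  terms of an operator end up.\<close>

definition homog :: "(nat \<times> nat \<Rightarrow> complex) \<Rightarrow> nat \<Rightarrow> complex \<Rightarrow> ((nat \<times> nat) multiset \<Rightarrow> complex) \<Rightarrow> bool" where
  "homog Y d c G \<longleftrightarrow> (\<forall>n. size n < d \<longrightarrow> G n = 0) \<and> (\<forall>n. size n = d \<longrightarrow> G n = c * (\<Prod>x\<in>#n. Y x))"

text \<open>
  \<open>u\<close> has order at most \<open>w\<close>, and \<open>s\<close> is its symbol of degree \<open>w\<close> at the point \<open>Y\<close>.
\<close>

definition has_sym :: "(nat \<times> nat \<Rightarrow> complex) \<Rightarrow> nat \<Rightarrow> complex \<Rightarrow> endo \<Rightarrow> bool" where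
  "has_sym Y w s u \<longleftrightarrow> (\<forall>d c G. homog Y (d + w) c G \<longrightarrow> homog Y d (c * s) (app u G))"

lemma has_sym_mult:
  assumes "has_sym Y w s u" "has_sym Y w' s' u'"
  shows "has_sym Y (w + w') (s * s') (u * u')"
  unfolding has_sym_def
proof (intro allI impI)
  fix d c G assume "homog Y (d + (w + w')) c G"
  hence "homog Y ((d + w') + w) c G" by (simp add: add_ac)
  hence "homog Y (d + w') (c * s) (app u G)" using assms(1) unfolding has_sym_def by blast
  hence "homog Y d (c * s * s') (app u' (app u G))" using assms(2) unfolding has_sym_def by blast
  thus "homog Y d (c * (s * s')) (app (u * u') G)" by (simp add: app_times mult.assoc)
qed

lemma has_sym_add: "has_sym Y w s u \<Longrightarrow> has_sym Y w s' u' \<Longrightarrow> has_sym Y w (s + s') (u + u')"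
  unfolding has_sym_def
proof (intro allI impI)
  fix d c G
  assume "\<forall>d c G. homog Y (d + w) c G \<longrightarrow> homog Y d (c * s) (app u G)"
    "\<forall>d c G. homog Y (d + w) c G \<longrightarrow> homog Y d (c * s') (app u' G)" "homog Y (d + w) c G"
  hence "homog Y d (c * s) (app u G)" "homog Y d (c * s') (app u' G)" by blast+
  thus "homog Y d (c * (s + s')) (app (u + u') G)"
    unfolding homog_def by (simp add: app_plus algebra_simps)
qed

lemma has_sym_0: "has_sym Y w 0 0"
  unfolding has_sym_def homog_def by (simp add: app_zero)

lemma has_sym_sum: "(\<And>x. x \<in> A \<Longrightarrow> has_sym Y w (s x) (u x)) \<Longrightarrow> has_sym Y w (sum s A) (sum u A)"
  by (induction A rule: infinite_finite_induct) (simp_all add: has_sym_0 has_sym_add)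

lemma has_sym_scal: "has_sym Y 0 a (scal a)"
  unfolding has_sym_def homog_def by (simp add: scal.rep_eq mult_ac)

lemma has_sym_1: "has_sym Y 0 1 1"
  using has_sym_scal[of Y 1] by (simp add: scal_1)

lemma has_sym_less: 
  assumes "has_sym Y w s u" "w < w'"
  shows "has_sym Y w' 0 u"
  unfolding has_sym_def
proof (intro allI impI)
  fix d c G assume "homog Y (d + w') c G"
  hence "homog Y ((d + (w' - w)) + w) c G" using assms(2) by simp
  hence "homog Y (d + (w' - w)) (c * s) (app u G)" using assms(1) unfolding has_sym_def by blast
  thus "homog Y d (c * 0) (app u G)" using assms(2) unfolding homog_def by auto
qed

lemma has_sym_power: "has_sym Y w s u \<Longrightarrow> has_sym Y (n * w) (s ^ n) (u ^ n)"
  by (induction n) (simp_all add: has_sym_1 has_sym_mult)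

text \<open>\<open>hop\<close> preserves the degree and is thus of lower order. The symbol comes
  solely from multiplication by \<open>Y_ji\<close>, the term produced by the factor
  \<open>exp(tr Y)\<close>.\<close>

lemma has_sym_Eop: "has_sym Y 1 (Y (j, i)) (Eop i j)"
  unfolding has_sym_def
proof (intro allI impI)
  fix d c G assume G: "homog Y (d + 1) c G"
  have hop: "hop i j G n = 0" if "size n \<le> d" for n
  proof -
    have "hop i j G n = (\<Sum>x\<in>#n. 0)"
      unfolding hop_def
    proof (intro arg_cong[where f = sum_mset] image_mset_cong)
      fix x assume "x \<in># n"
      hence "size (add_mset (fst x, i) (n - {#x#})) = size n"
        by (metis insert_DiffM size_add_mset)
      thus "(if snd x = j then G (add_mset (fst x, i) (n - {#x#})) else 0) = 0"
        using G that unfolding homog_def by auto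
    qed
    thus ?thesis by simp
  qed
  show "homog Y d (c * Y (j, i)) (app (Eop i j) G)"
    using G unfolding homog_def by (auto simp: app_Eop hop)
qed

text \<open>Test on evaluation at \<open>Y\<close> cut off to degree \<open>w\<close>: its image
  takes the value \<open>s\<close> at the empty monomial.\<close>

lemma has_sym_zeroD:
  assumes "has_sym Y w s 0"
  shows "s = 0"
proof -
  have "homog Y (0 + w) 1 (\<lambda>n. if size n = w then \<Prod>x\<in>#n. Y x else 0)"
    unfolding homog_def by auto
  hence "homog Y 0 (1 * s) (app 0 (\<lambda>n. if size n = w then \<Prod>x\<in>#n. Y x else 0))"
    using assms unfolding has_sym_def by blast
  thus ?thesis unfolding homog_def by (auto simp: app_zero)
qed

definition diag :: "(nat \<Rightarrow> complex) \<Rightarrow> nat \<times> nat \<Rightarrow> complex" where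
  "diag y = (\<lambda>(i, j). if i = j then y i else 0)"

lemma has_sym_Epow:
  assumes "i \<in> {1..N}"
  shows "has_sym (diag y) k (if i = j then y i ^ k else 0) (Epow N k i j)"
  using assms
proof (induction k arbitrary: i)
  case 0
  show ?case using has_sym_0 has_sym_1 by simp
next
  case (Suc k)
  have "has_sym (diag y) (1 + k) (\<Sum>l=1..N. diag y (l, i) * (if l = j then y l ^ k else 0)) (Epow N (Suc k) i j)"
    unfolding Epow.simps by (intro has_sym_sum has_sym_mult has_sym_Eop Suc.IH)
  also have "(\<Sum>l=1..N. diag y (l, i) * (if l = j then y l ^ k else 0)) =
     (\<Sum>l=1..N. if l = i then (if i = j then y i ^ Suc k else 0) else 0)"
    by (intro sum.cong refl) (auto simp: diag_def)
  also have "\<dots> = (if i = j then y i ^ Suc k else 0)"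
    using Suc.prems by (subst sum.delta) auto
  finally show ?case by simp
qed

lemma has_sym_Ctr: "has_sym (diag y) k (\<Sum>i=1..N. y i ^ k) (Ctr N k)"
  unfolding Ctr_def
proof (rule has_sym_sum)
  fix i assume "i \<in> {1..N}"
  thus "has_sym (diag y) k (y i ^ k) (Epow N k i i)" using has_sym_Epow[of i N y k i] by simp
qed

definition wt :: "(nat \<Rightarrow>\<^sub>0 nat) \<Rightarrow> nat" where
  "wt \<mu> = (\<Sum>i\<in>Poly_Mapping.keys \<mu>. Poly_Mapping.lookup \<mu> i * (i + 1))"

definition smon :: "(nat \<Rightarrow> complex) \<Rightarrow> (nat \<Rightarrow>\<^sub>0 nat) \<Rightarrow> complex" where
  "smon s \<mu> = (\<Prod>i\<in>Poly_Mapping.keys \<mu>. s i ^ Poly_Mapping.lookup \<mu> i)"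

lemma has_sym_emon: "has_sym (diag y) (wt \<mu>) (smon (\<lambda>i. \<Sum>l=1..N. y l ^ (i + 1)) \<mu>) (emon N \<mu>)"
proof -
  have "has_sym (diag y) (\<Sum>i\<in>set xs. Poly_Mapping.lookup \<mu> i * (i + 1))
     (\<Prod>i\<in>set xs. (\<Sum>l=1..N. y l ^ (i + 1)) ^ Poly_Mapping.lookup \<mu> i)
     (foldr (\<lambda>i acc. Ctr N (i+1) ^ Poly_Mapping.lookup \<mu> i * acc) xs 1)" if "distinct xs" for xs
    using that
  proof (induction xs)
    case (Cons x xs)
    have "has_sym (diag y) (Poly_Mapping.lookup \<mu> x * (x + 1) + (\<Sum>i\<in>set xs. Poly_Mapping.lookup \<mu> i * (i + 1)))
     ((\<Sum>l=1..N. y l ^ (x + 1)) ^ Poly_Mapping.lookup \<mu> x * (\<Prod>i\<in>set xs. (\<Sum>l=1..N. y l ^ (i + 1)) ^ Poly_Mapping.lookup \<mu> i))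
     (Ctr N (x+1) ^ Poly_Mapping.lookup \<mu> x * foldr (\<lambda>i acc. Ctr N (i+1) ^ Poly_Mapping.lookup \<mu> i * acc) xs 1)"
      using Cons by (intro has_sym_mult has_sym_power has_sym_Ctr) auto
    thus ?case using Cons.prems by simp
  qed (simp add: has_sym_1)
  from this[of "sorted_list_of_set (Poly_Mapping.keys \<mu>)"] show ?thesis
    by (simp add: emon_foldr wt_def smon_def)
qed

lemma smon_superset:
  assumes "finite A" "Poly_Mapping.keys \<mu> \<subseteq> A"
  shows "smon s \<mu> = (\<Prod>i\<in>A. s i ^ Poly_Mapping.lookup \<mu> i)"
  unfolding smon_def using assms by (intro prod.mono_neutral_left) (auto simp: in_keys_iff)

lemma smon_add: "smon s (\<mu> + \<nu>) = smon s \<mu> * smon s \<nu>"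
proof -
  let ?A = "Poly_Mapping.keys \<mu> \<union> Poly_Mapping.keys \<nu>"
  have "smon s (\<mu> + \<nu>) = (\<Prod>i\<in>?A. s i ^ Poly_Mapping.lookup (\<mu> + \<nu>) i)"
    using keys_add[of \<mu> \<nu>] by (intro smon_superset) auto
  also have "\<dots> = (\<Prod>i\<in>?A. s i ^ Poly_Mapping.lookup \<mu> i) * (\<Prod>i\<in>?A. s i ^ Poly_Mapping.lookup \<nu> i)"
    by (simp add: lookup_add power_add prod.distrib)
  also have "\<dots> = smon s \<mu> * smon s \<nu>"
    by (subst (1 2) smon_superset[where A = ?A]) auto
  finally show ?thesis .
qed

text \<open>Used for both readings of the variables: \<open>s i\<close> is the value given to
  \<open>C_(i+1)\<close> or to \<open>S_(i+1)\<close>.\<close>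

definition evc :: "nat \<Rightarrow> (nat \<Rightarrow> complex) \<Rightarrow> mpoly \<Rightarrow> complex" where
  "evc n s P = (\<Sum>\<mu>\<in>Poly_Mapping.keys P. poly (Poly_Mapping.lookup P \<mu>) (of_nat n) * smon s \<mu>)"

lemma evc_add: "evc n s (P + Q) = evc n s P + evc n s Q"
  unfolding evc_def by (rule setsum_keys_plus_distrib) (simp_all add: distrib_right)

lemma evc_0: "evc n s 0 = 0" by (simp add: evc_def)

lemma evc_single: "evc n s (Poly_Mapping.single \<mu> c) = poly c (of_nat n) * smon s \<mu>"
  by (cases "c = 0") (simp_all add: evc_def)

lemma evc_sum: "evc n s (sum f A) = (\<Sum>x\<in>A. evc n s (f x))"
  by (induction A rule: infinite_finite_induct) (simp_all add: evc_0 evc_add)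

lemma evc_mult: "evc n s (P * Q) = evc n s P * evc n s Q"
proof (rule poly_mapping_additive_eqI[of "\<lambda>P. evc n s (P * Q)" "\<lambda>P. evc n s P * evc n s Q"])
  fix u a
  show "evc n s (Poly_Mapping.single u a * Q) = evc n s (Poly_Mapping.single u a) * evc n s Q"
  proof (rule poly_mapping_additive_eqI[of "\<lambda>Q. evc n s (Poly_Mapping.single u a * Q)" "\<lambda>Q. evc n s (Poly_Mapping.single u a) * evc n s Q"])
    fix v b
    show "evc n s (Poly_Mapping.single u a * Poly_Mapping.single v b) = evc n s (Poly_Mapping.single u a) * evc n s (Poly_Mapping.single v b)"
      by (simp add: evc_single mult_single smon_add)
  qed (simp_all add: distrib_left evc_add evc_0)
qed (simp_all add: distrib_right evc_add evc_0)

lemma evc_1: "evc n s 1 = 1"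
  using evc_single[of n s 0 1] by (simp add: smon_def)

lemma evc_uminus: "evc n s (- P) = - evc n s P"
proof -
  have "evc n s (- P) + evc n s P = 0" by (simp add: evc_0 flip: evc_add)
  thus ?thesis by (simp add: eq_neg_iff_add_eq_0)
qed

lemma evc_diff: "evc n s (P - Q) = evc n s P - evc n s Q"
  using evc_add[of n s P "- Q"] by (simp add: evc_uminus)

lemma evc_power: "evc n s (P ^ k) = evc n s P ^ k"
  by (induction k) (simp_all add: evc_1 evc_mult)

lemma evc_prod: "evc n s (prod f A) = (\<Prod>x\<in>A. evc n s (f x))"
  by (induction A rule: infinite_finite_induct) (simp_all add: evc_1 evc_mult)

lemma evc_mconst: "evc n s (mconst c) = poly c (of_nat n)"
  by (simp add: mconst_def evc_single smon_def)

lemma evc_mvar: "evc n s (mvar k) = s k"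
  by (simp add: mvar_def evc_single smon_def)

lemma evc_cong:
  assumes "\<And>\<mu> i. \<mu> \<in> Poly_Mapping.keys P \<Longrightarrow> i \<in> Poly_Mapping.keys \<mu> \<Longrightarrow> s i = s' i"
  shows "evc n s P = evc n s' P"
  unfolding evc_def smon_def using assms by (intro sum.cong refl arg_cong2[where f = "(*)"] prod.cong) auto

lemma base_digits_unique:
  fixes a b :: "nat \<Rightarrow> nat"
  assumes "\<And>i. i < M \<Longrightarrow> a i < B" "\<And>i. i < M \<Longrightarrow> b i < B"
    and "(\<Sum>i<M. a i * B ^ i) = (\<Sum>i<M. b i * B ^ i)" "i < M"
  shows "a i = b i"
  using assms
proof (induction M arbitrary: a b i)
  case (Suc M)
  have split: "(\<Sum>i<Suc M. f i * B ^ i) = f 0 + B * (\<Sum>i<M. f (Suc i) * B ^ i)" for f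
    by (subst sum.lessThan_Suc_shift) (simp add: sum_distrib_left mult_ac)
  have B: "B > 0" using Suc.prems(1)[of 0] by simp
  have eq: "a 0 + B * (\<Sum>i<M. a (Suc i) * B ^ i) = b 0 + B * (\<Sum>i<M. b (Suc i) * B ^ i)"
    using Suc.prems(3) unfolding split .
  have "(a 0 + B * (\<Sum>i<M. a (Suc i) * B ^ i)) mod B = a 0" using Suc.prems(1)[of 0] by simp
  moreover have "(b 0 + B * (\<Sum>i<M. b (Suc i) * B ^ i)) mod B = b 0" using Suc.prems(2)[of 0] by simp
  ultimately have 0: "a 0 = b 0" using eq by simp
  hence "(\<Sum>i<M. a (Suc i) * B ^ i) = (\<Sum>i<M. b (Suc i) * B ^ i)" using eq B by simp
  hence "a (Suc i) = b (Suc i)" if "i < M" for i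
    using Suc.IH[of "\<lambda>i. a (Suc i)" "\<lambda>i. b (Suc i)" i] Suc.prems(1,2) that by simp
  thus ?case using 0 Suc.prems(4) by (cases i) auto
qed simp

text \<open>Kronecker substitution \<open>s_i = t^(B^i)\<close> makes all monomials distinct powers of \<open>t\<close>.\<close>

lemma evc_separates:
  assumes "\<And>n s. n \<ge> n0 \<Longrightarrow> evc n s P = 0"
  shows "P = 0"
proof -
  let ?K = "Poly_Mapping.keys P"
  define M where "M = Suc (Max (insert 0 (\<Union>\<mu>\<in>?K. Poly_Mapping.keys \<mu>)))"
  define B where "B = Suc (Max (insert 0 (\<Union>\<mu>\<in>?K. Poly_Mapping.lookup \<mu> ` Poly_Mapping.keys \<mu>)))"
  have M: "Poly_Mapping.keys \<mu> \<subseteq> {..<M}" if "\<mu> \<in> ?K" for \<mu>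
    unfolding M_def using that by (auto intro!: le_imp_less_Suc Max_ge)
  have B: "Poly_Mapping.lookup \<mu> i < B" if "\<mu> \<in> ?K" for \<mu> i
  proof (cases "i \<in> Poly_Mapping.keys \<mu>")
    case True
    thus ?thesis unfolding B_def using that by (auto intro!: le_imp_less_Suc Max_ge)
  next
    case False
    thus ?thesis by (simp add: in_keys_iff B_def)
  qed
  define code where "code \<mu> = (\<Sum>i<M. Poly_Mapping.lookup \<mu> i * B ^ i)" for \<mu> :: "nat \<Rightarrow>\<^sub>0 nat"
  have inj: "\<mu> = \<nu>" if "\<mu> \<in> ?K" "\<nu> \<in> ?K" "code \<mu> = code \<nu>" for \<mu> \<nu>
  proof (rule poly_mapping_eqI)
    fix i
    show "Poly_Mapping.lookup \<mu> i = Poly_Mapping.lookup \<nu> i"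
    proof (cases "i < M")
      case True
      show ?thesis
        by (rule base_digits_unique[where M = M and B = B and a = "Poly_Mapping.lookup \<mu>" and b = "Poly_Mapping.lookup \<nu>"])
           (use that B True in \<open>simp_all add: code_def\<close>)
    next
      case False
      hence "i \<notin> Poly_Mapping.keys \<mu>" "i \<notin> Poly_Mapping.keys \<nu>" using M that by auto
      thus ?thesis by (simp add: in_keys_iff)
    qed
  qed
  have "poly (Poly_Mapping.lookup P \<nu>) (of_nat n) = 0" if n: "n \<ge> n0" and \<nu>: "\<nu> \<in> ?K" for n \<nu>
  proof -
    let ?c = "\<lambda>\<mu>. poly (Poly_Mapping.lookup P \<mu>) (of_nat n)"
    define q where "q = (\<Sum>\<mu>\<in>?K. monom (?c \<mu>) (code \<mu>))"
    have "poly q t = 0" for t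
    proof -
      have sm: "smon (\<lambda>i. t ^ (B ^ i)) \<mu> = t ^ code \<mu>" if "\<mu> \<in> ?K" for \<mu>
      proof -
        have "smon (\<lambda>i. t ^ (B ^ i)) \<mu> = (\<Prod>i<M. (t ^ (B ^ i)) ^ Poly_Mapping.lookup \<mu> i)"
          using M[OF that] by (intro smon_superset) auto
        also have "\<dots> = t ^ code \<mu>"
          unfolding code_def power_sum by (intro prod.cong refl) (simp add: power_mult[symmetric] mult.commute)
        finally show ?thesis .
      qed
      have "evc n (\<lambda>i. t ^ (B ^ i)) P = poly q t"
        unfolding evc_def q_def by (simp add: poly_sum poly_monom sm)
      thus ?thesis using assms[OF n] by simp
    qed
    hence "q = 0" using poly_all_0_iff_0 by blast
    hence "0 = coeff q (code \<nu>)" by simp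
    also have "\<dots> = (\<Sum>\<mu>\<in>?K. if \<mu> = \<nu> then ?c \<mu> else 0)"
      unfolding q_def coeff_sum using inj[OF _ \<nu>] by (intro sum.cong refl) auto
    also have "\<dots> = ?c \<nu>" using \<nu> by (simp add: sum.delta)
    finally show ?thesis by simp
  qed
  hence root: "poly (Poly_Mapping.lookup P \<nu>) (of_nat (n0 + n)) = 0" if "\<nu> \<in> ?K" for \<nu> n
    using that by (simp del: of_nat_add)
  have "?K = {}"
  proof (rule ccontr)
    assume "?K \<noteq> {}"
    then obtain \<nu> where \<nu>: "\<nu> \<in> ?K" by blast
    \<comment> \<open>A coefficient in \<open>C[N]\<close> with infinitely many roots vanishes, so
      large integers suffice.\<close>
    have "range (\<lambda>n. of_nat (n0 + n) :: complex) \<subseteq> {x. poly (Poly_Mapping.lookup P \<nu>) x = 0}"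
      using root[OF \<nu>] by auto
    moreover have "infinite (range (\<lambda>n. of_nat (n0 + n) :: complex))"
      by (intro range_inj_infinite injI) simp
    ultimately have "infinite {x. poly (Poly_Mapping.lookup P \<nu>) x = 0}" using infinite_super by blast
    hence "Poly_Mapping.lookup P \<nu> = 0" using poly_roots_finite by blast
    thus False using \<nu> by (simp add: in_keys_iff)
  qed
  thus ?thesis by simp
qed

lemma sum_roots_of_unity_powers:
  assumes "n > 0"
  shows "(\<Sum>j<n. (cis (2 * pi * real j / real n)) ^ k) = (if n dvd k then of_nat n else 0)"
proof -
  have c1: "cis (2 * pi * real q) = 1" for q by (rule cis_multiple_2pi) simp
  define z where "z = cis (2 * pi * real k / real n)"
  have pw: "(cis (2 * pi * real j / real n)) ^ k = z ^ j" for j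
    by (simp add: z_def DeMoivre mult_ac)
  have zn: "z ^ n = 1"
  proof -
    have "z ^ n = cis (2 * pi * real k)" using assms by (simp add: z_def DeMoivre)
    also have "\<dots> = 1" by (rule c1)
    finally show ?thesis .
  qed
  have z1: "z = 1 \<longleftrightarrow> n dvd k"
  proof
    assume "n dvd k"
    then obtain q where "k = n * q" by blast
    hence "2 * pi * real k / real n = 2 * pi * real q" using assms by simp
    hence "z = cis (2 * pi * real q)" unfolding z_def by (rule arg_cong)
    thus "z = 1" by (simp only: c1)
  next
    assume z: "z = 1"
    have "2 * pi * real k / real n = 2 * pi * real (k div n) + 2 * pi * real (k mod n) / real n"
    proof -
      have "real k = real n * real (k div n) + real (k mod n)"
        by (metis mult_div_mod_eq of_nat_add of_nat_mult)
      thus ?thesis using assms by (simp add: field_simps)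
    qed
    hence "z = cis (2 * pi * real (k div n)) * cis (2 * pi * real (k mod n) / real n)"
      by (simp only: z_def cis_mult)
    hence "cis (2 * pi * real (k mod n) / real n) = cis (2 * pi * real 0 / real n)"
      using z unfolding c1 by simp
    hence "k mod n = 0"
      using bij_betw_roots_unity[OF assms] assms by (auto simp: bij_betw_def inj_on_def)
    thus "n dvd k" by auto
  qed
  show ?thesis
  proof (cases "n dvd k")
    case True
    thus ?thesis using z1 by (simp add: pw)
  next
    case False
    hence "(\<Sum>j<n. z ^ j) = (z ^ n - 1) / (z - 1)" using z1 by (intro geometric_sum) auto
    thus ?thesis using False zn by (simp add: pw)
  qed
qed

text \<open>
  The \<open>k\<close>-th roots of a number contribute to no power sum of order below \<open>k\<close>, so the power sums can be
  adjusted one after the other.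
\<close>

lemma power_sums_arbitrary:
  fixes s :: "nat \<Rightarrow> complex"
  shows "\<exists>ys. length ys = (\<Sum>k\<le>M. k) \<and> (\<forall>k\<in>{1..M}. sum_list (map (\<lambda>z. z ^ k) ys) = s k)"
proof (induction M)
  case (Suc M)
  then obtain ys where ys: "length ys = (\<Sum>k\<le>M. k)"
    "\<And>k. k \<in> {1..M} \<Longrightarrow> sum_list (map (\<lambda>z. z ^ k) ys) = s k" by blast
  \<comment> \<open>The \<open>Suc M\<close> roots of \<open>t\<close> contribute
    \<open>Suc M * t\<close> to the power sum of order \<open>Suc M\<close>, which has to make up
    the missing amount.\<close>
  define t where "t = (s (Suc M) - sum_list (map (\<lambda>z. z ^ Suc M) ys)) / of_nat (Suc M)"
  obtain b where b: "b ^ Suc M = t"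
  proof (cases "t = 0")
    case False
    have "card {z. z ^ Suc M = t} = Suc M" using False by (intro card_nth_roots) auto
    hence "{z. z ^ Suc M = t} \<noteq> {}" by (metis card.empty nat.distinct(1))
    thus ?thesis using that by blast
  qed (use that[of 0] in simp)
  define zs where "zs = map (\<lambda>j. b * cis (2 * pi * real j / real (Suc M))) [0..<Suc M]"
  have zs: "sum_list (map (\<lambda>z. z ^ k) zs) = (if Suc M dvd k then of_nat (Suc M) * b ^ k else 0)" for k
  proof -
    have "sum_list (map (\<lambda>z. z ^ k) zs) = (\<Sum>j<Suc M. (b * cis (2 * pi * real j / real (Suc M))) ^ k)"
      unfolding zs_def map_map by (simp only: interv_sum_list_conv_sum_set_nat o_def set_upt atLeast0LessThan)
    also have "\<dots> = b ^ k * (\<Sum>j<Suc M. (cis (2 * pi * real j / real (Suc M))) ^ k)"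
      by (simp only: power_mult_distrib sum_distrib_left)
    finally show ?thesis
      unfolding sum_roots_of_unity_powers[OF zero_less_Suc] by (simp del: of_nat_Suc)
  qed
  show ?case
  proof (intro exI conjI ballI)
    show "length (ys @ zs) = (\<Sum>k\<le>Suc M. k)" using ys(1) by (simp add: zs_def)
    fix k assume k: "k \<in> {1..Suc M}"
    show "sum_list (map (\<lambda>z. z ^ k) (ys @ zs)) = s k"
    proof (cases "k = Suc M")
      case True
      have "of_nat (Suc M) * t = s (Suc M) - sum_list (map (\<lambda>z. z ^ Suc M) ys)"
        unfolding t_def using of_nat_neq_0[of M, where 'a = complex] by (simp del: of_nat_Suc)
      thus ?thesis using True zs[of "Suc M"] b by (simp del: power_Suc of_nat_Suc)
    next
      case False
      hence "\<not> Suc M dvd k" using k by (auto dest: dvd_imp_le)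
      thus ?thesis using zs[of k] ys(2)[of k] False k by auto
    qed
  qed
qed simp

text \<open>The part \<open>T\<close> of top weight determines the symbol of \<open>ev N P\<close>,
  which is \<open>T\<close> evaluated at power sums of \<open>N\<close> numbers. For large
  \<open>N\<close> the power sums occurring in \<open>T\<close> take arbitrary values, so
  \<open>T\<close> would vanish.\<close>

lemma ev_injective:
  assumes "\<And>N. N \<ge> 1 \<Longrightarrow> ev N P = 0"
  shows "P = 0"
proof (rule ccontr)
  assume P: "P \<noteq> 0"
  let ?K = "Poly_Mapping.keys P"
  have K: "finite ?K" "?K \<noteq> {}" using P by auto
  define d where "d = Max (wt ` ?K)"
  have le: "wt \<mu> \<le> d" if "\<mu> \<in> ?K" for \<mu> unfolding d_def using that by simp
  have "d \<in> wt ` ?K" unfolding d_def using K by (intro Max_in) auto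
  then obtain \<nu> where \<nu>: "\<nu> \<in> ?K" "wt \<nu> = d" by auto
  define T :: mpoly where "T = (\<Sum>\<mu>\<in>{\<mu>\<in>?K. wt \<mu> = d}. Poly_Mapping.single \<mu> (Poly_Mapping.lookup P \<mu>))"
  have Tl: "Poly_Mapping.lookup T \<nu> = Poly_Mapping.lookup P \<nu>"
  proof -
    have "Poly_Mapping.lookup T \<nu> = (\<Sum>\<mu>\<in>{\<mu>\<in>?K. wt \<mu> = d}. if \<mu> = \<nu> then Poly_Mapping.lookup P \<nu> else 0)"
      unfolding T_def by (auto simp: lookup_sum lookup_single when_def intro!: sum.cong)
    thus ?thesis using \<nu> by (simp add: sum.delta)
  qed
  have top: "evc N (\<lambda>i. \<Sum>l=1..N. y l ^ (i + 1)) T = 0" if N: "N \<ge> 1" for N y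
  proof -
    let ?p = "\<lambda>i. \<Sum>l=1..N. y l ^ (i + 1)"
    let ?c = "\<lambda>\<mu>. poly (Poly_Mapping.lookup P \<mu>) (of_nat N)"
    have "has_sym (diag y) d (\<Sum>\<mu>\<in>?K. if wt \<mu> = d then ?c \<mu> * smon ?p \<mu> else 0) (ev N P)"
      unfolding ev_expand
    proof (rule has_sym_sum)
      fix \<mu> assume \<mu>: "\<mu> \<in> ?K"
      have "has_sym (diag y) (0 + wt \<mu>) (?c \<mu> * smon ?p \<mu>) (scal (?c \<mu>) * emon N \<mu>)"
        by (intro has_sym_mult has_sym_scal has_sym_emon)
      thus "has_sym (diag y) d (if wt \<mu> = d then ?c \<mu> * smon ?p \<mu> else 0) (scal (?c \<mu>) * emon N \<mu>)"
        using has_sym_less[of "diag y" "wt \<mu>" _ _ d] le[OF \<mu>] by (cases "wt \<mu> = d") auto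
    qed
    hence "(\<Sum>\<mu>\<in>?K. if wt \<mu> = d then ?c \<mu> * smon ?p \<mu> else 0) = 0"
      using assms[OF N] has_sym_zeroD by simp
    thus ?thesis unfolding T_def evc_sum evc_single by (simp only: sum.inter_filter[OF K(1)])
  qed
  define M where "M = Suc (Max (insert 0 (\<Union>\<mu>\<in>Poly_Mapping.keys T. Poly_Mapping.keys \<mu>)))"
  have M: "i < M" if "\<mu> \<in> Poly_Mapping.keys T" "i \<in> Poly_Mapping.keys \<mu>" for \<mu> i
    unfolding M_def using that by (auto intro!: le_imp_less_Suc Max_ge)
  have "T = 0"
  proof (rule evc_separates)
    \<comment> \<open>Prescribing the first \<open>M\<close> power sums takes
      \<open>1 + 2 + \<dots> + M\<close> numbers, so \<open>n\<close> must be at least that large;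
      the \<open>Suc\<close> ensures \<open>n \<ge> 1\<close>.\<close>
    fix n :: nat and s :: "nat \<Rightarrow> complex" assume n: "n \<ge> Suc (\<Sum>k\<le>M. k)"
    obtain ys where ys: "length ys = (\<Sum>k\<le>M. k)" "\<And>k. k \<in> {1..M} \<Longrightarrow> sum_list (map (\<lambda>z. z ^ k) ys) = s (k - 1)"
      using power_sums_arbitrary[of M "\<lambda>k. s (k - 1)"] by blast
    \<comment> \<open>Padding by zeros leaves all power sums of positive order unchanged.\<close>
    define y where "y l = (if l \<le> length ys then ys ! (l - 1) else 0)" for l
    have "(\<Sum>l=1..n. y l ^ (i + 1)) = s i" if "i < M" for i
    proof -
      have "(\<Sum>l=1..n. y l ^ (i + 1)) = (\<Sum>l=1..length ys. y l ^ (i + 1))"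
        using n ys(1) by (intro sum.mono_neutral_right) (auto simp: y_def)
      also have "\<dots> = (\<Sum>l<length ys. (ys ! l) ^ (i + 1))"
        by (rule sum.reindex_bij_witness[of _ Suc "\<lambda>l. l - 1"]) (auto simp: y_def)
      also have "\<dots> = sum_list (map (\<lambda>z. z ^ (i + 1)) ys)"
        by (simp add: sum_list_sum_nth atLeast0LessThan)
      also have "\<dots> = s i" using ys(2)[of "i + 1"] that by simp
      finally show ?thesis .
    qed
    hence "evc n s T = evc n (\<lambda>i. \<Sum>l=1..n. y l ^ (i + 1)) T"
      using M by (intro evc_cong) auto
    thus "evc n s T = 0" using top[of n y] n by simp
  qed
  hence "Poly_Mapping.lookup P \<nu> = 0" using Tl by simp
  thus False using \<nu>(1) by (simp add: in_keys_iff)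
qed

subsection \<open>Wick calculus\<close>

text \<open>\<open>wick I J\<close> is the expectation \<open>\<langle>x^I y^J\<rangle>\<close>.\<close>

definition wick :: "nat multiset \<Rightarrow> nat multiset \<Rightarrow> nat" where
  "wick I J = (if I = J then \<Prod>c\<in>set_mset I. fact (count I c) else 0)"

text \<open>Integration by parts: under the expectation, a factor \<open>y_i\<close> acts as the
  derivative by \<open>x_i\<close> on \<open>x^I\<close>.\<close>

lemma wick_add: "wick I (add_mset i J) = count I i * wick (I - {#i#}) J"
proof (cases "i \<in># I")
  case False
  hence "I \<noteq> add_mset i J" by auto
  thus ?thesis using False by (simp add: wick_def not_in_iff)
next
  case True
  then obtain I' where I: "I = add_mset i I'" by (meson multi_member_split)
  have "(\<Prod>c\<in>set_mset I. fact (count I c)) = count I i * (\<Prod>c\<in>set_mset I'. fact (count I' c) :: nat)"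
  proof -
    have "(\<Prod>c\<in>set_mset I'. fact (count I' c) :: nat) = (\<Prod>c\<in>set_mset I. fact (count I' c))"
      unfolding I by (intro prod.mono_neutral_left) (auto simp: not_in_iff)
    also have "\<dots> = fact (count I' i) * (\<Prod>c\<in>set_mset I - {i}. fact (count I' c))"
      using I by (subst prod.remove[of _ i]) auto
    also have "(\<Prod>c\<in>set_mset I - {i}. fact (count I' c)) = (\<Prod>c\<in>set_mset I - {i}. fact (count I c) :: nat)"
      unfolding I by (intro prod.cong) auto
    finally have "count I i * (\<Prod>c\<in>set_mset I'. fact (count I' c) :: nat) = fact (count I i) * (\<Prod>c\<in>set_mset I - {i}. fact (count I c))"
      by (simp add: I algebra_simps)
    also have "\<dots> = (\<Prod>c\<in>set_mset I. fact (count I c))"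
      using I by (subst prod.remove[of "set_mset I" i]) auto
    finally show ?thesis by simp
  qed
  moreover have "I = add_mset i J \<longleftrightarrow> I' = J" "I - {#i#} = I'" using I by auto
  ultimately show ?thesis by (simp only: wick_def) auto
qed

text \<open>
  A polynomial \<open>h\<close> in \<open>x\<close>, \<open>y\<close> over the algebra is represented by the function
  \<open>K I J = \<langle>x^I y^J h\<rangle>\<close>. In these terms \<open>Xop\<close>, \<open>Rop\<close> and \<open>Qop i\<close> are multiplication by \<open>X\<close>, \<open>r\<close> and \<open>Q_i\<close>,
  and, by integration by parts, \<open>Dop i\<close> is the derivative by \<open>x_i\<close>.
\<close>

type_synonym wfun = "nat multiset \<Rightarrow> nat multiset \<Rightarrow> endo"

definition Xop :: "nat \<Rightarrow> wfun \<Rightarrow> wfun" where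
  "Xop N K I J = (\<Sum>a=1..N. \<Sum>b=1..N. Eop a b * K (add_mset a I) (add_mset b J))"

definition Rop :: "nat \<Rightarrow> wfun \<Rightarrow> wfun" where
  "Rop N K I J = (\<Sum>a=1..N. K (add_mset a I) (add_mset a J))"

definition Qop :: "nat \<Rightarrow> nat \<Rightarrow> wfun \<Rightarrow> wfun" where
  "Qop N i K I J = (\<Sum>b=1..N. Eop i b * K I (add_mset b J))"

definition Dop :: "nat \<Rightarrow> wfun \<Rightarrow> wfun" where
  "Dop i K I J = K I (add_mset i J) - of_nat (count I i) * K (I - {#i#}) J"

fun wick_rising :: "nat \<Rightarrow> nat \<Rightarrow> wfun" where
  "wick_rising N 0 I J = of_nat (wick I J)"
| "wick_rising N (Suc m) I J = Xop N (wick_rising N m) I J + of_nat m * Rop N (wick_rising N m) I J"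

fun wick_power :: "nat \<Rightarrow> nat \<Rightarrow> wfun" where
  "wick_power N 0 I J = of_nat (wick I J)"
| "wick_power N (Suc m) I J = Xop N (wick_power N m) I J"

lemma endo_of_nat_commute: "u * of_nat n = of_nat n * (u :: endo)"
  by (metis scal_commute scal_of_nat)

lemma endo_of_nat_left_commute: "u * (of_nat n * v) = of_nat n * (u * (v :: endo))"
  by (metis endo_of_nat_commute mult.assoc)

lemma Eop_of_nat: "Eop a b * (of_nat n * v) = of_nat n * (Eop a b * v)"
  by (rule endo_of_nat_left_commute)

lemma scal_left_commute: "scal c * (Eop a b * v) = Eop a b * (scal c * v)"
  by (simp only: mult.assoc[symmetric] scal_commute)

lemma Xop_lin:
  "Xop N (\<lambda>I J. of_nat c * (A I J + of_nat e * B I J)) I J = of_nat c * (Xop N A I J + of_nat e * Xop N B I J)"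
  unfolding Xop_def by (simp add: sum.distrib sum_distrib_left distrib_left Eop_of_nat)

lemma Rop_lin:
  "Rop N (\<lambda>I J. of_nat c * (A I J + of_nat e * B I J)) I J = of_nat c * (Rop N A I J + of_nat e * Rop N B I J)"
  unfolding Rop_def by (simp add: sum.distrib sum_distrib_left distrib_left)

lemma Qop_add: "Qop N i (\<lambda>I J. A I J + of_nat e * B I J) I J = Qop N i A I J + of_nat e * Qop N i B I J"
  unfolding Qop_def by (simp add: sum.distrib sum_distrib_left distrib_left Eop_of_nat)

lemma Dop_add: "Dop i (\<lambda>I J. A I J + of_nat e * B I J) I J = Dop i A I J + of_nat e * Dop i B I J"
  unfolding Dop_def distrib_left endo_of_nat_left_commute[of "of_nat (count I i)"]
  by (simp add: algebra_simps)

lemma Dop_shift: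
  "Dop i K (add_mset a I) J = K (add_mset a I) (add_mset i J)
      - of_nat (count I i) * K (add_mset a (I - {#i#})) J - (if a = i then K I J else 0)"
proof (cases "i \<in># I")
  case True
  then obtain I' where I: "I = add_mset i I'" by (meson multi_member_split)
  have "add_mset a I - {#i#} = add_mset a I'" by (simp add: I add_mset_commute[of a i])
  thus ?thesis unfolding Dop_def by (simp add: I distrib_right)
next
  case False
  thus ?thesis by (auto simp: Dop_def not_in_iff)
qed

text \<open>Leibniz rule with \<open>\<partial>X/\<partial>x_i = Q_i\<close>.\<close>

lemma Dop_Xop:
  assumes "i \<in> {1..N}"
  shows "Dop i (Xop N K) I J = Xop N (Dop i K) I J + Qop N i K I J"
proof -
  have "Xop N (Dop i K) I J = (\<Sum>a=1..N. \<Sum>b=1..N. Eop a b * K (add_mset a I) (add_mset i (add_mset b J)))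
     - (\<Sum>a=1..N. \<Sum>b=1..N. Eop a b * (of_nat (count I i) * K (add_mset a (I - {#i#})) (add_mset b J)))
     - (\<Sum>a=1..N. if a = i then \<Sum>b=1..N. Eop a b * K I (add_mset b J) else 0)"
    unfolding Xop_def Dop_shift sum_subtractf[symmetric] right_diff_distrib
    by (intro sum.cong refl) (simp add: if_distrib sum_subtractf cong: if_cong)
  also have "(\<Sum>a=1..N. if a = i then \<Sum>b=1..N. Eop a b * K I (add_mset b J) else 0) = Qop N i K I J"
    unfolding Qop_def using assms by (subst sum.delta) auto
  finally show ?thesis
    unfolding Dop_def[of i "Xop N K"] Xop_def[of N K]
    by (simp add: sum_distrib_left Eop_of_nat add_mset_commute[of i])
qed

lemma Dop_Rop:
  assumes "i \<in> {1..N}"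
  shows "Dop i (Rop N K) I J = Rop N (Dop i K) I J + K I (add_mset i J)"
proof -
  have "Rop N (Dop i K) I J = (\<Sum>a=1..N. K (add_mset a I) (add_mset i (add_mset a J)))
     - (\<Sum>a=1..N. of_nat (count I i) * K (add_mset a (I - {#i#})) (add_mset a J))
     - (\<Sum>a=1..N. if a = i then K I (add_mset a J) else 0)"
    unfolding Rop_def Dop_shift sum_subtractf ..
  also have "(\<Sum>a=1..N. if a = i then K I (add_mset a J) else 0) = K I (add_mset i J)"
    using assms by (subst sum.delta) auto
  finally show ?thesis
    unfolding Dop_def[of i "Rop N K"] Rop_def[of N K]
    by (simp add: sum_distrib_left add_mset_commute[of i])
qed

text \<open>This is \<open>X Q_i - Q_i X = y_i X - r Q_i\<close>, the commutation relations of the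
  \<open>E_ij\<close> multiplied by the variables and summed.\<close>

lemma Xop_Qop:
  assumes "i \<in> {1..N}"
  shows "Xop N (Qop N i K) I J + Qop N i (Rop N K) I J = Qop N i (Xop N K) I J + Xop N K I (add_mset i J)"
proof -
  let ?S = "\<lambda>f. \<Sum>a=1..N. \<Sum>b=1..N. \<Sum>c=1..N. f a b c :: endo"
  let ?K = "\<lambda>a b c. K (add_mset a I) (add_mset b (add_mset c J))"
  have 1: "Xop N (Qop N i K) I J = ?S (\<lambda>a b c. Eop a b * Eop i c * ?K a b c)"
    unfolding Xop_def Qop_def by (simp add: sum_distrib_left mult.assoc add_mset_commute)
  have 2: "Qop N i (Xop N K) I J = ?S (\<lambda>a b c. Eop i c * Eop a b * ?K a b c)"
  proof -
    have "Qop N i (Xop N K) I J = (\<Sum>c=1..N. \<Sum>a=1..N. \<Sum>b=1..N. Eop i c * Eop a b * ?K a b c)"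
      unfolding Xop_def Qop_def by (simp add: sum_distrib_left mult.assoc)
    also have "\<dots> = (\<Sum>a=1..N. \<Sum>c=1..N. \<Sum>b=1..N. Eop i c * Eop a b * ?K a b c)"
      by (rule sum.swap)
    also have "\<dots> = ?S (\<lambda>a b c. Eop i c * Eop a b * ?K a b c)"
      by (intro sum.cong refl sum.swap)
    finally show ?thesis .
  qed
  have "?S (\<lambda>a b c. Eop a b * Eop i c * ?K a b c) - ?S (\<lambda>a b c. Eop i c * Eop a b * ?K a b c) =
     ?S (\<lambda>a b c. (Eop a b * Eop i c - Eop i c * Eop a b) * ?K a b c)"
    by (simp add: sum_subtractf left_diff_distrib)
  also have "\<dots> = ?S (\<lambda>a b c. (if b = i then Eop a c * ?K a b c else 0)) - ?S (\<lambda>a b c. if c = a then Eop i b * ?K a b c else 0)"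
    unfolding Eop_commutator by (simp add: left_diff_distrib sum_subtractf if_distrib[of "\<lambda>x. x * _"] cong: if_cong)
  also have "?S (\<lambda>a b c. (if b = i then Eop a c * ?K a b c else 0)) = Xop N K I (add_mset i J)"
  proof -
    have "?S (\<lambda>a b c. (if b = i then Eop a c * ?K a b c else 0)) =
        (\<Sum>a=1..N. \<Sum>b=1..N. if b = i then \<Sum>c=1..N. Eop a c * ?K a b c else 0)"
      by (intro sum.cong refl) auto
    also have "\<dots> = (\<Sum>a=1..N. \<Sum>c=1..N. Eop a c * ?K a i c)"
    proof (rule sum.cong[OF refl])
      fix a
      show "(\<Sum>b=1..N. if b = i then \<Sum>c=1..N. Eop a c * ?K a b c else 0) = (\<Sum>c=1..N. Eop a c * ?K a i c)"
        using assms by (subst sum.delta) auto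
    qed
    finally show ?thesis unfolding Xop_def by (simp add: add_mset_commute)
  qed
  also have "?S (\<lambda>a b c. if c = a then Eop i b * ?K a b c else 0) = Qop N i (Rop N K) I J"
  proof -
    have "?S (\<lambda>a b c. if c = a then Eop i b * ?K a b c else 0) = (\<Sum>a=1..N. \<Sum>b=1..N. Eop i b * ?K a b a)"
      by (intro sum.cong refl) (subst sum.delta, auto)
    also have "\<dots> = (\<Sum>b=1..N. \<Sum>a=1..N. Eop i b * ?K a b a)" by (rule sum.swap)
    finally show ?thesis unfolding Rop_def Qop_def by (simp add: sum_distrib_left add_mset_commute)
  qed
  finally show ?thesis unfolding 1 2 by (simp add: algebra_simps)
qed

lemma Rop_Qop: "Rop N (Qop N i K) I J = Qop N i (Rop N K) I J"
  unfolding Rop_def Qop_def sum_distrib_left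
  by (subst sum.swap) (simp add: add_mset_commute)

lemma Xop_shift: "Xop N (\<lambda>I J. K I (add_mset i J)) I J = Xop N K I (add_mset i J)"
  unfolding Xop_def by (simp add: add_mset_commute)

lemma Rop_shift: "Rop N (\<lambda>I J. K I (add_mset i J)) I J = Rop N K I (add_mset i J)"
  unfolding Rop_def by (simp add: add_mset_commute)

lemma Dop_wick_rising_0: "Dop i (wick_rising N 0) I J = 0"
  by (simp add: Dop_def wick_add)

text \<open>In the Leibniz rule \<open>X Q_i\<close> must be brought to the form
  \<open>Q_i X\<close>. The term \<open>- r Q_i\<close> of the commutator is absorbed by the
  \<open>r\<close> in the last factor of the rising product, and \<open>y_i X\<close> by the summand
  with \<open>y_i\<close>.\<close>

lemma Dop_wick_rising_Suc:
  assumes i: "i \<in> {1..N}"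
  shows "Dop i (wick_rising N (Suc m)) I J = of_nat (Suc m) * (Qop N i (wick_rising N m) I J + of_nat m * wick_rising N m I (add_mset i J))"
proof (induction m arbitrary: I J)
  case 0
  have "wick_rising N (Suc 0) = Xop N (wick_rising N 0)" by (intro ext) simp
  hence "Dop i (wick_rising N (Suc 0)) I J = Xop N (Dop i (wick_rising N 0)) I J + Qop N i (wick_rising N 0) I J"
    by (simp only: Dop_Xop[OF i])
  also have "Xop N (Dop i (wick_rising N 0)) I J = 0" by (simp add: Xop_def Dop_wick_rising_0 del: wick_rising.simps)
  finally show ?case by (simp del: wick_rising.simps)
next
  case (Suc m)
  let ?K = "wick_rising N m" and ?K1 = "wick_rising N (Suc m)"
  have K1: "?K1 = (\<lambda>I J. Xop N ?K I J + of_nat m * Rop N ?K I J)" by (intro ext) simp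
  have D: "Dop i ?K1 = (\<lambda>I J. of_nat (Suc m) * (Qop N i ?K I J + of_nat m * ?K I (add_mset i J)))"
    using Suc.IH by (intro ext)
  have "Dop i (wick_rising N (Suc (Suc m))) I J = Dop i (Xop N ?K1) I J + of_nat (Suc m) * Dop i (Rop N ?K1) I J"
    by (simp only: Dop_add[symmetric] wick_rising.simps(2)[abs_def, of N "Suc m"])
  also have "\<dots> = (Xop N (Dop i ?K1) I J + of_nat (Suc m) * Rop N (Dop i ?K1) I J)
      + (Qop N i ?K1 I J + of_nat (Suc m) * ?K1 I (add_mset i J))"
    by (simp only: Dop_Xop[OF i] Dop_Rop[OF i] distrib_left add_ac)
  also have "Xop N (Dop i ?K1) I J + of_nat (Suc m) * Rop N (Dop i ?K1) I J =
     of_nat (Suc m) * ((Xop N (Qop N i ?K) I J + of_nat m * Xop N ?K I (add_mset i J))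
       + of_nat (Suc m) * (Qop N i (Rop N ?K) I J + of_nat m * Rop N ?K I (add_mset i J)))"
    unfolding D Xop_lin Rop_lin Xop_shift Rop_shift Rop_Qop by (simp only: distrib_left add_ac)
  also have "(Xop N (Qop N i ?K) I J + of_nat m * Xop N ?K I (add_mset i J))
       + of_nat (Suc m) * (Qop N i (Rop N ?K) I J + of_nat m * Rop N ?K I (add_mset i J))
     = (Xop N (Qop N i ?K) I J + Qop N i (Rop N ?K) I J) + of_nat m * Xop N ?K I (add_mset i J)
       + of_nat m * Qop N i (Rop N ?K) I J + of_nat (Suc m) * of_nat m * Rop N ?K I (add_mset i J)"
    by (simp add: algebra_simps)
  also have "\<dots> = Qop N i ?K1 I J + of_nat (Suc m) * ?K1 I (add_mset i J)"
    unfolding Xop_Qop[OF i] unfolding K1 Qop_add by (simp add: algebra_simps)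
  finally show ?case by (simp add: algebra_simps del: wick_rising.simps)
qed

text \<open>Integration by parts turns \<open>r = \<Sum> x_i y_i\<close> into
  \<open>\<Sum> \<partial>_i x_i\<close>, that is, \<open>N\<close> plus the degree in
  \<open>x\<close>: \<open>size I\<close> comes from \<open>x^I\<close> and \<open>m\<close> from
  the rising product.\<close>

lemma Rop_wick_rising:
  assumes "set_mset I \<subseteq> {1..N}"
  shows "Rop N (wick_rising N m) I J = of_nat (N + size I + m) * wick_rising N m I J"
proof -
  have sz: "(\<Sum>i=1..N. count I i) = size I"
    unfolding size_multiset_overloaded_eq using assms
    by (intro sum.mono_neutral_right) (auto simp: not_in_iff)
  have K: "wick_rising N m (add_mset i I) (add_mset i J) = Dop i (wick_rising N m) (add_mset i I) J + of_nat (count I i + 1) * wick_rising N m I J" for i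
    by (simp add: Dop_def del: wick_rising.simps)
  have "Rop N (wick_rising N m) I J = (\<Sum>i=1..N. Dop i (wick_rising N m) (add_mset i I) J) + (\<Sum>i=1..N. of_nat (count I i + 1) * wick_rising N m I J)"
    unfolding Rop_def K sum.distrib ..
  also have "(\<Sum>i=1..N. of_nat (count I i + 1) * wick_rising N m I J) = of_nat (\<Sum>i=1..N. count I i + 1) * wick_rising N m I J"
    by (simp only: sum_distrib_right of_nat_sum)
  also have "(\<Sum>i=1..N. count I i + 1) = size I + N" by (simp only: sum.distrib sz) simp
  also have "(\<Sum>i=1..N. Dop i (wick_rising N m) (add_mset i I) J) = of_nat m * wick_rising N m I J"
  proof (cases m)
    case 0
    thus ?thesis by (simp add: Dop_wick_rising_0 del: wick_rising.simps)
  next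
    case (Suc m')
    have "(\<Sum>i=1..N. Dop i (wick_rising N m) (add_mset i I) J) =
       (\<Sum>i=1..N. of_nat m * (Qop N i (wick_rising N m') (add_mset i I) J + of_nat m' * wick_rising N m' (add_mset i I) (add_mset i J)))"
      unfolding Suc by (intro sum.cong refl Dop_wick_rising_Suc)
    also have "\<dots> = of_nat m * wick_rising N m I J"
      unfolding Suc wick_rising.simps(2) Xop_def Rop_def Qop_def by (simp only: sum_distrib_left sum.distrib distrib_left)
    finally show ?thesis .
  qed
  finally show ?thesis by (simp add: algebra_simps)
qed

definition Zelem :: "nat \<Rightarrow> nat \<Rightarrow> endo" where
  "Zelem N m = scal (1 / fact m) * wick_rising N m {#} {#}"

text \<open>The matrix \<open>\<langle>x_k y_i X^(m)\<rangle> / m!\<close>; its trace is the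
  normalized expectation of \<open>r X^(m)\<close>.\<close>

definition Melem :: "nat \<Rightarrow> nat \<Rightarrow> nat \<Rightarrow> nat \<Rightarrow> endo" where
  "Melem N m i k = scal (1 / fact m) * wick_rising N m {#k#} {#i#}"

lemma wick_rising_Zelem: "wick_rising N m {#} {#} = scal (fact m) * Zelem N m"
  by (simp add: Zelem_def scal_1 mult.assoc[symmetric] scal_mult[symmetric])

lemma Zelem_0: "Zelem N 0 = 1"
  by (simp add: Zelem_def wick_def scal_1)

lemma Melem_0: "Melem N 0 i k = (if i = k then 1 else 0)"
  by (simp add: Melem_def wick_def scal_1)

text \<open>Integrating \<open>y_i\<close> by parts differentiates either \<open>x_k\<close>, giving
  the diagonal term, or the rising product, giving \<open>(E + m)\<close> times the previous
  matrix.\<close>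

lemma Melem_Suc:
  assumes "i \<in> {1..N}"
  shows "Melem N (Suc m) i k = (\<Sum>l=1..N. Eop i l * Melem N m l k) + of_nat m * Melem N m i k
     + (if i = k then Zelem N (Suc m) else 0)"
proof -
  have sc: "scal (1 / fact (Suc m)) * of_nat (Suc m) = scal (1 / fact m)"
    unfolding scal_of_nat[symmetric] scal_mult[symmetric] by (simp add: field_simps del: of_nat_Suc)
  have "wick_rising N (Suc m) {#k#} {#i#} = Dop i (wick_rising N (Suc m)) {#k#} {#} + (if i = k then wick_rising N (Suc m) {#} {#} else 0)"
    by (simp add: Dop_def del: wick_rising.simps)
  hence "Melem N (Suc m) i k = scal (1 / fact (Suc m)) * of_nat (Suc m) *
      (Qop N i (wick_rising N m) {#k#} {#} + of_nat m * wick_rising N m {#k#} {#i#}) + (if i = k then Zelem N (Suc m) else 0)"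
    unfolding Melem_def Zelem_def by (simp add: Dop_wick_rising_Suc[OF assms] distrib_left mult.assoc del: wick_rising.simps of_nat_Suc)
  also have "scal (1 / fact (Suc m)) * of_nat (Suc m) * (Qop N i (wick_rising N m) {#k#} {#} + of_nat m * wick_rising N m {#k#} {#i#})
     = (\<Sum>l=1..N. Eop i l * Melem N m l k) + of_nat m * Melem N m i k"
    unfolding sc Qop_def Melem_def distrib_left sum_distrib_left
    by (simp only: scal_left_commute[symmetric] endo_of_nat_left_commute)
  finally show ?thesis .
qed

lemma trace_Melem: "(\<Sum>i=1..N. Melem N m i i) = of_nat (N + m) * Zelem N m"
proof -
  have "(\<Sum>i=1..N. Melem N m i i) = scal (1 / fact m) * Rop N (wick_rising N m) {#} {#}"
    unfolding Melem_def Rop_def by (simp add: sum_distrib_left)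
  also have "Rop N (wick_rising N m) {#} {#} = of_nat (N + m) * wick_rising N m {#} {#}"
    by (subst Rop_wick_rising) auto
  finally show ?thesis unfolding Zelem_def by (simp only: endo_of_nat_left_commute)
qed

subsection \<open>The Newton identity\<close>

text \<open>One device for linear functionals on polynomials with values in operators, in
  \<open>mpoly\<close> or in numbers.\<close>

definition polysum :: "(nat \<Rightarrow> complex \<Rightarrow> 'b::comm_monoid_add) \<Rightarrow> complex poly \<Rightarrow> 'b" where
  "polysum f p = (\<Sum>n\<le>degree p. f n (coeff p n))"

lemma polysum_bound:
  assumes "\<And>n. f n 0 = 0" "degree p \<le> M"
  shows "polysum f p = (\<Sum>n\<le>M. f n (coeff p n))"
  unfolding polysum_def using assms by (intro sum.mono_neutral_left) (auto simp: coeff_eq_0 not_le)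

lemma polysum_add:
  assumes "\<And>n. f n 0 = 0" "\<And>n a b. f n (a + b) = f n a + f n b"
  shows "polysum f (p + q) = polysum f p + polysum f q"
proof -
  let ?M = "max (degree p) (degree q)"
  have "degree (p + q) \<le> ?M" by (rule degree_add_le_max)
  thus ?thesis
    by (simp add: polysum_bound[of f, OF assms(1), where M = ?M] assms(2) sum.distrib)
qed

lemma polysum_pCons:
  assumes "\<And>n. f n 0 = 0"
  shows "polysum f (pCons a p) = f 0 a + polysum (\<lambda>n. f (Suc n)) p"
proof -
  have "polysum f (pCons a p) = (\<Sum>n\<le>Suc (degree p). f n (coeff (pCons a p) n))"
    using assms by (intro polysum_bound degree_pCons_le)
  thus ?thesis by (simp add: polysum_def sum.atMost_Suc_shift del: sum.atMost_Suc)
qed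

lemma polysum_smult:
  assumes "\<And>n. f n 0 = 0"
  shows "polysum f (smult c p) = polysum (\<lambda>n a. f n (c * a)) p"
proof -
  have "polysum f (smult c p) = (\<Sum>n\<le>degree p. f n (coeff (smult c p) n))"
    using assms by (intro polysum_bound degree_smult_le)
  thus ?thesis by (simp add: polysum_def)
qed

definition pE :: "nat \<Rightarrow> complex poly \<Rightarrow> nat \<Rightarrow> nat \<Rightarrow> endo" where
  "pE N p i k = polysum (\<lambda>n c. scal c * Epow N n i k) p"

definition trE :: "nat \<Rightarrow> complex poly \<Rightarrow> endo" where
  "trE N p = polysum (\<lambda>n c. scal c * Ctr N n) p"

lemma trE_pE: "(\<Sum>i=1..N. pE N p i i) = trE N p"
  unfolding pE_def trE_def polysum_def Ctr_def by (subst sum.swap) (simp add: sum_distrib_left)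

lemma pE_linear_factor:
  "pE N ([:c, 1:] * p) i k = (\<Sum>l=1..N. Eop i l * pE N p l k) + scal c * pE N p i k"
proof -
  have "pE N ([:c, 1:] * p) i k = pE N (smult c p) i k + pE N (pCons 0 p) i k"
    unfolding pE_def by (subst polysum_add[symmetric]) (simp_all add: scal_0 scal_add distrib_right)
  also have "pE N (smult c p) i k = scal c * pE N p i k"
    unfolding pE_def by (subst polysum_smult) (simp_all add: scal_0 scal_mult polysum_def sum_distrib_left mult.assoc)
  also have "pE N (pCons 0 p) i k = (\<Sum>n\<le>degree p. \<Sum>l=1..N. scal (coeff p n) * (Eop i l * Epow N n l k))"
    unfolding pE_def by (subst polysum_pCons) (simp_all add: scal_0 polysum_def sum_distrib_left)
  also have "\<dots> = (\<Sum>l=1..N. \<Sum>n\<le>degree p. Eop i l * (scal (coeff p n) * Epow N n l k))"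
    by (subst sum.swap) (simp only: scal_left_commute)
  also have "\<dots> = (\<Sum>l=1..N. Eop i l * pE N p l k)"
    unfolding pE_def polysum_def sum_distrib_left ..
  finally show ?thesis by (simp add: add.commute)
qed

definition rising :: "nat \<Rightarrow> nat \<Rightarrow> complex poly" where
  "rising j m = (\<Prod>t=j..<m. [:of_nat t, 1:])"

lemma rising_self: "rising m m = 1" by (simp add: rising_def)

lemma rising_Suc: "j \<le> m \<Longrightarrow> rising j (Suc m) = [:of_nat m, 1:] * rising j m"
  by (simp add: rising_def prod.atLeastLessThan_Suc mult.commute)

lemma pE_1: "pE N 1 i k = (if i = k then 1 else 0)"
  by (simp add: pE_def polysum_def scal_1)

text \<open>Unrolling the recursion: \<open>Zelem N j\<close> enters at stage \<open>j\<close> and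
  is then multiplied by \<open>E + j\<close>, ..., \<open>E + m - 1\<close>.\<close>

lemma Melem_expand:
  assumes "i \<in> {1..N}"
  shows "Melem N m i k = (\<Sum>j\<le>m. pE N (rising j m) i k * Zelem N j)"
  using assms
proof (induction m arbitrary: i)
  case 0
  show ?case by (simp add: Melem_0 Zelem_0 rising_self pE_1)
next
  case (Suc m)
  have "Melem N (Suc m) i k = (\<Sum>l=1..N. \<Sum>j\<le>m. Eop i l * pE N (rising j m) l k * Zelem N j)
      + of_nat m * (\<Sum>j\<le>m. pE N (rising j m) i k * Zelem N j) + (if i = k then Zelem N (Suc m) else 0)"
    unfolding Melem_Suc[OF Suc.prems] using Suc by (simp add: sum_distrib_left mult.assoc)
  also have "(\<Sum>l=1..N. \<Sum>j\<le>m. Eop i l * pE N (rising j m) l k * Zelem N j) =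
      (\<Sum>j\<le>m. (\<Sum>l=1..N. Eop i l * pE N (rising j m) l k) * Zelem N j)"
    by (subst sum.swap) (simp add: sum_distrib_right)
  also have "\<dots> + of_nat m * (\<Sum>j\<le>m. pE N (rising j m) i k * Zelem N j) =
      (\<Sum>j\<le>m. pE N (rising j (Suc m)) i k * Zelem N j)"
  proof -
    have "(\<Sum>j\<le>m. pE N (rising j (Suc m)) i k * Zelem N j) =
      (\<Sum>j\<le>m. ((\<Sum>l=1..N. Eop i l * pE N (rising j m) l k) + of_nat m * pE N (rising j m) i k) * Zelem N j)"
      by (intro sum.cong refl) (simp only: rising_Suc pE_linear_factor scal_of_nat atMost_iff)
    thus ?thesis by (simp only: sum_distrib_left distrib_right sum.distrib mult.assoc)
  qed
  finally show ?case by (simp add: rising_self pE_1)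
qed

lemma newton_identity: "of_nat (N + m) * Zelem N m = (\<Sum>j\<le>m. trE N (rising j m) * Zelem N j)"
proof -
  have "of_nat (N + m) * Zelem N m = (\<Sum>i=1..N. \<Sum>j\<le>m. pE N (rising j m) i i * Zelem N j)"
    unfolding trace_Melem[symmetric] by (intro sum.cong refl Melem_expand)
  also have "\<dots> = (\<Sum>j\<le>m. trE N (rising j m) * Zelem N j)"
    unfolding trE_pE[symmetric] sum_distrib_right by (rule sum.swap)
  finally show ?thesis .
qed

subsection \<open>From rising products to powers\<close>

text \<open>Stirling numbers of the second kind with sign \<open>(-1)^(m-k)\<close>: they expand a
  power in rising factorials.\<close>

fun signed_stirling :: "nat \<Rightarrow> nat \<Rightarrow> complex" where
  "signed_stirling 0 0 = 1"
| "signed_stirling 0 (Suc k) = 0"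
| "signed_stirling (Suc m) 0 = 0"
| "signed_stirling (Suc m) (Suc k) = signed_stirling m k - of_nat (Suc k) * signed_stirling m (Suc k)"

lemma signed_stirling_eq_0: "m < k \<Longrightarrow> signed_stirling m k = 0"
proof (induction m arbitrary: k)
  case 0 thus ?case by (cases k) auto
next
  case (Suc m) thus ?case by (cases k) auto
qed

text \<open>The recursion in summed form, abstract in \<open>F\<close> because it is applied to
  operators as well as to polynomials.\<close>

lemma sum_signed_stirling_Suc:
  fixes F :: "nat \<Rightarrow> complex \<Rightarrow> 'a::ab_group_add"
  assumes F0: "\<And>k. F k 0 = 0" and Fd: "\<And>k a b. F k (a - b) = F k a - F k b"
  shows "(\<Sum>k\<le>Suc m. F k (signed_stirling (Suc m) k)) =
    (\<Sum>k\<le>m. F (Suc k) (signed_stirling m k)) - (\<Sum>k\<le>m. F k (of_nat k * signed_stirling m k))"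
proof -
  have "(\<Sum>k\<le>m. F k (of_nat k * signed_stirling m k)) = (\<Sum>k\<le>Suc m. F k (of_nat k * signed_stirling m k))"
    by (simp add: signed_stirling_eq_0 F0)
  also have "\<dots> = (\<Sum>k\<le>m. F (Suc k) (of_nat (Suc k) * signed_stirling m (Suc k)))"
    by (simp add: sum.atMost_Suc_shift F0 del: sum.atMost_Suc)
  finally show ?thesis
    by (simp add: sum.atMost_Suc_shift F0 Fd sum_subtractf del: sum.atMost_Suc)
qed

lemma poly_rising_plus_1: "poly (rising k m) (x + 1) = poly (rising (Suc k) (Suc m)) x"
  unfolding rising_def poly_prod
  by (rule prod.reindex_bij_witness[of _ "\<lambda>t. t - 1" Suc]) (auto simp: algebra_simps)

lemma poly_rising_Suc_left: "k \<le> m \<Longrightarrow> poly (rising k (Suc m)) x = (x + of_nat k) * poly (rising (Suc k) (Suc m)) x"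
  unfolding rising_def poly_prod by (subst prod.atLeast_Suc_lessThan) (simp_all add: algebra_simps)

text \<open>Formally \<open>X^m\<close> is the sum of \<open>signed_stirling m k\<close> times
  \<open>r^(m-k) X^(k)\<close>. In the expectation each \<open>r\<close> becomes \<open>N\<close>
  plus the current degree, and the \<open>m - k\<close> of them multiply up to
  \<open>rising k m\<close>.\<close>

lemma wick_power_expand:
  assumes "set_mset I \<subseteq> {1..N}"
  shows "wick_power N m I J = (\<Sum>k\<le>m. scal (signed_stirling m k * poly (rising k m) (of_nat (N + size I))) * wick_rising N k I J)"
  using assms
proof (induction m arbitrary: I J)
  case 0
  show ?case by (simp add: rising_self scal_1)
next
  case (Suc m)
  define x :: complex where "x = of_nat (N + size I)"
  define R where "R k = poly (rising k (Suc m)) x" for k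
  \<comment> \<open>The additional \<open>x_a\<close> raises the degree by one, so the argument
    moves from \<open>x\<close> to \<open>x + 1\<close>.\<close>
  have rs: "poly (rising k m) (of_nat (N + Suc (size I))) = R (Suc k)" for k
    using poly_rising_plus_1[of k m x] by (simp add: R_def x_def add_ac)
  have Rk: "R k = (x + of_nat k) * R (Suc k)" if "k \<le> m" for k
    unfolding R_def by (rule poly_rising_Suc_left[OF that])
  have XK: "Xop N (wick_rising N k) I J = wick_rising N (Suc k) I J - scal (of_nat k * (x + of_nat k)) * wick_rising N k I J" for k
  proof -
    have "of_nat k * Rop N (wick_rising N k) I J = scal (of_nat k * (x + of_nat k)) * wick_rising N k I J"
      unfolding Rop_wick_rising[OF Suc.prems] x_def using scal_of_nat[of "k * (N + size I + k)"]
      by (simp only: mult.assoc of_nat_mult of_nat_add)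
    thus ?thesis by simp
  qed
  have "wick_power N (Suc m) I J = (\<Sum>a=1..N. \<Sum>b=1..N. \<Sum>k\<le>m. Eop a b * (scal (signed_stirling m k * R (Suc k)) * wick_rising N k (add_mset a I) (add_mset b J)))"
    unfolding wick_power.simps Xop_def
  proof (intro sum.cong refl)
    fix a b assume "a \<in> {1..N}"
    hence "set_mset (add_mset a I) \<subseteq> {1..N}" using Suc.prems by auto
    from Suc.IH[OF this] show "Eop a b * wick_power N m (add_mset a I) (add_mset b J) =
       (\<Sum>k\<le>m. Eop a b * (scal (signed_stirling m k * R (Suc k)) * wick_rising N k (add_mset a I) (add_mset b J)))"
      by (simp only: size_add_mset rs sum_distrib_left)
  qed
  also have "\<dots> = (\<Sum>a=1..N. \<Sum>k\<le>m. \<Sum>b=1..N. scal (signed_stirling m k * R (Suc k)) * (Eop a b * wick_rising N k (add_mset a I) (add_mset b J)))"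
    unfolding scal_left_commute by (intro sum.cong refl sum.swap)
  also have "\<dots> = (\<Sum>k\<le>m. scal (signed_stirling m k * R (Suc k)) * Xop N (wick_rising N k) I J)"
    unfolding Xop_def sum_distrib_left by (rule sum.swap)
  also have "\<dots> = (\<Sum>k\<le>m. scal (signed_stirling m k * R (Suc k)) * wick_rising N (Suc k) I J) -
      (\<Sum>k\<le>m. scal (of_nat k * signed_stirling m k * R k) * wick_rising N k I J)"
    unfolding XK right_diff_distrib sum_subtractf mult.assoc[symmetric] scal_mult[symmetric]
    by (intro arg_cong2[where f = "(-)"] refl sum.cong) (simp add: Rk mult_ac)
  also have "\<dots> = (\<Sum>k\<le>Suc m. scal (signed_stirling (Suc m) k * R k) * wick_rising N k I J)"
    by (rule sum_signed_stirling_Suc[symmetric, where F = "\<lambda>k c. scal (c * R k) * wick_rising N k I J"])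
       (simp_all add: scal_0 left_diff_distrib scal_diff)
  finally show ?case by (simp only: R_def x_def)
qed

section \<open>Sums over permutations as Wick expectations\<close>

lemma wick_power_words:
  fixes ts :: "nat list"
  assumes "distinct ts"
  shows "wick_power N (length ts) I J = (\<Sum>i\<in>Pi\<^sub>E (set ts) (\<lambda>_. {1..N}). \<Sum>j\<in>Pi\<^sub>E (set ts) (\<lambda>_. {1..N}).
     word_op (map (\<lambda>t. (i t, j t)) ts) * of_nat (wick (I + image_mset i (mset ts)) (J + image_mset j (mset ts))))"
  using assms
proof (induction ts arbitrary: I J)
  case Nil
  show ?case by (simp add: word_op_def)
next
  case (Cons t ts)
  let ?P = "Pi\<^sub>E (set ts) (\<lambda>_. {1..N})"
  let ?w = "\<lambda>ts I J i j. word_op (map (\<lambda>t. (i t, j t)) ts) * of_nat (wick (I + image_mset i (mset ts)) (J + image_mset j (mset ts)))"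
  have nt: "t \<notin> set ts" using Cons.prems by simp
  have step: "?w (t # ts) I J (i(t := a)) (j(t := b)) = Eop a b * ?w ts (add_mset a I) (add_mset b J) i j" for i j a b
  proof -
    have m: "map (\<lambda>s. ((i(t := a)) s, (j(t := b)) s)) ts = map (\<lambda>s. (i s, j s)) ts"
      using nt by (intro map_cong refl) auto
    have im: "image_mset (f(t := c)) (mset ts) = image_mset f (mset ts)" for f :: "nat \<Rightarrow> nat" and c
      using nt by (intro image_mset_cong) auto
    show ?thesis
      by (simp only: list.map m word_op_Cons mset.simps image_mset_add_mset im fun_upd_same
          union_mset_add_mset_right union_mset_add_mset_left mult.assoc)
  qed
  have "wick_power N (length (t # ts)) I J = (\<Sum>a=1..N. \<Sum>b=1..N. Eop a b * (\<Sum>i\<in>?P. \<Sum>j\<in>?P. ?w ts (add_mset a I) (add_mset b J) i j))"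
    using Cons by (simp add: Xop_def)
  also have "\<dots> = (\<Sum>a=1..N. \<Sum>b=1..N. \<Sum>i\<in>?P. \<Sum>j\<in>?P. ?w (t # ts) I J (i(t := a)) (j(t := b)))"
    unfolding step sum_distrib_left ..
  also have "\<dots> = (\<Sum>a=1..N. \<Sum>i\<in>?P. \<Sum>b=1..N. \<Sum>j\<in>?P. ?w (t # ts) I J (i(t := a)) (j(t := b)))"
    by (intro sum.cong refl sum.swap)
  also have "\<dots> = (\<Sum>i\<in>Pi\<^sub>E (set (t # ts)) (\<lambda>_. {1..N}). \<Sum>j\<in>Pi\<^sub>E (set (t # ts)) (\<lambda>_. {1..N}). ?w (t # ts) I J i j)"
    by (simp only: list.set sum_PiE_insert[OF nt])
  finally show ?case .
qed

text \<open>Two sets are kept apart because the induction removes \<open>a\<close> from one and its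
  image from the other. The choices for that image are counted by the factor in
  \<open>wick_add\<close>.\<close>

lemma card_injections_wick:
  fixes i j :: "nat \<Rightarrow> nat"
  assumes "finite A" "finite B" "card A = card B"
  shows "card {f \<in> A \<rightarrow>\<^sub>E B. inj_on f A \<and> (\<forall>a\<in>A. j a = i (f a))} =
    wick (image_mset i (mset_set B)) (image_mset j (mset_set A))"
  using assms
proof (induction A arbitrary: B rule: finite_induct)
  case empty
  hence "B = {}" by simp
  moreover have "{f \<in> {} \<rightarrow>\<^sub>E {}. inj_on f {} \<and> (\<forall>a\<in>{}. j a = i (f a))} = {\<lambda>_. undefined :: nat}" by auto
  ultimately show ?case by (simp add: wick_def)
next
  case (insert a A)
  let ?S = "\<lambda>A B. {f \<in> A \<rightarrow>\<^sub>E B. inj_on f A \<and> (\<forall>a\<in>A. j a = i (f a))}"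
  let ?B' = "{b \<in> B. i b = j a}"
  have eq: "?S (insert a A) B = (\<Union>b\<in>?B'. (\<lambda>f. f(a := b)) ` ?S A (B - {b}))"
  proof (intro equalityI subsetI)
    fix f assume f: "f \<in> ?S (insert a A) B"
    have fe: "f \<in> insert a A \<rightarrow>\<^sub>E B" and finj: "inj_on f (insert a A)" and fij: "\<forall>x\<in>insert a A. j x = i (f x)"
      using f by auto
    let ?g = "restrict f A"
    have "?g \<in> ?S A (B - {f a})"
      using fe finj fij insert.hyps(2) by (auto simp: inj_on_def)
    moreover have "f = ?g(a := f a)"
      using fe by (auto simp: fun_eq_iff PiE_def extensional_def)
    moreover have "f a \<in> ?B'" using fe fij by auto
    ultimately show "f \<in> (\<Union>b\<in>?B'. (\<lambda>f. f(a := b)) ` ?S A (B - {b}))" by blast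
  next
    fix f assume "f \<in> (\<Union>b\<in>?B'. (\<lambda>f. f(a := b)) ` ?S A (B - {b}))"
    then obtain b g where b: "b \<in> B" "i b = j a" and g: "g \<in> A \<rightarrow>\<^sub>E (B - {b})" "inj_on g A" "\<forall>x\<in>A. j x = i (g x)"
      and f: "f = g(a := b)" by auto
    have ga: "g x \<in> B \<and> g x \<noteq> b" if "x \<in> A" for x using g(1) that by (auto dest: PiE_mem)
    have ax: "x \<noteq> a" if "x \<in> A" for x using that insert.hyps(2) by auto
    have "f \<in> insert a A \<rightarrow>\<^sub>E B"
      unfolding f using b g(1) ga by (auto simp: PiE_def extensional_def)
    moreover have "inj_on f (insert a A)"
      unfolding f using g(2) ga ax insert.hyps(2) by (auto simp: inj_on_def)
    moreover have "\<forall>x\<in>insert a A. j x = i (f x)" unfolding f using b g(3) ax by auto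
    ultimately show "f \<in> ?S (insert a A) B" by blast
  qed
  have fin: "finite (?S A C)" if "finite C" for C :: "nat set"
    using finite_PiE[OF insert.hyps(1), of "\<lambda>_. C"] that by auto
  have inj: "inj_on (\<lambda>f. f(a := b)) (?S A C)" for b :: nat and C :: "nat set"
  proof (rule inj_onI)
    fix f g assume f: "f \<in> ?S A C" "g \<in> ?S A C" "f(a := b) = g(a := b)"
    have "f a = g a" using f(1,2) insert.hyps(2) by (auto simp: PiE_def extensional_def)
    thus "f = g" using f(3) by (metis fun_upd_triv fun_upd_upd)
  qed
  have "card (?S (insert a A) B) = (\<Sum>b\<in>?B'. card ((\<lambda>f. f(a := b)) ` ?S A (B - {b})))"
    unfolding eq
  proof (rule card_UN_disjoint)
    show "finite ?B'" using insert.prems by simp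
    show "\<forall>b\<in>?B'. finite ((\<lambda>f. f(a := b)) ` ?S A (B - {b}))"
      using fin insert.prems by auto
    show "\<forall>b\<in>?B'. \<forall>b'\<in>?B'. b \<noteq> b' \<longrightarrow>
        (\<lambda>f. f(a := b)) ` ?S A (B - {b}) \<inter> (\<lambda>f. f(a := b')) ` ?S A (B - {b'}) = {}"
      by (auto dest: fun_cong[of _ _ a])
  qed
  also have "\<dots> = (\<Sum>b\<in>?B'. wick (image_mset i (mset_set B) - {#j a#}) (image_mset j (mset_set A)))"
  proof (rule sum.cong[OF refl])
    fix b assume b: "b \<in> ?B'"
    have "mset_set B = add_mset b (mset_set (B - {b}))"
      using b insert.prems(1) by (simp add: mset_set.remove)
    hence "image_mset i (mset_set (B - {b})) = image_mset i (mset_set B) - {#j a#}"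
      using b by simp
    moreover have "card A = card (B - {b})" using b insert by simp
    ultimately show "card ((\<lambda>f. f(a := b)) ` ?S A (B - {b})) = wick (image_mset i (mset_set B) - {#j a#}) (image_mset j (mset_set A))"
      using insert.IH[of "B - {b}"] insert.prems(1) by (simp add: card_image[OF inj])
  qed
  also have "\<dots> = card ?B' * wick (image_mset i (mset_set B) - {#j a#}) (image_mset j (mset_set A))" by simp
  also have "card ?B' = count (image_mset i (mset_set B)) (j a)"
  proof -
    have "count (image_mset i (mset_set B)) (j a) = (\<Sum>y\<in>i -` {j a} \<inter> B. count (mset_set B) y)"
      using insert.prems(1) by (simp add: count_image_mset)
    also have "\<dots> = (\<Sum>y\<in>i -` {j a} \<inter> B. 1)"
      using insert.prems(1) by (intro sum.cong) auto
    also have "i -` {j a} \<inter> B = ?B'" by auto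
    finally show ?thesis by simp
  qed
  also have "count (image_mset i (mset_set B)) (j a) * wick (image_mset i (mset_set B) - {#j a#}) (image_mset j (mset_set A)) =
      wick (image_mset i (mset_set B)) (image_mset j (mset_set (insert a A)))"
    using insert.hyps by (simp add: wick_add)
  finally show ?case .
qed

lemma card_permutations_wick:
  fixes i j :: "nat \<Rightarrow> nat"
  assumes "finite A"
  shows "card {\<alpha>. \<alpha> permutes A \<and> (\<forall>a\<in>A. j a = i (\<alpha> a))} = wick (image_mset i (mset_set A)) (image_mset j (mset_set A))"
proof -
  let ?S = "{f \<in> A \<rightarrow>\<^sub>E A. inj_on f A \<and> (\<forall>a\<in>A. j a = i (f a))}"
  let ?T = "{\<alpha>. \<alpha> permutes A \<and> (\<forall>a\<in>A. j a = i (\<alpha> a))}"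
  have "bij_betw (\<lambda>\<alpha>. restrict \<alpha> A) ?T ?S"
  proof (rule bij_betw_byWitness[where f' = "\<lambda>f x. if x \<in> A then f x else x"])
    show "\<forall>\<alpha>\<in>?T. (\<lambda>x. if x \<in> A then restrict \<alpha> A x else x) = \<alpha>"
      by (auto simp: fun_eq_iff permutes_def)
    show "\<forall>f\<in>?S. restrict (\<lambda>x. if x \<in> A then f x else x) A = f"
      by (auto simp: fun_eq_iff PiE_def extensional_def)
    show "(\<lambda>\<alpha>. restrict \<alpha> A) ` ?T \<subseteq> ?S"
      by (auto simp: permutes_in_image inj_on_restrict_eq permutes_inj_on)
    show "(\<lambda>f x. if x \<in> A then f x else x) ` ?S \<subseteq> ?T"
    proof (rule image_subsetI, intro CollectI conjI ballI)
      fix f assume f: "f \<in> ?S"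
      have "inj_on f A" "f ` A \<subseteq> A" using f by auto
      hence "bij_betw f A A" unfolding bij_betw_def using assms endo_inj_surj by metis
      hence "bij_betw (\<lambda>x. if x \<in> A then f x else x) A A" by (subst bij_betw_cong[where g = f]) auto
      thus "(\<lambda>x. if x \<in> A then f x else x) permutes A" by (rule bij_imp_permutes) simp
    next
      fix f a assume "f \<in> ?S" "a \<in> A"
      thus "j a = i (if a \<in> A then f a else a)" by auto
    qed
  qed
  hence "card ?T = card ?S" by (rule bij_betw_same_card)
  thus ?thesis using card_injections_wick[OF assms assms refl, of j i] by simp
qed

text \<open>Wick's theorem: for given row indices \<open>i\<close> and column indices
  \<open>j\<close>, the permutations with \<open>j = i \<circ> \<alpha>\<close> are counted by the
  expectation of the corresponding monomial in \<open>x\<close> and \<open>y\<close>.\<close>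

lemma rep_sum_permutations:
  "(\<Sum>\<alpha>\<in>{\<alpha>. \<alpha> permutes {1..m}}. rep (w_glN N m \<alpha>)) = wick_power N m {#} {#}"
proof -
  let ?A = "{1..m}" and ?ts = "[1..<m+1]"
  let ?P = "Pi\<^sub>E ?A (\<lambda>_. {1..N})" and ?Q = "{\<alpha>. \<alpha> permutes ?A}"
  let ?w = "\<lambda>i j. word_op (map (\<lambda>t. (i t, j t)) ?ts)"
  have set: "set ?ts = ?A" by auto
  have ms: "mset ?ts = mset_set ?A" by (metis mset_set_set distinct_upt set)
  have finQ: "finite ?Q" by (simp add: finite_permutations)
  have finP: "finite ?P" by (simp add: finite_PiE)
  have one: "(\<Sum>j\<in>?P. ?w i j * of_nat (card {\<alpha>\<in>?Q. \<forall>a\<in>?A. j a = i (\<alpha> a)})) = (\<Sum>\<alpha>\<in>?Q. ?w i (\<lambda>t. i (\<alpha> t)))"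
    if i: "i \<in> ?P" for i
  proof -
    have "(\<Sum>j\<in>?P. ?w i j * of_nat (card {\<alpha>\<in>?Q. \<forall>a\<in>?A. j a = i (\<alpha> a)})) =
       (\<Sum>j\<in>?P. \<Sum>\<alpha>\<in>?Q. if (\<forall>a\<in>?A. j a = i (\<alpha> a)) then ?w i j else 0)"
    proof (rule sum.cong[OF refl])
      fix j
      have "?w i j * of_nat (card {\<alpha>\<in>?Q. \<forall>a\<in>?A. j a = i (\<alpha> a)}) = (\<Sum>\<alpha>\<in>{\<alpha>\<in>?Q. \<forall>a\<in>?A. j a = i (\<alpha> a)}. ?w i j)"
        by (simp only: sum_constant endo_of_nat_commute)
      also have "\<dots> = (\<Sum>\<alpha>\<in>?Q. if (\<forall>a\<in>?A. j a = i (\<alpha> a)) then ?w i j else 0)"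
        using sum.inter_filter[OF finQ, of "\<lambda>_. ?w i j" "\<lambda>\<alpha>. \<forall>a\<in>?A. j a = i (\<alpha> a)"] .
      finally show "?w i j * of_nat (card {\<alpha>\<in>?Q. \<forall>a\<in>?A. j a = i (\<alpha> a)}) =
         (\<Sum>\<alpha>\<in>?Q. if (\<forall>a\<in>?A. j a = i (\<alpha> a)) then ?w i j else 0)" .
    qed
    also have "\<dots> = (\<Sum>\<alpha>\<in>?Q. \<Sum>j\<in>?P. if (\<forall>a\<in>?A. j a = i (\<alpha> a)) then ?w i j else 0)"
      by (rule sum.swap)
    also have "\<dots> = (\<Sum>\<alpha>\<in>?Q. ?w i (\<lambda>t. i (\<alpha> t)))"
    proof (rule sum.cong[OF refl])
      fix \<alpha> assume "\<alpha> \<in> ?Q"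
      hence perm: "\<alpha> permutes ?A" by simp
      have al: "\<alpha> t \<in> ?A" if "t \<in> ?A" for t using that by (simp only: permutes_in_image[OF perm])
      define j0 where "j0 = restrict (\<lambda>t. i (\<alpha> t)) ?A"
      have j0: "j0 \<in> ?P" unfolding j0_def restrict_PiE_iff using al PiE_mem[OF i] by blast
      have iff: "(\<forall>a\<in>?A. j a = i (\<alpha> a)) \<longleftrightarrow> j = j0" if j: "j \<in> ?P" for j
      proof
        assume "\<forall>a\<in>?A. j a = i (\<alpha> a)"
        thus "j = j0" using PiE_ext[OF j j0] by (simp only: j0_def restrict_apply if_True)
      qed (simp only: j0_def restrict_apply if_True, simp)
      have "(\<Sum>j\<in>?P. if (\<forall>a\<in>?A. j a = i (\<alpha> a)) then ?w i j else 0) = (\<Sum>j\<in>?P. if j = j0 then ?w i j else 0)"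
        by (rule sum.cong[OF refl]) (simp only: iff)
      also have "\<dots> = ?w i j0" using j0 finP by (simp only: sum.delta if_True)
      also have "map (\<lambda>t. (i t, j0 t)) ?ts = map (\<lambda>t. (i t, i (\<alpha> t))) ?ts"
        by (intro map_cong refl) (simp only: j0_def restrict_apply set if_True)
      finally show "(\<Sum>j\<in>?P. if (\<forall>a\<in>?A. j a = i (\<alpha> a)) then ?w i j else 0) = ?w i (\<lambda>t. i (\<alpha> t))" .
    qed
    finally show ?thesis .
  qed
  have "wick_power N m {#} {#} = wick_power N (length ?ts) {#} {#}" by (simp only: length_upt add_diff_cancel_right')
  also have "\<dots> = (\<Sum>i\<in>?P. \<Sum>j\<in>?P. ?w i j * of_nat (wick (image_mset i (mset_set ?A)) (image_mset j (mset_set ?A))))"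
    by (subst wick_power_words) (simp_all only: distinct_upt set ms empty_neutral)
  also have "\<dots> = (\<Sum>i\<in>?P. \<Sum>j\<in>?P. ?w i j * of_nat (card {\<alpha>\<in>?Q. \<forall>a\<in>?A. j a = i (\<alpha> a)}))"
    by (simp only: card_permutations_wick[symmetric, OF finite_atLeastAtMost] mem_Collect_eq)
  also have "\<dots> = (\<Sum>i\<in>?P. \<Sum>\<alpha>\<in>?Q. ?w i (\<lambda>t. i (\<alpha> t)))" by (intro sum.cong refl one)
  also have "\<dots> = (\<Sum>\<alpha>\<in>?Q. \<Sum>i\<in>?P. ?w i (\<lambda>t. i (\<alpha> t)))" by (rule sum.swap)
  also have "\<dots> = (\<Sum>\<alpha>\<in>?Q. rep (w_glN N m \<alpha>))"
    by (simp only: w_glN_def rep_sum rep_word)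
  finally show ?thesis by simp
qed

text \<open>Makes the definite description usable: two solutions agree under every
  \<open>ev N\<close>, hence are equal by \<open>ev_injective\<close>.\<close>

lemma ev_w_gl:
  assumes "\<alpha> permutes {1..m}" "N \<ge> 1"
  shows "ev N (w_gl m \<alpha>) = rep (w_glN N m \<alpha>)"
proof -
  let ?R = "\<lambda>P. \<forall>N\<ge>1. U_eq N (eval_U N P) (w_glN N m \<alpha>)"
  have evR: "ev N P = rep (w_glN N m \<alpha>)" if "?R P" "N \<ge> 1" for P N
    unfolding ev_def using that rep_U_eq by blast
  obtain P where P: "?R P" using universal_w_glN[OF assms(1)] by blast
  have "Q = P" if "?R Q" for Q
  proof -
    have "Q - P = 0"
      by (rule ev_injective) (simp add: ev_diff evR[OF that] evR[OF P])
    thus ?thesis by simp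
  qed
  hence "?R (w_gl m \<alpha>)" unfolding w_gl_def using P by (intro theI[of ?R P])
  thus ?thesis using evR assms(2) by blast
qed

lemma ev_A_elem:
  assumes "N \<ge> 1"
  shows "ev N (A_elem m) = scal (1 / fact m) * (\<Sum>k\<le>m. scal (signed_stirling m k * fact k * poly (rising k m) (of_nat N)) * Zelem N k)"
proof -
  have "ev N (A_elem m) = scal (1 / fact m) * (\<Sum>\<alpha>\<in>{\<alpha>. \<alpha> permutes {1..m}}. rep (w_glN N m \<alpha>))"
    unfolding A_elem_def ev_mconst_mult ev_sum using assms
    by (intro arg_cong2[where f = "(*)"] sum.cong) (auto simp: ev_w_gl)
  also have "\<dots> = scal (1 / fact m) * wick_power N m {#} {#}" by (simp only: rep_sum_permutations)
  also have "wick_power N m {#} {#} = (\<Sum>k\<le>m. scal (signed_stirling m k * fact k * poly (rising k m) (of_nat N)) * Zelem N k)"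
  proof -
    have "scal (x * y) * (scal z * u) = scal (x * z * y) * u" for x y z u
      by (simp only: mult.assoc[symmetric] scal_mult[symmetric]) (simp add: mult_ac)
    thus ?thesis by (subst wick_power_expand) (simp_all add: wick_rising_Zelem del: wick_rising.simps)
  qed
  finally show ?thesis .
qed

section \<open>Lifting the Newton recursion to polynomials\<close>

definition Chat :: "nat \<Rightarrow> mpoly" where
  "Chat k = (if k = 0 then mconst polyN else mvar (k - 1))"

text \<open>The polynomial counterpart of \<open>trE\<close>. The trace of \<open>E^0\<close> is
  \<open>N\<close>, which is why \<open>Chat 0\<close> is \<open>polyN\<close>.\<close>

definition tauC :: "complex poly \<Rightarrow> mpoly" where
  "tauC p = polysum (\<lambda>n c. mconst [:c:] * Chat n) p"

text \<open>\<open>Zelem\<close> lives in the representation; this version, solved from the Newton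
  identity, is an element to which \<open>Phi\<close> can be applied.\<close>

fun zhat :: "nat \<Rightarrow> mpoly" where
  "zhat m = (if m = 0 then 1 else mconst [:1 / of_nat m:] * (\<Sum>j<m. tauC (rising j m) * zhat j))"

declare zhat.simps [simp del]

lemma Ctr_0: "Ctr N 0 = of_nat N"
  by (simp add: Ctr_def)

lemma ev_Chat_mult: "ev N (Chat k * P) = Ctr N k * ev N P"
proof (cases k)
  case 0
  thus ?thesis by (simp add: Chat_def ev_mconst_mult Ctr_0 polyN_def scal_of_nat)
next
  case (Suc k')
  thus ?thesis using ev_mvar_mult[of N k' P] by (simp add: Chat_def)
qed

lemma ev_tauC_mult: "ev N (tauC p * P) = trE N p * ev N P"
  unfolding tauC_def trE_def polysum_def sum_distrib_right ev_sum
  by (simp add: mult.assoc ev_mconst_mult ev_Chat_mult)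

lemma ev_zhat: "ev N (zhat m) = Zelem N m"
proof (induction m rule: less_induct)
  case (less m)
  show ?case
  proof (cases "m = 0")
    case True
    thus ?thesis by (simp add: zhat.simps ev_1 Zelem_0)
  next
    case False
    \<comment> \<open>The term \<open>j = m\<close> of the Newton identity is
      \<open>N * Zelem N m\<close>; cancelling it leaves the factor \<open>m\<close> on the left, by
      which one can divide.\<close>
    have "trE N 1 = of_nat N" by (simp add: trE_def polysum_def scal_1 Ctr_0)
    hence "of_nat (N + m) * Zelem N m = (\<Sum>j<m. trE N (rising j m) * Zelem N j) + of_nat N * Zelem N m"
      unfolding newton_identity by (simp add: lessThan_Suc_atMost[symmetric] rising_self)
    hence eq: "of_nat m * Zelem N m = (\<Sum>j<m. trE N (rising j m) * Zelem N j)"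
      by (simp add: distrib_right)
    have "ev N (zhat m) = scal (1 / of_nat m) * (\<Sum>j<m. trE N (rising j m) * Zelem N j)"
      using False less by (subst zhat.simps) (simp add: ev_mconst_mult ev_sum ev_tauC_mult)
    also have "\<dots> = Zelem N m"
      unfolding eq[symmetric] using False
      by (simp add: mult.assoc[symmetric] scal_of_nat[symmetric] scal_mult[symmetric] scal_1)
    finally show ?thesis .
  qed
qed

text \<open>Both sides agree in the representation for every \<open>N\<close>, and
  \<open>ev_injective\<close> lifts the equality.\<close>

lemma A_elem_zhat:
  "A_elem m = mconst [:1 / fact m:] * (\<Sum>k\<le>m. mconst (smult (signed_stirling m k * fact k) (rising k m)) * zhat k)"
  (is "_ = ?R")
proof -
  have "A_elem m - ?R = 0"
  proof (rule ev_injective)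
    fix N :: nat assume "N \<ge> 1"
    thus "ev N (A_elem m - ?R) = 0"
      by (simp add: ev_diff ev_A_elem ev_mconst_mult ev_sum ev_zhat)
  qed
  thus ?thesis by simp
qed

subsection \<open>The Schur substitution\<close>

text \<open>Since \<open>h^i\<close> has order at least \<open>i\<close>, any truncation of the sum
  beyond the wanted coefficient gives the same value.\<close>

lemma fps_mult_lsum_nth:
  fixes h :: "'a::comm_ring_1 fps"
  assumes h: "fps_nth h 0 = 0" and "k \<le> M"
  shows "fps_nth (P * lsum (\<lambda>i. fps_const (c i) * h ^ i)) k = (\<Sum>i\<le>M. c i * fps_nth (P * h ^ i) k)"
proof -
  have lsum: "fps_nth (lsum (\<lambda>i. fps_const (c i) * h ^ i)) l = fps_nth (\<Sum>i\<le>M. fps_const (c i) * h ^ i) l" if "l \<le> M" for l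
  proof -
    have "fps_nth (lsum (\<lambda>i. fps_const (c i) * h ^ i)) l = (\<Sum>i\<le>l. c i * fps_nth (h ^ i) l)"
      by (simp add: lsum_def)
    also have "\<dots> = (\<Sum>i\<le>M. c i * fps_nth (h ^ i) l)"
      using that startsby_zero_power_prefix[OF h] by (intro sum.mono_neutral_left) auto
    finally show ?thesis by (simp add: fps_sum_nth)
  qed
  have "fps_nth (P * lsum (\<lambda>i. fps_const (c i) * h ^ i)) k = fps_nth (P * (\<Sum>i\<le>M. fps_const (c i) * h ^ i)) k"
    unfolding fps_mult_nth using assms(2) by (intro sum.cong refl) (simp add: lsum)
  also have "P * (\<Sum>i\<le>M. fps_const (c i) * h ^ i) = (\<Sum>i\<le>M. fps_const (c i) * (P * h ^ i))"
    by (simp add: sum_distrib_left mult_ac)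
  finally show ?thesis by (simp add: fps_sum_nth)
qed

lemma geom_inverse: "(1 - fps_const b * fps_X) * geom b = 1"
proof (rule fps_ext)
  fix k show "fps_nth ((1 - fps_const b * fps_X) * geom b) k = fps_nth 1 k"
    by (cases k) (simp_all add: geom_def left_diff_distrib mult.assoc)
qed

lemma inv1p_inverse:
  fixes g :: "'a::comm_ring_1 fps"
  assumes "fps_nth g 0 = 0"
  shows "(1 + g) * inv1p g = 1"
proof (rule fps_ext)
  fix k
  have g: "fps_nth (- g) 0 = 0" using assms by simp
  have "inv1p g = lsum (\<lambda>j. fps_const 1 * (- g) ^ j)" by (simp add: inv1p_def)
  hence "fps_nth ((1 + g) * inv1p g) k = (\<Sum>i\<le>k. fps_nth ((1 + g) * (- g) ^ i) k)"
    by (simp only: fps_mult_lsum_nth[OF g order_refl] mult_1)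
  also have "\<dots> = fps_nth (\<Sum>i\<le>k. (- g) ^ i - (- g) ^ Suc i) k"
    by (simp add: fps_sum_nth algebra_simps)
  also have "(\<Sum>i\<le>k. (- g) ^ i - (- g) ^ Suc i) = 1 - (- g) ^ Suc k"
    by (subst sum_telescope) simp
  also have "fps_nth (1 - (- g) ^ Suc k) k = fps_nth 1 k"
    using startsby_zero_power_prefix[OF g, of "Suc k"] by simp
  finally show "fps_nth ((1 + g) * inv1p g) k = fps_nth 1 k" .
qed

lemma lsum_binomial:
  fixes g :: "complex fps"
  assumes "fps_nth g 0 = 0"
  shows "lsum (\<lambda>j. fps_const (of_nat (n choose j)) * g ^ j) = (1 + g) ^ n"
proof (rule fps_ext)
  fix k
  have "fps_nth (1 * lsum (\<lambda>j. fps_const (of_nat (n choose j)) * g ^ j)) k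
     = (\<Sum>j\<le>k + n. of_nat (n choose j) * fps_nth (1 * g ^ j) k)"
    by (rule fps_mult_lsum_nth[OF assms]) simp
  also have "\<dots> = (\<Sum>j\<le>n. of_nat (n choose j) * fps_nth (g ^ j) k)"
    by (subst mult_1, rule sum.mono_neutral_right) (auto simp: binomial_eq_0)
  also have "\<dots> = fps_nth ((g + 1) ^ n) k"
    unfolding binomial_ring by (simp add: fps_sum_nth fps_of_nat[symmetric] del: fps_of_nat)
  finally show "fps_nth (lsum (\<lambda>j. fps_const (of_nat (n choose j)) * g ^ j)) k = fps_nth ((1 + g) ^ n) k"
    by (simp add: add.commute)
qed

section \<open>Specialization of the Schur substitution\<close>

definition fps_evc :: "nat \<Rightarrow> (nat \<Rightarrow> complex) \<Rightarrow> mpoly fps \<Rightarrow> complex fps" where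
  "fps_evc n s f = Abs_fps (\<lambda>k. evc n s (fps_nth f k))"

lemma fps_evc_nth: "fps_nth (fps_evc n s f) k = evc n s (fps_nth f k)" by (simp add: fps_evc_def)

lemma fps_evc_mult: "fps_evc n s (f * g) = fps_evc n s f * fps_evc n s g"
  by (rule fps_ext) (simp add: fps_evc_nth fps_mult_nth evc_sum evc_mult)

lemma fps_evc_1: "fps_evc n s 1 = 1"
  by (rule fps_ext) (simp add: fps_evc_nth evc_1 evc_0)

lemma fps_evc_power: "fps_evc n s (f ^ k) = fps_evc n s f ^ k"
  by (induction k) (simp_all add: fps_evc_1 fps_evc_mult)

lemma fps_evc_diff: "fps_evc n s (f - g) = fps_evc n s f - fps_evc n s g"
  by (rule fps_ext) (simp add: fps_evc_nth evc_diff)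

lemma fps_evc_uminus: "fps_evc n s (- f) = - fps_evc n s f"
  by (rule fps_ext) (simp add: fps_evc_nth evc_uminus)

lemma fps_evc_const: "fps_evc n s (fps_const c) = fps_const (evc n s c)"
  by (rule fps_ext) (simp add: fps_evc_nth evc_0)

lemma fps_evc_X: "fps_evc n s fps_X = fps_X"
  by (rule fps_ext) (simp add: fps_evc_nth fps_X_def evc_0 evc_1)

lemma fps_evc_0: "fps_evc n s 0 = 0"
  by (rule fps_ext) (simp add: fps_evc_nth evc_0)

lemma fps_evc_lsum: "fps_evc n s (lsum F) = lsum (\<lambda>i. fps_evc n s (F i))"
  by (rule fps_ext) (simp add: fps_evc_nth lsum_def evc_sum)

lemma fps_evc_geom: "fps_evc n s (geom b) = geom (evc n s b)"
  by (rule fps_ext) (simp add: fps_evc_nth geom_def evc_power)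

lemma fps_evc_inv1p: "fps_evc n s (inv1p g) = inv1p (fps_evc n s g)"
  by (simp add: inv1p_def fps_evc_lsum fps_evc_power fps_evc_uminus)

lemma poly_Nchoose: "poly (Nchoose j) (of_nat n) = of_nat (n choose j)"
proof -
  have "poly (Nchoose j) (of_nat n) = (\<Prod>i<j. of_nat n - of_nat i) / fact j"
    by (simp add: Nchoose_def poly_prod)
  also have "\<dots> = of_nat n gchoose j"
    by (simp add: gbinomial_prod_rev atLeast0LessThan)
  finally show ?thesis by (simp add: binomial_gbinomial)
qed

definition Sval :: "(nat \<Rightarrow> complex) \<Rightarrow> nat \<Rightarrow> complex" where
  "Sval s i = (if i = 0 then 1 else s (i - 1))"

lemma evc_Svar: "evc n s (Svar i) = Sval s i"
  by (simp add: Svar_def Sval_def evc_1 evc_mvar)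

definition Sser :: "(nat \<Rightarrow> complex) \<Rightarrow> complex \<Rightarrow> complex fps" where
  "Sser s c = lsum (\<lambda>i. fps_const (Sval s i) * (fps_X * geom c) ^ i)"

text \<open>At \<open>N = n\<close> the binomial series of the symbolic power becomes an honest
  \<open>n\<close>-th power; the denominator is multiplied to the left.\<close>

lemma schur_functional_equation:
  fixes n s
  defines "a \<equiv> (of_nat n + 1) / 2 :: complex" and "b \<equiv> (of_nat n - 1) / 2 :: complex"
  shows "fps_evc n s schur_rhs * Sser s a = ((1 - fps_const a * fps_X) * geom b) ^ n * Sser s b"
proof -
  let ?q = "(1 - fps_const a * fps_X) * geom b"
  define ga where "ga = lsum (\<lambda>i. if i = 0 then 0 else fps_const (Sval s i) * (fps_X * geom a) ^ i)"
  have ab: "evc n s (mconst (smult (1/2) (polyN + 1))) = a" "evc n s (mconst (smult (1/2) (polyN - 1))) = b"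
    by (simp_all add: evc_mconst polyN_def a_def b_def)
  have ga: "Sser s a = 1 + ga"
  proof (rule fps_ext)
    fix k
    show "fps_nth (Sser s a) k = fps_nth (1 + ga) k"
      unfolding Sser_def ga_def lsum_def
      by (simp add: sum.atMost_shift Sval_def)
  qed
  have q: "fps_nth (?q - 1) 0 = 0" by (simp add: geom_def)
  have pw: "fps_evc n s (powN1p g) = (1 + fps_evc n s g) ^ n" if "fps_nth (fps_evc n s g) 0 = 0" for g
    unfolding powN1p_def fps_evc_lsum fps_evc_mult fps_evc_const fps_evc_power evc_mconst poly_Nchoose
    using lsum_binomial[OF that] by simp
  have Sb: "lsum (\<lambda>i. fps_evc n s (if i = 0 then 1 else fps_const (Svar i) * (fps_X * geom (mconst (smult (1/2) (polyN - 1)))) ^ i)) = Sser s b"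
    unfolding Sser_def
    by (intro arg_cong[where f = lsum] ext)
       (simp add: fps_evc_1 fps_evc_mult fps_evc_const fps_evc_power fps_evc_X fps_evc_geom ab evc_Svar Sval_def)
  have Sa: "lsum (\<lambda>i. fps_evc n s (if i = 0 then 0 else fps_const (Svar i) * (fps_X * geom (mconst (smult (1/2) (polyN + 1)))) ^ i)) = ga"
    unfolding ga_def
    by (intro arg_cong[where f = lsum] ext)
       (simp add: fps_evc_0 fps_evc_mult fps_evc_const fps_evc_power fps_evc_X fps_evc_geom ab evc_Svar)
  have mq: "fps_evc n s ((fps_const 1 - fps_const (mconst (smult (1/2) (polyN + 1))) * fps_X) * geom (mconst (smult (1/2) (polyN - 1))) - 1) = ?q - 1"
    by (simp add: fps_evc_diff fps_evc_mult fps_evc_const fps_evc_X fps_evc_geom ab fps_evc_1 evc_1)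
  have "fps_evc n s schur_rhs = ?q ^ n * Sser s b * inv1p ga"
    unfolding schur_rhs_def Let_def fps_evc_mult fps_evc_inv1p fps_evc_lsum Sa Sb
    using q by (subst pw) (simp_all only: mq, simp)
  moreover have "(1 + ga) * inv1p ga = 1"
    by (rule inv1p_inverse) (simp add: ga_def lsum_def)
  ultimately show ?thesis unfolding ga by (metis mult.assoc mult.commute mult_1_right)
qed

text \<open>Turns the substitution into a change of numerical values.\<close>

lemma evc_Phi: "evc n s (Phi P) = evc n (\<lambda>i. evc n s (Phi_C (i + 1))) P"
  unfolding Phi_def evc_def[of n _ P] evc_sum smon_def
  by (simp add: evc_mult evc_mconst evc_prod evc_power)

text \<open>For \<open>c = (n - 1)/2\<close> this is the functional \<open>\<sigma>\<close>; changing \<open>c\<close> translates the argument.\<close>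

definition Lfun :: "nat \<Rightarrow> (nat \<Rightarrow> complex) \<Rightarrow> complex \<Rightarrow> complex poly \<Rightarrow> complex" where
  "Lfun n s c p = polysum (\<lambda>j x. x * (if j < n - 1 then 0 else Sval s (j - (n - 1)))) (pcompose p [:c, 1:])"

lemma Lfun_add: "Lfun n s c (p + q) = Lfun n s c p + Lfun n s c q"
  unfolding Lfun_def pcompose_add by (rule polysum_add) (simp_all add: distrib_right)

lemma Lfun_smult: "Lfun n s c (smult d p) = d * Lfun n s c p"
  unfolding Lfun_def pcompose_smult
  by (subst polysum_smult) (simp_all add: polysum_def sum_distrib_left mult_ac)

lemma Lfun_0: "Lfun n s c 0 = 0" using Lfun_smult[of n s c 0 0] by simp

lemma Lfun_diff: "Lfun n s c (p - q) = Lfun n s c p - Lfun n s c q"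
  using Lfun_add[of n s c p "- q"] Lfun_smult[of n s c "-1" q] by simp

lemma Lfun_sum: "Lfun n s c (sum f A) = (\<Sum>x\<in>A. Lfun n s c (f x))"
  by (induction A rule: infinite_finite_induct) (simp_all add: Lfun_0 Lfun_add)

lemma Lfun_pcompose: "Lfun n s c (pcompose p [:d, 1:]) = Lfun n s (c + d) p"
proof -
  have "pcompose [:d, 1:] [:c, 1:] = [:c + d, 1:]" by (simp add: pcompose_pCons add.commute)
  thus ?thesis unfolding Lfun_def by (simp add: pcompose_assoc[symmetric])
qed

lemma Lfun_expand: "Lfun n s c p = polysum (\<lambda>k x. x * Lfun n s c (monom 1 k)) p"
proof -
  have "Lfun n s c p = Lfun n s c (\<Sum>k\<le>degree p. smult (coeff p k) (monom 1 k))"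
    by (simp add: smult_monom poly_as_sum_of_monoms)
  thus ?thesis by (simp add: Lfun_sum Lfun_smult polysum_def)
qed

text \<open>The expansion of \<open>u^j / (1 - c u)^(j+1)\<close>; multiplying by
  \<open>1 - c u\<close> gives Pascal's rule.\<close>

lemma geom_X_power_nth: "fps_nth (geom c * (fps_X * geom c) ^ j) k = of_nat (k choose j) * c ^ (k - j)"
  for c :: complex
proof (induction j arbitrary: k)
  case 0
  show ?case by (simp add: geom_def)
next
  case (Suc j)
  let ?G = "\<lambda>j. geom c * (fps_X * geom c) ^ j"
  have "(1 - fps_const c * fps_X) * ?G (Suc j) = ((1 - fps_const c * fps_X) * geom c) * (fps_X * ?G j)"
    by (simp add: mult_ac)
  hence "(1 - fps_const c * fps_X) * ?G (Suc j) = fps_X * ?G j"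
    by (simp only: geom_inverse mult_1)
  hence "?G (Suc j) - fps_const c * fps_X * ?G (Suc j) = fps_X * ?G j"
    by (simp only: mult_1 left_diff_distrib)
  hence rec: "?G (Suc j) = fps_X * ?G j + fps_const c * (fps_X * ?G (Suc j))"
    by (simp only: diff_eq_eq mult.assoc)
  show ?case
  proof (induction k)
    case 0
    show ?case by (subst rec) simp
  next
    case (Suc k)
    have "fps_nth (?G (Suc j)) (Suc k) = fps_nth (?G j) k + c * fps_nth (?G (Suc j)) k"
      by (subst rec) simp
    also have "\<dots> = of_nat (k choose j) * c ^ (k - j) + of_nat (k choose Suc j) * (c * c ^ (k - Suc j))"
      unfolding Suc.IH \<open>\<And>k. fps_nth (?G j) k = of_nat (k choose j) * c ^ (k - j)\<close> by simp
    also have "of_nat (k choose Suc j) * (c * c ^ (k - Suc j)) = of_nat (k choose Suc j) * c ^ (k - j)"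
      by (cases "Suc j \<le> k") (simp_all add: binomial_eq_0 power_Suc[symmetric] Suc_diff_Suc del: power_Suc)
    finally show ?case by (simp add: algebra_simps)
  qed
qed

text \<open>Moment generating series, that is, the functional applied to \<open>1/(1 - u z)\<close>.
  Translation by \<open>c\<close> substitutes \<open>u/(1 - c u)\<close>, and the offset
  \<open>n - 1\<close> of the functional produces the prefactor.\<close>

lemma Lfun_monom: "Lfun n s c (monom 1 k) = fps_nth (fps_X ^ (n - 1) * geom c ^ Suc (n - 1) * Sser s c) k"
proof -
  let ?h = "fps_X * geom c"
  let ?S = "\<lambda>j. if j < n - 1 then 0 else Sval s (j - (n - 1))"
  have h: "fps_nth ?h 0 = 0" by simp
  have "fps_X ^ (n - 1) * geom c ^ Suc (n - 1) * Sser s c = (geom c * ?h ^ (n - 1)) * Sser s c"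
    by (simp add: power_mult_distrib mult_ac)
  hence "fps_nth (fps_X ^ (n - 1) * geom c ^ Suc (n - 1) * Sser s c) k =
     (\<Sum>i\<le>k. Sval s i * fps_nth (geom c * ?h ^ (n - 1) * ?h ^ i) k)"
    unfolding Sser_def by (simp only: fps_mult_lsum_nth[OF h order_refl])
  also have "\<dots> = (\<Sum>i\<le>k. Sval s i * (of_nat (k choose (n - 1 + i)) * c ^ (k - (n - 1 + i))))"
    by (simp only: mult.assoc power_add[symmetric] geom_X_power_nth)
  also have "\<dots> = (\<Sum>j=n - 1..n - 1 + k. ?S j * (of_nat (k choose j) * c ^ (k - j)))"
    by (rule sum.reindex_bij_witness[of _ "\<lambda>j. j - (n - 1)" "\<lambda>i. n - 1 + i"]) auto
  also have "\<dots> = (\<Sum>j\<le>n - 1 + k. ?S j * (of_nat (k choose j) * c ^ (k - j)))"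
    by (rule sum.mono_neutral_left) auto
  also have "\<dots> = (\<Sum>j\<le>k. ?S j * (of_nat (k choose j) * c ^ (k - j)))"
    by (rule sum.mono_neutral_right) (auto simp: binomial_eq_0)
  also have "\<dots> = Lfun n s c (monom 1 k)"
  proof -
    have pc: "pcompose (monom 1 k) [:c, 1:] = [:c, 1:] ^ k"
    proof -
      have "pcompose ([:0, 1:] ^ k) q = q ^ k" for q :: "complex poly"
        by (induction k) (simp_all add: pcompose_mult pcompose_pCons pcompose_1)
      thus ?thesis by (simp add: monom_altdef)
    qed
    have "degree ([:c, 1:] ^ k) \<le> k" by (simp add: degree_linear_power)
    thus ?thesis unfolding Lfun_def pc
      by (subst polysum_bound[where M = k]) (simp_all add: coeff_linear_poly_power mult_ac)
  qed
  finally show ?thesis by simp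
qed

definition cval :: "nat \<Rightarrow> (nat \<Rightarrow> complex) \<Rightarrow> nat \<Rightarrow> complex" where
  "cval n s k = (if k = 0 then of_nat n else evc n s (Phi_C k))"

definition tauc :: "nat \<Rightarrow> (nat \<Rightarrow> complex) \<Rightarrow> complex poly \<Rightarrow> complex" where
  "tauc n s p = polysum (\<lambda>k c. c * cval n s k) p"

text \<open>\<open>Phi_C\<close> reads only the coefficients from \<open>u^2\<close> on. That the
  series really starts with \<open>1 - n u\<close> has to be computed; it makes \<open>n\<close> the
  value at index 0.\<close>

lemma schur_rhs_nth:
  "fps_nth (fps_evc n s schur_rhs) 0 = 1" "fps_nth (fps_evc n s schur_rhs) (Suc k) = - cval n s k"
proof -
  define a b :: complex where "a = (of_nat n + 1) / 2" and "b = (of_nat n - 1) / 2"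
  let ?F = "fps_evc n s schur_rhs" and ?q = "(1 - fps_const a * fps_X) * geom b"
  have eq: "?F * Sser s a = ?q ^ n * Sser s b"
    unfolding a_def b_def by (rule schur_functional_equation)
  have S0: "fps_nth (Sser s c) 0 = 1" for c by (simp add: Sser_def lsum_def Sval_def)
  have S1: "fps_nth (Sser s c) (Suc 0) = s 0" for c
    by (simp add: Sser_def lsum_def Sval_def geom_def)
  have q0: "fps_nth ?q 0 = 1" by (simp add: geom_def)
  have ab: "a = b + 1" by (simp add: a_def b_def field_simps)
  have q1: "fps_nth ?q (Suc 0) = -1"
    by (simp add: geom_def left_diff_distrib mult.assoc ab)
  have qn: "fps_nth (?q ^ n) (Suc 0) = - of_nat n"
  proof (induction n)
    case (Suc n)
    have "fps_nth (?q ^ n) 0 = 1" using q0 by (simp add: fps_power_zeroth)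
    thus ?case using Suc q0 q1 by (simp only: power_Suc fps_mult_nth_1) simp
  qed simp
  have "fps_nth (?F * Sser s a) 0 = fps_nth (?q ^ n * Sser s b) 0" by (simp only: eq)
  thus F0: "fps_nth ?F 0 = 1"
    using q0 by (simp only: fps_mult_nth_0 S0 fps_power_zeroth) simp
  have "fps_nth (?F * Sser s a) 1 = fps_nth (?q ^ n * Sser s b) 1" by (simp only: eq)
  moreover have "fps_nth (?q ^ n) 0 = 1" using q0 by (simp add: fps_power_zeroth)
  ultimately have F1: "fps_nth ?F (Suc 0) = - of_nat n"
    using qn by (simp only: fps_mult_nth_1) (simp add: S0 S1 F0)
  show "fps_nth ?F (Suc k) = - cval n s k"
    using F1 by (cases k) (simp_all add: cval_def Phi_C_def fps_evc_nth evc_uminus)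
qed

text \<open>With the prefactors of the moment series included, the \<open>n\<close>-th power in the
  Schur formula cancels completely: the series \<open>1 - n u - \<dots>\<close> times the moment
  series at \<open>b + 1\<close> is the moment series at \<open>b\<close>.\<close>

lemma Lfun_monom_recurrence:
  assumes "n \<ge> 1"
  defines "b \<equiv> (of_nat n - 1) / 2 :: complex"
  shows "(\<Sum>i<k. cval n s i * Lfun n s (b + 1) (monom 1 (k - 1 - i))) =
     Lfun n s (b + 1) (monom 1 k) - Lfun n s b (monom 1 k)"
proof -
  define a :: complex where "a = b + 1"
  let ?F = "fps_evc n s schur_rhs" and ?q = "(1 - fps_const a * fps_X) * geom b"
  let ?G = "\<lambda>c. fps_X ^ (n - 1) * geom c ^ Suc (n - 1) * Sser s c"
  have ab: "a = (of_nat n + 1) / 2" by (simp add: a_def b_def field_simps)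
  have eq: "?F * Sser s a = ?q ^ n * Sser s b"
    unfolding ab b_def by (rule schur_functional_equation)
  have n: "Suc (n - 1) = n" using assms by simp
  have "?F * ?G a = fps_X ^ (n - 1) * (geom a ^ n * (?F * Sser s a))" by (simp only: n mult_ac)
  also have "\<dots> = fps_X ^ (n - 1) * (((1 - fps_const a * fps_X) * geom a) ^ n * geom b ^ n * Sser s b)"
    unfolding eq power_mult_distrib by (simp only: mult_ac)
  also have "\<dots> = ?G b" by (simp only: geom_inverse power_one mult_1 n mult.assoc)
  finally have FG: "fps_nth (?F * ?G a) k = Lfun n s b (monom 1 k)" by (simp only: Lfun_monom)
  have "fps_nth (?F * ?G a) k = Lfun n s a (monom 1 k) - (\<Sum>i<k. cval n s i * Lfun n s a (monom 1 (k - 1 - i)))"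
  proof (cases k)
    case 0
    thus ?thesis by (simp only: fps_mult_nth_0 schur_rhs_nth Lfun_monom) simp
  next
    case (Suc k')
    have "fps_nth (?F * ?G a) k = (\<Sum>i\<le>Suc k'. fps_nth ?F i * Lfun n s a (monom 1 (Suc k' - i)))"
      unfolding Suc fps_mult_nth Lfun_monom atLeast0AtMost ..
    also have "\<dots> = Lfun n s a (monom 1 k) - (\<Sum>i\<le>k'. cval n s i * Lfun n s a (monom 1 (k' - i)))"
      unfolding sum.atMost_Suc_shift by (simp add: schur_rhs_nth Suc sum_negf)
    finally show ?thesis by (simp add: Suc lessThan_Suc_atMost)
  qed
  with FG have "Lfun n s a (monom 1 k) - (\<Sum>i<k. cval n s i * Lfun n s a (monom 1 (k - 1 - i))) = Lfun n s b (monom 1 k)"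
    by (simp only:)
  thus ?thesis unfolding a_def by (simp add: algebra_simps)
qed

text \<open>
  \<open>Bfun n s c p w\<close> applies the functional \<open>tauc\<close> in \<open>x\<close> and \<open>Lfun\<close> in \<open>z\<close> to \<open>w(z) (p(x) - p(z)) / (x - z)\<close>.
\<close>

definition Bfun :: "nat \<Rightarrow> (nat \<Rightarrow> complex) \<Rightarrow> complex \<Rightarrow> complex poly \<Rightarrow> complex poly \<Rightarrow> complex" where
  "Bfun n s c p w = polysum (\<lambda>k x. x * (\<Sum>i<k. cval n s i * Lfun n s c (monom 1 (k - 1 - i) * w))) p"

text \<open>From \<open>((d+x) p(x) - (d+z) p(z)) / (x-z) = p(x) + (d+z) (p(x) - p(z)) /
  (x-z)\<close>.\<close>

lemma Bfun_linear_factor: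
  "Bfun n s c ([:d, 1:] * p) w = tauc n s p * Lfun n s c w + Bfun n s c p ([:d, 1:] * w)"
proof -
  let ?T = "\<lambda>w k. \<Sum>i<k. cval n s i * Lfun n s c (monom 1 (k - 1 - i) * w)"
  have "Bfun n s c ([:d, 1:] * p) w = Bfun n s c (smult d p) w + Bfun n s c (pCons 0 p) w"
    unfolding Bfun_def by (subst polysum_add[symmetric]) (simp_all add: distrib_right)
  also have "Bfun n s c (smult d p) w = (\<Sum>k\<le>degree p. coeff p k * (d * ?T w k))"
    unfolding Bfun_def by (subst polysum_smult) (simp_all add: polysum_def mult_ac)
  also have "Bfun n s c (pCons 0 p) w = (\<Sum>k\<le>degree p. coeff p k * ?T w (Suc k))"
    unfolding Bfun_def by (subst polysum_pCons) (simp_all add: polysum_def)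
  also have "(\<Sum>k\<le>degree p. coeff p k * (d * ?T w k)) + (\<Sum>k\<le>degree p. coeff p k * ?T w (Suc k)) =
     (\<Sum>k\<le>degree p. coeff p k * (d * ?T w k + ?T w (Suc k)))"
    by (simp add: sum.distrib distrib_left)
  also have "\<dots> = (\<Sum>k\<le>degree p. coeff p k * (cval n s k * Lfun n s c w + ?T ([:d, 1:] * w) k))"
  proof (intro sum.cong refl arg_cong2[where f = "(*)"])
    fix k
    have "?T w (Suc k) = (\<Sum>i<k. cval n s i * Lfun n s c (monom 1 (k - i) * w)) + cval n s k * Lfun n s c w"
      by simp
    also have "(\<Sum>i<k. cval n s i * Lfun n s c (monom 1 (k - i) * w)) =
       (\<Sum>i<k. cval n s i * Lfun n s c (monom 1 (k - 1 - i) * pCons 0 w))"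
    proof (rule sum.cong[OF refl])
      fix i assume "i \<in> {..<k}"
      hence "monom 1 (k - i) = pCons 0 (monom (1::complex) (k - 1 - i))"
        by (simp add: monom_Suc[symmetric] Suc_diff_Suc)
      thus "cval n s i * Lfun n s c (monom 1 (k - i) * w) = cval n s i * Lfun n s c (monom 1 (k - 1 - i) * pCons 0 w)"
        by simp
    qed
    finally have "d * ?T w k + ?T w (Suc k) = cval n s k * Lfun n s c w +
       (\<Sum>i<k. cval n s i * (d * Lfun n s c (monom 1 (k - 1 - i) * w) + Lfun n s c (monom 1 (k - 1 - i) * pCons 0 w)))"
      by (simp add: sum.distrib sum_distrib_left distrib_left mult_ac)
    also have "(\<Sum>i<k. cval n s i * (d * Lfun n s c (monom 1 (k - 1 - i) * w) + Lfun n s c (monom 1 (k - 1 - i) * pCons 0 w)))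
      = ?T ([:d, 1:] * w) k"
    proof (intro sum.cong refl arg_cong2[where f = "(*)"])
      fix i
      have "monom 1 (k - 1 - i) * ([:d, 1:] * w) = smult d (monom 1 (k - 1 - i) * w) + monom 1 (k - 1 - i) * pCons 0 w"
        by (simp add: distrib_left)
      thus "d * Lfun n s c (monom 1 (k - 1 - i) * w) + Lfun n s c (monom 1 (k - 1 - i) * pCons 0 w) =
         Lfun n s c (monom 1 (k - 1 - i) * ([:d, 1:] * w))"
        by (simp only: Lfun_add Lfun_smult)
    qed
    finally show "d * ?T w k + ?T w (Suc k) = cval n s k * Lfun n s c w + ?T ([:d, 1:] * w) k" .
  qed
  also have "\<dots> = tauc n s p * Lfun n s c w + Bfun n s c p ([:d, 1:] * w)"
    unfolding tauc_def Bfun_def polysum_def by (simp add: distrib_left sum.distrib sum_distrib_left mult_ac)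
  finally show ?thesis .
qed

definition shifted :: "complex \<Rightarrow> nat \<Rightarrow> nat \<Rightarrow> complex poly" where
  "shifted c J M = (\<Prod>t=J..<M. [:c + of_nat t, 1:])"

lemma shifted_0: "shifted c M M = 1" by (simp add: shifted_def)

lemma shifted_Suc_right: "J \<le> M \<Longrightarrow> shifted c J (Suc M) = [:c + of_nat M, 1:] * shifted c J M"
  by (simp add: shifted_def prod.atLeastLessThan_Suc mult.commute)

lemma shifted_Suc_left: "J < M \<Longrightarrow> shifted c J M = [:c + of_nat J, 1:] * shifted c (Suc J) M"
  unfolding shifted_def by (rule prod.atLeast_Suc_lessThan)

lemma shifted_translate: "shifted c (k + J) (k + M) = shifted (c + of_nat k) J M"
  unfolding shifted_def
  by (rule prod.reindex_bij_witness[of _ "\<lambda>t. k + t" "\<lambda>t. t - k"]) (auto simp: algebra_simps of_nat_diff)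

lemma pcompose_shifted: "pcompose (shifted c J M) [:d, 1:] = shifted (c + d) J M"
  unfolding shifted_def pcompose_prod by (simp add: pcompose_pCons add_ac)

lemma Bfun_shifted:
  "Bfun n s c (shifted d 0 M) 1 = (\<Sum>J<M. tauc n s (shifted d (Suc J) M) * Lfun n s c (shifted d 0 J))"
proof -
  \<comment> \<open>\<open>K\<close> linear factors have been moved from \<open>p\<close> to the
    weight \<open>w\<close>; when all are moved the remaining divided difference is that of a
    constant.\<close>
  have "K \<le> M \<Longrightarrow> Bfun n s c (shifted d 0 M) 1 = (\<Sum>J<K. tauc n s (shifted d (Suc J) M) * Lfun n s c (shifted d 0 J))
      + Bfun n s c (shifted d K M) (shifted d 0 K)" for K
  proof (induction K)
    case 0
    show ?case by (simp add: shifted_0)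
  next
    case (Suc K)
    hence K: "K < M" by simp
    show ?case
      using Suc by (simp add: shifted_Suc_left[OF K] Bfun_linear_factor shifted_Suc_right del: mult_pCons_left)
  qed
  from this[of M] show ?thesis by (simp add: shifted_0 Bfun_def polysum_def)
qed

lemma Lfun_low_degree:
  assumes "degree p < n - 1"
  shows "Lfun n s c p = 0"
proof -
  have "degree (pcompose p [:c, 1:]) \<le> degree p" using degree_pcompose_le[of p "[:c, 1:]"] by simp
  thus ?thesis unfolding Lfun_def polysum_def using assms by (intro sum.neutral) auto
qed

lemma degree_shifted: "degree (shifted c 0 J) = J"
  unfolding shifted_def by (subst degree_prod_eq_sum_degree) auto

lemma monic_shifted: "lead_coeff (shifted c 0 J) = 1"
  unfolding shifted_def lead_coeff_prod by simp

definition zeta :: "nat \<Rightarrow> (nat \<Rightarrow> complex) \<Rightarrow> nat \<Rightarrow> complex" where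
  "zeta n s j = Lfun n s ((of_nat n - 1) / 2) (shifted (1 - of_nat n) 0 (n - 1 + j))"

text \<open>The product is monic of degree \<open>n - 1\<close>, the lowest degree that the
  functional sees, and there its value is \<open>S_0 = 1\<close>.\<close>

lemma zeta_0: "zeta n s 0 = 1"
proof -
  let ?b = "(of_nat n - 1) / 2 :: complex"
  let ?p = "shifted (1 - of_nat n + ?b) 0 (n - 1)"
  have "zeta n s 0 = polysum (\<lambda>j x. x * (if j < n - 1 then 0 else Sval s (j - (n - 1)))) ?p"
    unfolding zeta_def Lfun_def pcompose_shifted by simp
  also have "\<dots> = (\<Sum>j\<le>n - 1. if j = n - 1 then 1 else 0)"
    unfolding polysum_def degree_shifted
    using monic_shifted[of "1 - of_nat n + ?b" "n - 1"]
    by (intro sum.cong refl) (auto simp: degree_shifted Sval_def)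
  finally show ?thesis by simp
qed

text \<open>The difference equation is applied to a product of \<open>n + m\<close> consecutive
  linear factors. Translation by one exchanges only an end factor, so the difference is
  \<open>n + m\<close> times a shorter product; the divided difference on the other side gives the
  sum.\<close>

lemma zeta_newton:
  assumes "n \<ge> 1"
  shows "of_nat (n + m) * zeta n s m = (\<Sum>j\<le>m. tauc n s (rising j m) * zeta n s j)"
proof -
  define b :: complex where "b = (of_nat n - 1) / 2"
  define M where "M = n + m"
  let ?d = "- of_nat n :: complex"
  let ?L = "\<lambda>J. Lfun n s b (shifted (1 - of_nat n) 0 J)"
  have sh: "Lfun n s (b + 1) (shifted ?d 0 J) = ?L J" for J
  proof -
    have "?d + 1 = 1 - of_nat n" by simp
    thus ?thesis using Lfun_pcompose[of n s b "shifted ?d 0 J" 1] by (simp only: pcompose_shifted)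
  qed
  have M: "Suc (M - 1) = M" using assms by (simp add: M_def)
  have B: "Bfun n s (b + 1) p 1 = Lfun n s (b + 1) p - Lfun n s b p" for p
    unfolding Bfun_def Lfun_expand[of n s _ p] polysum_def mult_1_right
    using Lfun_monom_recurrence[OF assms, of s, folded b_def]
    by (simp add: sum_subtractf[symmetric] right_diff_distrib)
  have "Lfun n s (b + 1) (shifted ?d 0 M) - Lfun n s b (shifted ?d 0 M) = of_nat M * ?L (M - 1)"
  proof -
    have 1: "shifted (1 - of_nat n) 0 M = [:1 - of_nat n + of_nat (M - 1), 1:] * shifted (1 - of_nat n) 0 (M - 1)"
      using shifted_Suc_right[of 0 "M - 1" "1 - of_nat n"] M by simp
    have 2: "shifted ?d 0 M = [:?d, 1:] * shifted (1 - of_nat n) 0 (M - 1)"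
    proof -
      have "shifted ?d 0 M = [:?d, 1:] * shifted ?d (1 + 0) (1 + (M - 1))"
        using shifted_Suc_left[of 0 M ?d] M by simp
      also have "shifted ?d (1 + 0) (1 + (M - 1)) = shifted (1 - of_nat n) 0 (M - 1)"
        using shifted_translate[of ?d 1 0 "M - 1"] by (simp add: add.commute)
      finally show ?thesis .
    qed
    have oM: "of_nat M = 1 + (of_nat (M - 1) :: complex)" using M by (metis of_nat_Suc)
    have "shifted (1 - of_nat n) 0 M - shifted ?d 0 M = smult (of_nat M) (shifted (1 - of_nat n) 0 (M - 1))"
      unfolding 1 2 left_diff_distrib[symmetric] oM by (simp add: algebra_simps)
    hence "Lfun n s b (shifted (1 - of_nat n) 0 M - shifted ?d 0 M) = of_nat M * ?L (M - 1)"
      by (simp only: Lfun_smult)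
    thus ?thesis by (simp only: sh Lfun_diff)
  qed
  hence "of_nat M * ?L (M - 1) = (\<Sum>J<M. tauc n s (shifted ?d (Suc J) M) * ?L J)"
    using Bfun_shifted[of n s "b + 1" ?d M] by (simp only: B sh)
  \<comment> \<open>Products with fewer than \<open>n - 1\<close> factors are annihilated by the
    functional; the first surviving one is \<open>zeta n s 0\<close>.\<close>
  also have "\<dots> = (\<Sum>J=n - 1..<M. tauc n s (shifted ?d (Suc J) M) * ?L J)"
  proof (rule sum.mono_neutral_right)
    show "\<forall>J\<in>{..<M} - {n - 1..<M}. tauc n s (shifted ?d (Suc J) M) * ?L J = 0"
      by (auto intro!: Lfun_low_degree simp: degree_shifted)
  qed auto
  also have "\<dots> = (\<Sum>j\<le>m. tauc n s (shifted ?d (n + j) (n + m)) * ?L (n - 1 + j))"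
    by (rule sum.reindex_bij_witness[of _ "\<lambda>j. n - 1 + j" "\<lambda>J. J - (n - 1)"])
       (use assms in \<open>auto simp: M_def\<close>)
  also have "\<dots> = (\<Sum>j\<le>m. tauc n s (rising j m) * zeta n s j)"
    unfolding shifted_translate by (simp add: shifted_def rising_def zeta_def b_def)
  finally show ?thesis using assms by (simp add: M_def zeta_def b_def)
qed

lemma evc_zhat:
  assumes "n \<ge> 1"
  shows "evc n (\<lambda>i. evc n s (Phi_C (i + 1))) (zhat m) = zeta n s m"
proof (induction m rule: less_induct)
  case (less m)
  let ?e = "evc n (\<lambda>i. evc n s (Phi_C (i + 1)))"
  show ?case
  proof (cases "m = 0")
    case True
    thus ?thesis by (simp add: zhat.simps evc_1 zeta_0)
  next
    case False
    have C: "?e (Chat k) = cval n s k" for k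
      by (simp add: Chat_def cval_def evc_mconst evc_mvar polyN_def)
    have tau: "?e (tauC p) = tauc n s p" for p
      unfolding tauC_def tauc_def polysum_def
      by (simp only: evc_sum evc_mult evc_mconst C) simp
    have "tauc n s 1 = of_nat n" by (simp add: tauc_def polysum_def cval_def)
    hence "of_nat (n + m) * zeta n s m = (\<Sum>j<m. tauc n s (rising j m) * zeta n s j) + of_nat n * zeta n s m"
      unfolding zeta_newton[OF assms] by (simp add: lessThan_Suc_atMost[symmetric] rising_self)
    hence "of_nat m * zeta n s m = (\<Sum>j<m. tauc n s (rising j m) * zeta n s j)"
      by (simp add: distrib_right)
    moreover have "?e (zhat m) = 1 / of_nat m * (\<Sum>j<m. tauc n s (rising j m) * zeta n s j)"
    proof -
      have "?e (zhat m) = 1 / of_nat m * (\<Sum>j<m. ?e (tauC (rising j m)) * ?e (zhat j))"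
        using False by (subst zhat.simps) (simp add: evc_mult evc_mconst evc_sum)
      also have "\<dots> = 1 / of_nat m * (\<Sum>j<m. tauc n s (rising j m) * zeta n s j)"
        unfolding tau using less by (intro arg_cong2[where f = "(*)"] sum.cong refl) simp
      finally show ?thesis .
    qed
    ultimately have "?e (zhat m) = 1 / of_nat m * (of_nat m * zeta n s m)" by (simp only:)
    thus ?thesis using False by simp
  qed
qed

subsection \<open>Generating functions\<close>

definition wser :: "complex fps" where "wser = 1 - fps_exp (-1)"

lemma wser_0: "fps_nth wser 0 = 0" by (simp add: wser_def)

text \<open>As \<open>wser\<close> has derivative \<open>1 - wser\<close>, differentiating its
  powers reproduces the Stirling recursion.\<close>

lemma wser_power_nth: "fps_nth (wser ^ k) m = signed_stirling m k * fact k / fact m"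
proof (induction k arbitrary: m)
  case 0
  show ?case by (cases m) simp_all
next
  case (Suc k)
  have d: "fps_deriv wser = 1 - wser"
    by (simp add: wser_def fps_const_neg[symmetric] del: fps_const_neg)
  have "fps_deriv (wser ^ Suc k) = of_nat (Suc k) * fps_deriv wser * wser ^ k"
    using fps_deriv_power'[of wser "Suc k"] by (simp only: diff_Suc_1)
  hence D: "fps_deriv (wser ^ Suc k) = of_nat (Suc k) * (wser ^ k - wser ^ Suc k)"
    unfolding d by (simp only: power_Suc left_diff_distrib mult_1 mult.assoc)
  show ?case
  proof (induction m)
    case 0
    show ?case by (simp add: wser_0)
  next
    case (Suc m)
    have "of_nat (Suc m) * fps_nth (wser ^ Suc k) (Suc m) = fps_nth (fps_deriv (wser ^ Suc k)) m"
      by (simp only: fps_deriv_nth Suc_eq_plus1)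
    also have "\<dots> = of_nat (Suc k) * (fps_nth (wser ^ k) m - fps_nth (wser ^ Suc k) m)"
      unfolding D by (simp only: fps_of_nat[symmetric] fps_mult_left_const_nth fps_sub_nth)
    also have "\<dots> = of_nat (Suc k) * (signed_stirling m k * fact k / fact m - signed_stirling m (Suc k) * fact (Suc k) / fact m)"
      by (simp only: Suc.IH \<open>\<And>m. fps_nth (wser ^ k) m = signed_stirling m k * fact k / fact m\<close>)
    also have "\<dots> = signed_stirling (Suc m) (Suc k) * fact (Suc k) / fact m"
      by (simp add: field_simps)
    finally have "of_nat (Suc m) * fps_nth (wser ^ Suc k) (Suc m) = signed_stirling (Suc m) (Suc k) * fact (Suc k) / fact m" .
    hence "fps_nth (wser ^ Suc k) (Suc m) = signed_stirling (Suc m) (Suc k) * fact (Suc k) / fact m / of_nat (Suc m)"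
      by (metis nonzero_mult_div_cancel_left of_nat_neq_0)
    also have "\<dots> = signed_stirling (Suc m) (Suc k) * fact (Suc k) / fact (Suc m)"
      by (simp only: fact_Suc divide_divide_eq_left mult.commute)
    finally show ?case .
  qed
qed

lemma power_eq_sum_shifted: "[:c, 1:] ^ M = (\<Sum>K\<le>M. smult (signed_stirling M K) (shifted c 0 K))"
proof (induction M)
  case 0
  show ?case by (simp add: shifted_0)
next
  case (Suc M)
  have step: "[:c, 1:] * shifted c 0 K = shifted c 0 (Suc K) - smult (of_nat K) (shifted c 0 K)" for K
    by (simp add: shifted_Suc_right smult_add_left)
  have "[:c, 1:] ^ Suc M = (\<Sum>K\<le>M. smult (signed_stirling M K) ([:c, 1:] * shifted c 0 K))"
    unfolding power_Suc Suc.IH sum_distrib_left by (simp only: mult_smult_right)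
  also have "\<dots> = (\<Sum>K\<le>M. smult (signed_stirling M K) (shifted c 0 (Suc K))) - (\<Sum>K\<le>M. smult (of_nat K * signed_stirling M K) (shifted c 0 K))"
    unfolding step smult_diff_right sum_subtractf by (simp add: mult.commute)
  also have "\<dots> = (\<Sum>K\<le>Suc M. smult (signed_stirling (Suc M) K) (shifted c 0 K))"
    by (rule sum_signed_stirling_Suc[symmetric]) (simp_all add: smult_diff_left)
  finally show ?case .
qed

text \<open>Its coefficient at \<open>t^m\<close> is the value of \<open>Phi (A_elem m)\<close>
  divided by \<open>(n - 1 + m)!\<close>.\<close>

definition Aseries :: "nat \<Rightarrow> (nat \<Rightarrow> complex) \<Rightarrow> complex fps" where
  "Aseries n s = lsum (\<lambda>k. fps_const (zeta n s k / fact (n - 1 + k)) * wser ^ k)"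

definition Sseries :: "nat \<Rightarrow> (nat \<Rightarrow> complex) \<Rightarrow> complex fps" where
  "Sseries n s = Abs_fps (\<lambda>i. Sval s i / fact (n - 1 + i))"

text \<open>Both sides are the exponential generating series of \<open>Lfun n s 0\<close> at the
  powers of \<open>y - b\<close>: on the left these are expanded in products
  \<open>shifted (- b) 0 K\<close>, on the right by the binomial theorem.\<close>

lemma wser_power_Aseries:
  assumes "n \<ge> 1"
  defines "b \<equiv> (of_nat n - 1) / 2 :: complex"
  shows "wser ^ (n - 1) * Aseries n s = fps_exp (- b) * (fps_X ^ (n - 1) * Sseries n s)"
proof (rule fps_ext)
  fix M
  let ?S = "\<lambda>j. if j < n - 1 then 0 else Sval s (j - (n - 1))"
  let ?L = "\<lambda>K. Lfun n s 0 (shifted (- b) 0 K)"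
  have zl: "zeta n s k = ?L (n - 1 + k)" for k
  proof -
    have "zeta n s k = Lfun n s 0 (pcompose (shifted (1 - of_nat n) 0 (n - 1 + k)) [:b, 1:])"
      unfolding zeta_def Lfun_pcompose b_def by simp
    also have "pcompose (shifted (1 - of_nat n) 0 (n - 1 + k)) [:b, 1:] = shifted (- b) 0 (n - 1 + k)"
    proof -
      have "1 - of_nat n + b = - b" by (simp add: b_def field_simps)
      thus ?thesis by (simp only: pcompose_shifted)
    qed
    finally show ?thesis .
  qed
  have "fps_nth (wser ^ (n - 1) * Aseries n s) M =
     (\<Sum>k\<le>M. zeta n s k / fact (n - 1 + k) * fps_nth (wser ^ (n - 1) * wser ^ k) M)"
    unfolding Aseries_def by (rule fps_mult_lsum_nth[OF wser_0 order_refl])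
  also have "\<dots> = (\<Sum>k\<le>M. ?L (n - 1 + k) * signed_stirling M (n - 1 + k) / fact M)"
    by (simp add: power_add[symmetric] wser_power_nth zl)
  also have "\<dots> = (\<Sum>K=n - 1..n - 1 + M. ?L K * signed_stirling M K / fact M)"
    by (rule sum.reindex_bij_witness[of _ "\<lambda>K. K - (n - 1)" "\<lambda>k. n - 1 + k"]) auto
  also have "\<dots> = (\<Sum>K\<le>n - 1 + M. ?L K * signed_stirling M K / fact M)"
    by (rule sum.mono_neutral_left) (auto simp: Lfun_low_degree degree_shifted)
  also have "\<dots> = (\<Sum>K\<le>M. ?L K * signed_stirling M K / fact M)"
    by (rule sum.mono_neutral_right) (auto simp: signed_stirling_eq_0)
  also have "\<dots> = Lfun n s 0 ([:- b, 1:] ^ M) / fact M"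
    unfolding power_eq_sum_shifted[of "- b"] Lfun_sum Lfun_smult by (simp add: sum_divide_distrib mult.commute)
  also have "Lfun n s 0 ([:- b, 1:] ^ M) = (\<Sum>j\<le>M. of_nat (M choose j) * (- b) ^ (M - j) * ?S j)"
  proof -
    have "pcompose p [:0, 1:] = p" for p :: "complex poly" by (rule pcompose_idR)
    moreover have "degree ([:- b, 1:] ^ M) \<le> M" by (simp add: degree_linear_power)
    ultimately show ?thesis unfolding Lfun_def
      by (simp only:, subst polysum_bound[where M = M]) (simp_all add: coeff_linear_poly_power)
  qed
  also have "\<dots> / fact M = (\<Sum>j\<le>M. (- b) ^ (M - j) / fact (M - j) * (?S j / fact j))"
    unfolding sum_divide_distrib by (intro sum.cong refl) (simp add: binomial_fact)
  also have "\<dots> = (\<Sum>j=0..M. fps_nth (fps_X ^ (n - 1) * Sseries n s) j * fps_nth (fps_exp (- b)) (M - j))"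
    unfolding atLeast0AtMost
    by (intro sum.cong refl) (auto simp: fps_X_power_mult_nth Sseries_def mult_ac)
  also have "\<dots> = fps_nth (fps_exp (- b) * (fps_X ^ (n - 1) * Sseries n s)) M"
    unfolding fps_mult_nth[symmetric] by (simp only: mult.commute)
  finally show "fps_nth (wser ^ (n - 1) * Aseries n s) M = fps_nth (fps_exp (- b) * (fps_X ^ (n - 1) * Sseries n s)) M" .
qed

section \<open>The series of sinh and its powers\<close>

definition hcoef :: "nat \<Rightarrow> complex" where
  "hcoef j = 1 / (4 ^ j * fact (2 * j + 1))"

text \<open>\<open>sinh(t/2)/(t/2)\<close> as a series in \<open>z = t^2\<close>.\<close>

definition Hser :: "complex fps" where "Hser = Abs_fps hcoef"

lemma sinh_series: "fps_exp (1/2) * wser = fps_X * (Hser oo fps_X ^ 2)"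
proof (rule fps_ext)
  fix m
  have "fps_exp (1/2) * wser = fps_exp (1/2) - fps_exp (- 1/2 :: complex)"
    using fps_exp_add_mult[of "1/2 :: complex" "-1"] by (simp add: wser_def algebra_simps)
  hence l: "fps_nth (fps_exp (1/2) * wser) m = ((1/2) ^ m - (- 1/2) ^ m) / fact m"
    by (simp add: diff_divide_distrib)
  show "fps_nth (fps_exp (1/2) * wser) m = fps_nth (fps_X * (Hser oo fps_X ^ 2)) m"
  proof (cases m)
    case 0
    thus ?thesis by (simp add: wser_0)
  next
    case (Suc k)
    show ?thesis
    proof (cases "even k")
      case True
      then obtain j where j: "k = 2 * j" by (elim evenE)
      have "fps_nth (fps_X * (Hser oo fps_X ^ 2)) m = hcoef j"
        by (simp add: Suc j fps_nth_compose_X_power Hser_def)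
      also have "\<dots> = ((1/2) ^ m - (- 1/2) ^ m) / fact m"
      proof -
        have "(- 1/2 :: complex) ^ m = - ((1/2) ^ m)"
          using j Suc by (simp add: power_minus_odd[of m "1/2", simplified])
        moreover have "(1/2 :: complex) ^ m = 1 / (2 * 4 ^ j)"
          by (simp add: Suc j power_mult power_divide)
        ultimately show ?thesis by (simp add: hcoef_def Suc j)
      qed
      finally show ?thesis by (simp only: l)
    next
      case False
      hence ev: "even m" using Suc by simp
      have "(- 1/2 :: complex) ^ m = (1/2) ^ m"
        using power_minus_even[OF ev, of "1/2 :: complex"] by simp
      hence "fps_nth (fps_exp (1/2) * wser) m = 0" unfolding l by simp
      moreover have "fps_nth (fps_X * (Hser oo fps_X ^ 2)) m = 0"
        using False by (simp add: Suc fps_nth_compose_X_power)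
      ultimately show ?thesis by (simp only:)
    qed
  qed
qed

text \<open>
  \<open>gpoly k\<close> is the coefficient of \<open>z^k\<close> in \<open>H(z)^(1-N)\<close>, computed from the logarithmic derivative.
\<close>

fun gpoly :: "nat \<Rightarrow> complex poly" where
  "gpoly k = (if k = 0 then 1 else smult (- 1 / of_nat k)
     (\<Sum>j<k. smult (hcoef (k - j)) ([:of_nat j - of_nat (k - j), of_nat (k - j):] * gpoly j)))"

declare gpoly.simps [simp del]

lemma gpoly_0: "gpoly 0 = 1" by (simp add: gpoly.simps)

lemma hcoef_0: "hcoef 0 = 1" by (simp add: hcoef_def)

lemma hcoef_1: "hcoef (Suc 0) = 1 / 24"
  by (simp add: hcoef_def fact_numeral)

lemma degree_gpoly_le: "degree (gpoly k) \<le> k"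
proof (induction k rule: less_induct)
  case (less k)
  show ?case
  proof (cases "k = 0")
    case False
    have "degree ([:of_nat j - of_nat (k - j), of_nat (k - j):] * gpoly j) \<le> k" if "j < k" for j
    proof -
      have "degree ([:of_nat j - of_nat (k - j), of_nat (k - j):] * gpoly j) \<le> 1 + degree (gpoly j)"
        by (rule order_trans[OF degree_mult_le]) (simp add: degree_pCons_le)
      thus ?thesis using less[OF that] that by simp
    qed
    thus ?thesis using False
      by (subst gpoly.simps)
         (auto intro!: order_trans[OF degree_smult_le] degree_sum_le simp del: mult_pCons_left smult_pCons)
  qed (simp add: gpoly_0)
qed

text \<open>To leading order in \<open>N\<close> the series \<open>H(z)^(1-N)\<close> behaves like
  \<open>exp(- N z / 24)\<close>, where \<open>1/24\<close> is the linear coefficient of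
  \<open>H\<close>. In the recursion only the last summand reaches the top degree.\<close>

lemma coeff_gpoly: "coeff (gpoly k) k = (- 1 / 24) ^ k / fact k"
proof (induction k)
  case 0
  show ?case by (simp add: gpoly_0)
next
  case (Suc k)
  let ?q = "\<lambda>j. [:of_nat j - of_nat (Suc k - j), of_nat (Suc k - j):] :: complex poly"
  have low: "coeff (?q j * gpoly j) (Suc k) = 0" if "j < k" for j
  proof (rule coeff_eq_0)
    have "degree (?q j * gpoly j) \<le> 1 + degree (gpoly j)"
      by (rule order_trans[OF degree_mult_le]) (simp add: degree_pCons_le)
    thus "degree (?q j * gpoly j) < Suc k" using degree_gpoly_le[of j] that by simp
  qed
  have top: "coeff (?q k * gpoly k) (Suc k) = coeff (gpoly k) k"
    using degree_gpoly_le[of k] by (simp add: coeff_eq_0)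
  have "coeff (gpoly (Suc k)) (Suc k) = - 1 / of_nat (Suc k) * (\<Sum>j<Suc k. hcoef (Suc k - j) * coeff (?q j * gpoly j) (Suc k))"
    by (subst gpoly.simps) (simp add: coeff_sum del: mult_pCons_left of_nat_Suc sum.lessThan_Suc)
  also have "(\<Sum>j<Suc k. hcoef (Suc k - j) * coeff (?q j * gpoly j) (Suc k)) = 1 / 24 * coeff (gpoly k) k"
  proof -
    have "(\<Sum>j<k. hcoef (Suc k - j) * coeff (?q j * gpoly j) (Suc k)) = 0"
      by (intro sum.neutral ballI) (simp only: low lessThan_iff mult_zero_right)
    thus ?thesis by (simp only: sum.lessThan_Suc top add_0) (simp add: hcoef_1)
  qed
  finally show ?case unfolding Suc by (simp add: field_simps)
qed

lemma degree_gpoly: "degree (gpoly k) = k"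
proof (rule antisym[OF degree_gpoly_le])
  show "k \<le> degree (gpoly k)" by (rule le_degree) (simp add: coeff_gpoly)
qed

definition Gser :: "nat \<Rightarrow> complex fps" where
  "Gser n = Abs_fps (\<lambda>k. poly (gpoly k) (of_nat n))"

lemma Hser_Gser_ode:
  assumes "n \<ge> 1"
  shows "Hser * fps_deriv (Gser n) = - (of_nat (n - 1) * (fps_deriv Hser * Gser n))"
proof (rule fps_ext)
  fix k
  let ?g = "\<lambda>j. poly (gpoly j) (of_nat n)" and ?v = "of_nat (n - 1) :: complex"
  have v: "of_nat n = ?v + 1" using assms by (metis Suc_diff_1 Suc_le_eq One_nat_def of_nat_Suc add.commute)
  have "of_nat (Suc k) * ?g (Suc k) = - (\<Sum>j<Suc k. hcoef (Suc k - j) * ((of_nat j + ?v * of_nat (Suc k - j)) * ?g j))"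
  proof -
    have "?g (Suc k) = - 1 / of_nat (Suc k) * (\<Sum>j<Suc k. hcoef (Suc k - j) * ((of_nat j + ?v * of_nat (Suc k - j)) * ?g j))"
      by (subst gpoly.simps)
         (simp add: poly_sum v algebra_simps del: of_nat_Suc sum.lessThan_Suc)
    thus ?thesis by (simp add: field_simps del: of_nat_Suc sum.lessThan_Suc)
  qed
  also have "(\<Sum>j<Suc k. hcoef (Suc k - j) * ((of_nat j + ?v * of_nat (Suc k - j)) * ?g j)) =
     (\<Sum>j<Suc k. hcoef (Suc k - j) * (of_nat j * ?g j)) + ?v * (\<Sum>j<Suc k. of_nat (Suc k - j) * hcoef (Suc k - j) * ?g j)"
    unfolding sum_distrib_left sum.distrib[symmetric] by (intro sum.cong refl) (simp only: distrib_left distrib_right mult_ac)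
  finally have c: "of_nat (Suc k) * ?g (Suc k) = - ((\<Sum>j<Suc k. hcoef (Suc k - j) * (of_nat j * ?g j))
     + ?v * (\<Sum>j<Suc k. of_nat (Suc k - j) * hcoef (Suc k - j) * ?g j))" .
  have aux: "x = - (A + V) \<Longrightarrow> 1 * x + A = - V" for x A V :: complex by simp
  have rec: "hcoef 0 * (of_nat (Suc k) * ?g (Suc k)) + (\<Sum>j<Suc k. hcoef (Suc k - j) * (of_nat j * ?g j)) =
     - (?v * (\<Sum>j<Suc k. of_nat (Suc k - j) * hcoef (Suc k - j) * ?g j))"
    unfolding hcoef_0 by (rule aux[OF c])
  have "fps_nth (Hser * fps_deriv (Gser n)) k = (\<Sum>j\<le>k. hcoef (k - j) * (of_nat (Suc j) * ?g (Suc j)))"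
    unfolding mult.commute[of Hser] fps_mult_nth atLeast0AtMost
    by (simp add: Hser_def Gser_def mult_ac)
  also have "\<dots> = (\<Sum>j\<le>Suc k. hcoef (Suc k - j) * (of_nat j * ?g j))"
    by (simp add: sum.atMost_Suc_shift del: sum.atMost_Suc of_nat_Suc)
  also have "\<dots> = hcoef 0 * (of_nat (Suc k) * ?g (Suc k)) + (\<Sum>j<Suc k. hcoef (Suc k - j) * (of_nat j * ?g j))"
    by (simp add: lessThan_Suc_atMost[symmetric])
  also note rec
  also have "(\<Sum>j<Suc k. of_nat (Suc k - j) * hcoef (Suc k - j) * ?g j) = fps_nth (fps_deriv Hser * Gser n) k"
    unfolding mult.commute[of "fps_deriv Hser"] fps_mult_nth atLeast0AtMost lessThan_Suc_atMost
    by (intro sum.cong refl) (simp add: Hser_def Gser_def Suc_diff_le mult_ac)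
  finally show "fps_nth (Hser * fps_deriv (Gser n)) k = fps_nth (- (of_nat (n - 1) * (fps_deriv Hser * Gser n))) k"
    by (simp only: fps_of_nat[symmetric] fps_mult_left_const_nth fps_neg_nth)
qed

text \<open>By the differential equation the product has derivative zero, and its constant term is
  1.\<close>

lemma Hser_power_Gser:
  assumes "n \<ge> 1"
  shows "Hser ^ (n - 1) * Gser n = 1"
proof -
  let ?v = "n - 1" and ?P = "Hser ^ (n - 1) * Gser n"
  have H0: "fps_nth Hser 0 = 1" by (simp add: Hser_def hcoef_0)
  hence nz: "Hser \<noteq> 0" by auto
  have "Hser * fps_deriv (Hser ^ k) = of_nat k * fps_deriv Hser * Hser ^ k" for k
  proof (cases k)
    case (Suc j)
    have "fps_deriv (Hser ^ Suc j) = of_nat (Suc j) * fps_deriv Hser * Hser ^ j"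
      using fps_deriv_power'[of Hser "Suc j"] by (simp only: diff_Suc_1)
    thus ?thesis unfolding Suc by (simp only: power_Suc mult_ac)
  qed simp
  hence "Hser * fps_deriv ?P = Hser ^ ?v * (of_nat ?v * (fps_deriv Hser * Gser n) + Hser * fps_deriv (Gser n))"
    by (simp add: algebra_simps)
  also have "\<dots> = 0" unfolding Hser_Gser_ode[OF assms] by simp
  finally have "fps_deriv ?P = 0" using nz by simp
  hence "?P = fps_const (fps_nth ?P 0)" by (simp only: fps_deriv_eq_0_iff)
  moreover have "fps_nth ?P 0 = 1" using H0 by (simp add: fps_power_zeroth Gser_def gpoly_0)
  ultimately show ?thesis by simp
qed

lemma Aseries_nth:
  assumes "n \<ge> 1"
  shows "fps_nth (Aseries n s) m = (\<Sum>k\<le>m div 2. poly (gpoly k) (of_nat n) * (Sval s (m - 2 * k) / fact (n - 1 + (m - 2 * k))))"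
proof -
  define b :: complex where "b = (of_nat n - 1) / 2"
  let ?h = "Hser oo fps_X ^ 2" and ?g = "Gser n oo fps_X ^ 2 :: complex fps"
  have X0: "fps_nth (fps_X ^ 2 :: complex fps) 0 = 0" by simp
  have b: "of_nat (n - 1) * (1/2) = b" using assms by (simp add: b_def of_nat_diff)
  \<comment> \<open>The center \<open>(n - 1)/2\<close> of the Schur substitution is exactly what
    makes \<open>wser^(n-1)\<close> symmetric: \<open>exp(b t) wser^(n-1)\<close> is a power of
    \<open>2 sinh(t/2)\<close>, hence the even series in the result.\<close>
  have "(fps_exp (1/2) * wser) ^ (n - 1) * Aseries n s = fps_exp b * (wser ^ (n - 1) * Aseries n s)"
    by (simp only: power_mult_distrib fps_exp_power_mult b mult.assoc)
  also have "\<dots> = (fps_exp b * fps_exp (- b)) * (fps_X ^ (n - 1) * Sseries n s)"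
    unfolding wser_power_Aseries[OF assms, folded b_def] by (simp only: mult.assoc)
  also have "fps_exp b * fps_exp (- b) = 1" by (simp add: fps_exp_add_mult[symmetric])
  finally have "fps_X ^ (n - 1) * (?h ^ (n - 1) * Aseries n s) = fps_X ^ (n - 1) * Sseries n s"
    by (simp only: sinh_series power_mult_distrib mult.assoc mult_1)
  hence hL: "?h ^ (n - 1) * Aseries n s = Sseries n s" by simp
  have "?h ^ (n - 1) * ?g = (Hser ^ (n - 1) * Gser n) oo fps_X ^ 2"
    by (simp only: fps_compose_mult_distrib[OF X0] fps_compose_power[OF X0])
  hence "?h ^ (n - 1) * ?g = 1" by (simp only: Hser_power_Gser[OF assms] fps_compose_1)
  hence "Aseries n s = (?h ^ (n - 1) * ?g) * Aseries n s" by (simp only: mult_1)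
  also have "\<dots> = ?g * (?h ^ (n - 1) * Aseries n s)" by (simp only: mult_ac)
  finally have "Aseries n s = ?g * Sseries n s" by (simp only: hL)
  hence "fps_nth (Aseries n s) m = (\<Sum>i\<le>m. fps_nth ?g i * fps_nth (Sseries n s) (m - i))"
    by (simp add: fps_mult_nth atLeast0AtMost)
  also have "\<dots> = (\<Sum>i\<in>(\<lambda>k. 2 * k) ` {..m div 2}. fps_nth ?g i * fps_nth (Sseries n s) (m - i))"
    by (rule sum.mono_neutral_right) (auto simp: fps_nth_compose_X_power elim!: evenE)
  also have "\<dots> = (\<Sum>k\<le>m div 2. fps_nth ?g (2 * k) * fps_nth (Sseries n s) (m - 2 * k))"
    by (subst sum.reindex) (auto simp: inj_on_def)
  finally show ?thesis by (simp add: fps_nth_compose_X_power Gser_def Sseries_def)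
qed

lemma poly_rising_of_nat:
  assumes "n \<ge> 1" "k \<le> m"
  shows "poly (rising k m) (of_nat n) = fact (n - 1 + m) / fact (n - 1 + k)"
  using assms(2)
proof (induction m rule: dec_induct)
  case base
  show ?case by (simp add: rising_self)
next
  case (step m)
  have "fact (n - 1 + Suc m) = of_nat (Suc (n - 1 + m)) * (fact (n - 1 + m) :: complex)"
    by (simp only: add_Suc_right fact_Suc)
  also have "Suc (n - 1 + m) = n + m" using assms(1) by simp
  finally have "fact (n - 1 + Suc m) = (of_nat n + of_nat m) * (fact (n - 1 + m) :: complex)"
    by (simp only: of_nat_add)
  moreover have "poly (rising k (Suc m)) (of_nat n) = (of_nat n + of_nat m) * poly (rising k m) (of_nat n)"
    using step.hyps by (simp add: rising_Suc algebra_simps)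
  ultimately show ?case using step.IH by (simp only: times_divide_eq_right)
qed

text \<open>At positive integers the falling factorial is the ratio of the factorial weights in
  \<open>Aseries\<close> and \<open>Sseries\<close>.\<close>

lemma poly_ffact_shift:
  assumes "n \<ge> 1" "l \<le> m"
  shows "poly (ffact_shift m l) (of_nat n) = fact (n - 1 + m) / fact (n - 1 + (m - l))"
  using assms(2)
proof (induction l)
  case 0
  show ?case by (simp add: ffact_shift_def)
next
  case (Suc l)
  have "n - 1 + (m - l) = Suc (n - 1 + (m - Suc l))" using Suc.prems by simp
  hence "(fact (n - 1 + (m - l)) :: complex) = of_nat (n - 1 + (m - l)) * fact (n - 1 + (m - Suc l))"
    by (metis fact_Suc)
  moreover have "of_nat (n - 1 + (m - l)) = (of_nat m - 1 - of_nat l + of_nat n :: complex)"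
    using Suc.prems assms(1) by (simp add: of_nat_diff)
  ultimately have f: "(fact (n - 1 + (m - l)) :: complex) = (of_nat m - 1 - of_nat l + of_nat n) * fact (n - 1 + (m - Suc l))"
    by simp
  have nz: "(of_nat m - 1 - of_nat l + of_nat n :: complex) \<noteq> 0" using f by (metis fact_nonzero mult_zero_left)
  have ih: "poly (ffact_shift m l) (of_nat n) =
      fact (n - 1 + m) / ((of_nat m - 1 - of_nat l + of_nat n) * fact (n - 1 + (m - Suc l)))"
    using Suc.IH[OF Suc_leD[OF Suc.prems]] unfolding f .
  have p: "poly (ffact_shift m (Suc l)) (of_nat n) = poly (ffact_shift m l) (of_nat n) * (of_nat m - 1 - of_nat l + of_nat n)"
    by (simp add: ffact_shift_def poly_prod algebra_simps)
  show ?case unfolding p ih using nz by simp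
qed

theorem theorem8:
  shows "\<exists>a :: nat \<Rightarrow> complex poly.
     a 0 = 1 \<and> (\<forall>k. degree (a k) = k) \<and>
     (\<forall>m\<ge>1. Phi (A_elem m) =
        (\<Sum>k\<le>m div 2. mconst ((-1) ^ k * a k * ffact_shift m (2 * k)) * Svar (m - 2 * k)))"
proof (intro exI conjI allI impI)
  \<comment> \<open>The sign in the witness cancels the \<open>(-1)^k\<close> of the formula, as
    \<open>gpoly\<close> already carries the sign.\<close>
  let ?a = "\<lambda>k. smult ((-1) ^ k) (gpoly k)"
  show "?a 0 = 1" by (simp add: gpoly_0)
  show "degree (?a k) = k" for k by (simp add: degree_gpoly)
  fix m :: nat assume "m \<ge> 1"
  let ?R = "\<Sum>k\<le>m div 2. mconst ((-1) ^ k * ?a k * ffact_shift m (2 * k)) * Svar (m - 2 * k)"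
  have "Phi (A_elem m) - ?R = 0"
  proof (rule evc_separates)
    \<comment> \<open>The identity is checked at integers \<open>n \<ge> 1\<close>, where
      \<open>(n - 1 + m)!\<close> turns the coefficients of the two series back into polynomials in
      \<open>n\<close>.\<close>
    fix n :: nat and s assume n: "n \<ge> 1"
    let ?F = "fact (n - 1 + m) :: complex"
    have "evc n s (Phi (A_elem m)) = 1 / fact m * (\<Sum>k\<le>m. signed_stirling m k * fact k * poly (rising k m) (of_nat n) * zeta n s k)"
      unfolding evc_Phi A_elem_zhat evc_mult evc_sum evc_zhat[OF n] evc_mconst by simp
    also have "\<dots> = ?F * (\<Sum>k\<le>m. zeta n s k / fact (n - 1 + k) * (signed_stirling m k * fact k / fact m))"
      unfolding sum_distrib_left by (intro sum.cong refl) (simp add: poly_rising_of_nat[OF n] mult_ac)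
    also have "(\<Sum>k\<le>m. zeta n s k / fact (n - 1 + k) * (signed_stirling m k * fact k / fact m)) = fps_nth (Aseries n s) m"
      by (simp add: Aseries_def lsum_def wser_power_nth)
    also have "?F * fps_nth (Aseries n s) m =
       (\<Sum>k\<le>m div 2. poly (gpoly k) (of_nat n) * (?F / fact (n - 1 + (m - 2 * k))) * Sval s (m - 2 * k))"
      unfolding Aseries_nth[OF n] sum_distrib_left by (intro sum.cong refl) simp
    also have "\<dots> = (\<Sum>k\<le>m div 2. poly (gpoly k) (of_nat n) * poly (ffact_shift m (2 * k)) (of_nat n) * Sval s (m - 2 * k))"
      by (intro sum.cong refl) (subst poly_ffact_shift[OF n], auto)
    also have "\<dots> = evc n s ?R"
    proof -
      have "(-1) ^ k * smult ((-1) ^ k) p = p" for k and p :: "complex poly"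
        by (cases "even k") simp_all
      thus ?thesis by (simp only: evc_sum evc_mult evc_mconst evc_Svar poly_mult)
    qed
    finally show "evc n s (Phi (A_elem m) - ?R) = 0" by (simp add: evc_diff)
  qed
  thus "Phi (A_elem m) = ?R" by simp
qed

end
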